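(* Let $m\ge 1$ and let $T_1,\dots,T_m:[0,1]\to[0,1]$ be $C^1$ maps with $T_i'(x)>0$ for all $x\in[0,1]$, such that $T_i((0,1))\cap T_j((0,1))=\emptyset$ for $i\neq j$, and such that $\operatorname{diam}(T_{i_1}\circ\cdots\circ T_{i_n}([0,1]))\to 0$ as $n\to\infty$, uniformly over all sequences $(i_1,i_2,\dots)\in\{1,\dots,m\}^{\mathbb N}$. Let $f:\Sigma\to\mathbb{R}$ be continuous. Then for every $\alpha\in[\alpha_{\min},\alpha_{\max}]$, \[ \dim \Pi(X_\alpha\cap\tilde\Sigma)=\sup_{\mu\in\mathcal{M}_\sigma(\Sigma)}\left\{\frac{h_\sigma(\mu)}{\lambda(\mu)}:\int f\,d\mu=\alpha\text{ and }\lambda(\mu)>0\right\}. \]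
   Context: $\Sigma=\{1,\dots,m\}^{\mathbb N}$ is the one-sided full shift with the product topology and shift map $\sigma$. The projection $\Pi:\Sigma\to[0,1]$ is $\Pi(\omega)=\lim_{n\to\infty}T_{\omega_1}\circ\cdots\circ T_{\omega_n}(0)$. Define $g:\Sigma\to\mathbb R$ by $g(\omega)=-\log T'_{\omega_1}(\Pi(\sigma\omega))$. For $F:\Sigma\to\mathbb R$ write $A_nF(\omega)=\frac1n\sum_{i=0}^{n-1}F(\sigma^i\omega)$. Let $X_\alpha=\{\omega\in\Sigma:\lim_{n\to\infty}A_nf(\omega)=\alpha\}$ and $\tilde\Sigma=\{\omega\in\Sigma:\liminf_{n\to\infty}A_ng(\omega)>0\}$. $\mathcal M_\sigma(\Sigma)$ denotes the $\sigma$-invariant Borel probability measures on $\Sigma$ and $\mathcal E_\sigma(\Sigma)$ the ergodic ones; $h_\sigma(\mu)$ is the measure-theoretic entropy of $\mu$ and $\lambda(\mu)=\int g\,d\mu$ its Lyapunov exponent. $\alpha_{\min}=\inf_{\mu\in\mathcal E_\sigma(\Sigma)}\int f\,d\mu$ and $\alpha_{\max}=\sup_{\mu\in\mathcal E_\sigma(\Sigma)}\int f\,d\mu$. $\dim$ denotes Hausdorff dimension. *)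

theory Defs
  imports "HOL-Probability.Probability"
begin

text \<open>The full shift on symbols 1..m, sequences indexed from 0
  (omega 0 is the first symbol). Topology: the product topology on nat => nat
  (nat discrete). Measurable structure: the product sigma algebra.\<close>

definition full_shift :: "nat \<Rightarrow> (nat \<Rightarrow> nat) set" where
  "full_shift m = {\<omega>. \<forall>i. \<omega> i \<in> {1..m}}"

definition shift_space :: "nat \<Rightarrow> (nat \<Rightarrow> nat) measure" where
  "shift_space m = (\<Pi>\<^sub>M i\<in>(UNIV::nat set). count_space {1..m})"

definition shift :: "(nat \<Rightarrow> nat) \<Rightarrow> (nat \<Rightarrow> nat)" where
  "shift \<omega> = (\<lambda>i. \<omega> (Suc i))"

definition birkhoff_avg :: "((nat \<Rightarrow> nat) \<Rightarrow> real) \<Rightarrow> nat \<Rightarrow> (nat \<Rightarrow> nat) \<Rightarrow> real" where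
  "birkhoff_avg F n \<omega> = (\<Sum>i<n. F ((shift ^^ i) \<omega>)) / real n"

definition invariant_measures :: "nat \<Rightarrow> (nat \<Rightarrow> nat) measure set" where
  "invariant_measures m = {\<mu>. sets \<mu> = sets (shift_space m) \<and> prob_space \<mu> \<and>
     (\<forall>A \<in> sets \<mu>. emeasure \<mu> (shift -` A \<inter> space \<mu>) = emeasure \<mu> A)}"

definition ergodic_measures :: "nat \<Rightarrow> (nat \<Rightarrow> nat) measure set" where
  "ergodic_measures m = {\<mu> \<in> invariant_measures m.
     \<forall>A \<in> sets \<mu>. shift -` A \<inter> space \<mu> = A \<longrightarrow> measure \<mu> A = 0 \<or> measure \<mu> A = 1}"

definition ent_fun :: "real \<Rightarrow> real" where
  "ent_fun p = (if p \<le> 0 then 0 else - p * ln p)"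

definition fin_partition :: "'a measure \<Rightarrow> 'a set set \<Rightarrow> bool" where
  "fin_partition \<mu> P \<longleftrightarrow> finite P \<and> P \<subseteq> sets \<mu> \<and> disjoint P \<and> \<Union>P = space \<mu>"

definition partition_entropy :: "'a measure \<Rightarrow> 'a set set \<Rightarrow> real" where
  "partition_entropy \<mu> P = (\<Sum>A\<in>P. ent_fun (measure \<mu> A))"

definition dyn_join :: "'a measure \<Rightarrow> ('a \<Rightarrow> 'a) \<Rightarrow> 'a set set \<Rightarrow> nat \<Rightarrow> 'a set set" where
  "dyn_join \<mu> T P n = {C. C \<noteq> {} \<and>
     (\<exists>w \<in> {0..<n} \<rightarrow>\<^sub>E P. C = {x \<in> space \<mu>. \<forall>i<n. (T ^^ i) x \<in> w i})}"

definition entropy_rel :: "'a measure \<Rightarrow> ('a \<Rightarrow> 'a) \<Rightarrow> 'a set set \<Rightarrow> real" where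
  "entropy_rel \<mu> T P = lim (\<lambda>n. partition_entropy \<mu> (dyn_join \<mu> T P n) / real n)"

definition ks_entropy :: "'a measure \<Rightarrow> ('a \<Rightarrow> 'a) \<Rightarrow> real" where
  "ks_entropy \<mu> T = (SUP P \<in> {P. fin_partition \<mu> P}. entropy_rel \<mu> T P)"

definition hausdorff_content :: "real \<Rightarrow> real \<Rightarrow> 'a::metric_space set \<Rightarrow> ennreal" where
  "hausdorff_content s \<delta> E =
     (INF U \<in> {U :: nat \<Rightarrow> 'a set. E \<subseteq> (\<Union>i. U i) \<and> (\<forall>i. bounded (U i) \<and> diameter (U i) \<le> \<delta>)}.
        \<Sum>i. ennreal (diameter (U i) powr s))"

definition hausdorff_measure :: "real \<Rightarrow> 'a::metric_space set \<Rightarrow> ennreal" where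
  "hausdorff_measure s E = (SUP \<delta> \<in> {0<..}. hausdorff_content s \<delta> E)"

definition hausdorff_dim :: "'a::metric_space set \<Rightarrow> real" where
  "hausdorff_dim E = Inf {s. s > 0 \<and> hausdorff_measure s E = 0}"

definition compose_word :: "(nat \<Rightarrow> real \<Rightarrow> real) \<Rightarrow> (nat \<Rightarrow> nat) \<Rightarrow> nat \<Rightarrow> real \<Rightarrow> real" where
  "compose_word T \<omega> n = foldr (\<lambda>i f. T (\<omega> i) \<circ> f) [0..<n] id"

definition coding :: "(nat \<Rightarrow> real \<Rightarrow> real) \<Rightarrow> (nat \<Rightarrow> nat) \<Rightarrow> real" where
  "coding T \<omega> = lim (\<lambda>n. compose_word T \<omega> n 0)"

text \<open>g(omega) = - log T'_{omega_1}(Pi(sigma omega)), with DT i the derivative of T i.\<close>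
definition geom_pot :: "(nat \<Rightarrow> real \<Rightarrow> real) \<Rightarrow> (nat \<Rightarrow> real \<Rightarrow> real) \<Rightarrow> (nat \<Rightarrow> nat) \<Rightarrow> real" where
  "geom_pot T DT \<omega> = - ln (DT (\<omega> 0) (coding T (shift \<omega>)))"

end

theory Submission
  imports Defs
begin

text \<open>
  Write \<open>D\<^sub>n(\<omega>)\<close> for the length of the \<open>n\<close>-th cylinder interval of \<open>\<omega>\<close>. Since \<open>log T\<^sub>i'\<close> is uniformly
  continuous and the cylinders shrink uniformly, \<open>- log D\<^sub>n\<close> and the Birkhoff sum of \<open>g\<close> differ by
  \<open>o(n)\<close> uniformly in \<open>\<omega>\<close>; no distortion control beyond this is used.

  Upper bound. If the \<open>s\<close>-dimensional measure of the level set is positive, there are \<open>n\<^sub>j \<rightarrow> \<infinity>\<close> and sets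
  \<open>W\<^sub>j\<close> of words of length \<open>n\<^sub>j\<close> on which the average of \<open>f\<close> is close to \<open>\<alpha>\<close>, that of \<open>g\<close> is bounded
  below, and the sum of \<open>D\<^sup>s\<close> is not exponentially small. Empirical measures of orbits weighted in
  proportion to \<open>D\<^sup>s\<close> have entropy about \<open>s\<close> times their Lyapunov exponent; by Misiurewicz's
  argument this passes to a weak limit \<open>\<mu>\<close>, so \<open>h(\<mu>) \<ge> s \<lambda>(\<mu>)\<close> with \<open>\<lambda>(\<mu>) > 0\<close>, and \<open>\<integral>f d\<mu> = \<alpha>\<close>.

  Lower bound. Given \<open>\<mu>\<close>, not necessarily ergodic, draw independent \<open>\<mu>\<close>-random sequences and
  concatenate the first \<open>j + 1\<close> symbols of the \<open>j\<close>-th one. By invariance each block has exactly the right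
  mean, and Hoeffding's inequality with Borel-Cantelli shows that almost every concatenation has Birkhoff
  averages \<open>\<alpha>\<close> and \<open>\<lambda>(\<mu>)\<close>, while the mass of its cylinders decays at rate at least \<open>h(\<mu>)\<close>. The mass
  distribution principle applies because a set of diameter \<open>r\<close> meets at most five
  cylinder intervals of one generation of length at least \<open>r\<close>.
\<close>

subsection \<open>Words, cylinders and Birkhoff sums on the full shift\<close>

text \<open>The maps are only C^1 and may have neutral fixed points, so every comparison of lengths
  with Birkhoff sums carries a factor exp(o(n)). Such factors are harmless because the decisive gap,
  between the entropy and s times the exponent, is linear in n. Positivity of the liminf of the
  averages of g is used through a uniform bound d > 0 on countably many pieces of the level set; a
  bound of this kind survives weak limits and keeps the limit exponent away from 0. The block
  lengths j + 1 are a compromise. They grow, so that what is lost once per block, at its end or in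
  its mean information, vanishes per symbol. They are negligible against the total length, about J^2
  / 2, so that block ends suffice both as times and as scales. Independence of the blocks does the
  work of ergodicity: the averages of one concatenation tend to the integrals of \<mu> itself, not
  of an ergodic component. Entropy is seen only through words: it is the infimum of H_n / n over n,
  H_n being the entropy of the first n symbols. One inequality serves the upper bound and the other
  the lower bound.\<close>

definition pre :: "nat \<Rightarrow> (nat \<Rightarrow> 'a) \<Rightarrow> 'a list" where
  "pre n \<omega> = map \<omega> [0..<n]"

definition words :: "nat \<Rightarrow> nat \<Rightarrow> nat list set" where
  "words m n = {w. length w = n \<and> set w \<subseteq> {1..m}}"

text \<open>Padding with the letter 1 selects a point in the cylinder of w, provided the alphabet is
  nonempty.\<close>

definition ext :: "nat list \<Rightarrow> nat \<Rightarrow> nat" where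
  "ext w i = (if i < length w then w ! i else 1)"

definition bsum :: "((nat \<Rightarrow> nat) \<Rightarrow> real) \<Rightarrow> nat \<Rightarrow> (nat \<Rightarrow> nat) \<Rightarrow> real" where
  "bsum F n \<omega> = (\<Sum>i<n. F ((shift ^^ i) \<omega>))"

text \<open>Uniform continuity expressed through words. For functions on the full shift it follows
  from continuity by compactness, and it is the form in which both f and g enter all
  estimates.\<close>

definition cyl_cont :: "nat \<Rightarrow> ((nat \<Rightarrow> nat) \<Rightarrow> real) \<Rightarrow> bool" where
  "cyl_cont m F \<longleftrightarrow> (\<forall>e>0. \<exists>q. \<forall>\<omega>\<in>full_shift m. \<forall>\<omega>'\<in>full_shift m.
      pre q \<omega> = pre q \<omega>' \<longrightarrow> \<bar>F \<omega> - F \<omega>'\<bar> \<le> e)"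

lemma length_pre [simp]: "length (pre n \<omega>) = n" by (simp add: pre_def)
lemma nth_pre [simp]: "i < n \<Longrightarrow> pre n \<omega> ! i = \<omega> i" by (simp add: pre_def)
lemma pre_0 [simp]: "pre 0 \<omega> = []" by (simp add: pre_def)
lemma pre_Suc: "pre (Suc n) \<omega> = pre n \<omega> @ [\<omega> n]" by (simp add: pre_def)
lemma pre_eq_iff: "pre n \<omega> = pre n \<omega>' \<longleftrightarrow> (\<forall>i<n. \<omega> i = \<omega>' i)" by (auto simp: pre_def)
lemma pre_eq_mono: "pre n \<omega> = pre n \<omega>' \<Longrightarrow> k \<le> n \<Longrightarrow> pre k \<omega> = pre k \<omega>'"
  by (auto simp: pre_eq_iff)
lemma pre_Suc_shift: "pre (Suc n) \<omega> = \<omega> 0 # pre n (shift \<omega>)"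
  unfolding pre_def shift_def map_upt_Suc by simp
lemma pre_add: "pre (k + n) \<omega> = pre k \<omega> @ pre n (\<lambda>i. \<omega> (i + k))"
  by (rule nth_equalityI) (auto simp: nth_append)

lemma shift_funpow: "(shift ^^ k) \<omega> = (\<lambda>i. \<omega> (i + k))"
  by (induction k arbitrary: \<omega>) (auto simp: shift_def)

lemma pre_eq_shift: "pre n \<omega> = pre n \<omega>' \<Longrightarrow> pre (n - k) ((shift ^^ k) \<omega>) = pre (n - k) ((shift ^^ k) \<omega>')"
  by (auto simp: pre_eq_iff shift_funpow)

lemma bsum_0 [simp]: "bsum F 0 \<omega> = 0" by (simp add: bsum_def)

lemma bsum_Suc: "bsum F (Suc n) \<omega> = F \<omega> + bsum F n (shift \<omega>)"
proof -
  have "(\<Sum>i<Suc n. F ((shift ^^ i) \<omega>)) = F \<omega> + (\<Sum>i<n. F ((shift ^^ Suc i) \<omega>))"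
    by (subst sum.lessThan_Suc_shift) simp
  then show ?thesis by (simp only: bsum_def funpow_Suc_right o_def)
qed

lemma bsum_add: "bsum F (k + n) \<omega> = bsum F k \<omega> + bsum F n ((shift ^^ k) \<omega>)"
proof (induction k arbitrary: \<omega>)
  case (Suc k)
  have "(shift ^^ k) (shift \<omega>) = (shift ^^ Suc k) \<omega>" by (simp only: funpow_Suc_right o_def)
  then show ?case using Suc[of "shift \<omega>"] by (simp add: bsum_Suc del: funpow.simps)
qed simp

lemma birkhoff_avg_bsum: "birkhoff_avg F n \<omega> = bsum F n \<omega> / real n"
  by (simp add: birkhoff_avg_def bsum_def)

lemma full_shiftD: "\<omega> \<in> full_shift m \<Longrightarrow> \<omega> i \<in> {1..m}" by (simp add: full_shift_def)
lemma full_shift_shift: "\<omega> \<in> full_shift m \<Longrightarrow> shift \<omega> \<in> full_shift m"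
  by (simp add: full_shift_def shift_def)
lemma full_shift_funpow: "\<omega> \<in> full_shift m \<Longrightarrow> (shift ^^ k) \<omega> \<in> full_shift m"
  by (simp add: full_shift_def shift_funpow)

lemma finite_words: "finite (words m n)"
  using finite_lists_length_eq[of "{1..m}" n] by (simp add: words_def conj_commute)
lemma card_words: "card (words m n) = m ^ n"
  using card_lists_length_eq[of "{1..m}" n] by (simp add: words_def conj_commute)
lemma pre_in_words: "\<omega> \<in> full_shift m \<Longrightarrow> pre n \<omega> \<in> words m n"
  by (auto simp: words_def pre_def full_shift_def)
lemma words_0 [simp]: "words m 0 = {[]}" by (auto simp: words_def)

lemma words_Suc: "words m (Suc n) = (\<lambda>(w, a). w @ [a]) ` (words m n \<times> {1..m})"
proof -
  have "w \<in> (\<lambda>(w, a). w @ [a]) ` (words m n \<times> {1..m})" if "w \<in> words m (Suc n)" for w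
    using that by (cases w rule: rev_cases) (auto simp: words_def image_iff)
  then show ?thesis by (auto simp: words_def)
qed

lemma ext_full_shift: "w \<in> words m n \<Longrightarrow> m \<ge> 1 \<Longrightarrow> ext w \<in> full_shift m"
  using nth_mem[of _ w] by (auto simp: words_def full_shift_def ext_def subset_iff)
lemma pre_ext: "length w = n \<Longrightarrow> pre n (ext w) = w"
  by (rule nth_equalityI) (auto simp: ext_def)

section \<open>Measurable structure of the full shift\<close>

lemma space_shift_space [simp]: "space (shift_space m) = full_shift m"
  by (auto simp: shift_space_def space_PiM full_shift_def PiE_def Pi_def)

lemma measurable_coord [measurable]: "(\<lambda>\<omega>. \<omega> i) \<in> measurable (shift_space m) (count_space UNIV)"
proof -
  have "(\<lambda>\<omega>. \<omega> i) \<in> measurable (shift_space m) (count_space {1..m})"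
    unfolding shift_space_def by measurable
  then show ?thesis
    by (rule measurable_compose) auto
qed

lemma measurable_pre [measurable]: "pre n \<in> measurable (shift_space m) (count_space UNIV)"
proof (subst measurable_count_space_eq_countable, safe)
  fix w :: "nat list"
  have "pre n -` {w} \<inter> space (shift_space m)
      = (if length w = n then {\<omega> \<in> space (shift_space m). \<forall>i\<in>{..<n}. \<omega> i = w ! i} else {})"
    by (auto simp: list_eq_iff_nth_eq)
  also have "\<dots> \<in> sets (shift_space m)"
  proof -
    have [measurable]: "Measurable.pred (shift_space m) (\<lambda>\<omega>. \<omega> i = w ! i)" for i
      by (rule measurable_compose[OF measurable_coord]) simp
    show ?thesis by (simp del: space_shift_space)
  qed
  finally show "pre n -` {w} \<inter> space (shift_space m) \<in> sets (shift_space m)" .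
qed auto

lemma measurable_shift [measurable]: "shift \<in> measurable (shift_space m) (shift_space m)"
  unfolding shift_space_def shift_def
  by (rule measurable_PiM_single') (auto simp: space_PiM intro!: measurable_component_singleton)

lemma measurable_shift_funpow [measurable]: "(shift ^^ k) \<in> measurable (shift_space m) (shift_space m)"
proof (induction k)
  case (Suc k)
  then show ?case using measurable_compose[OF Suc measurable_shift] by (simp add: o_def)
qed (simp add: id_def[symmetric])

text \<open>The empty set is added to make the family stable under intersection, since two cylinders
  are nested or disjoint.\<close>

definition cylinders :: "nat \<Rightarrow> (nat \<Rightarrow> nat) set set" where
  "cylinders m = insert {} {{\<omega> \<in> full_shift m. pre n \<omega> = w} | n w. w \<in> words m n}"

lemma cylinder_sets [measurable]: "{\<omega> \<in> full_shift m. pre n \<omega> \<in> U} \<in> sets (shift_space m)"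
  using measurable_sets[OF measurable_pre[of n m], of U]
  by (simp add: vimage_def Int_def conj_commute)

lemma cylinders_subset: "cylinders m \<subseteq> sets (shift_space m)"
proof -
  have "{\<omega> \<in> full_shift m. pre n \<omega> = w} \<in> sets (shift_space m)" for n w
    using cylinder_sets[of m n "{w}"] by simp
  then show ?thesis by (auto simp: cylinders_def)
qed

text \<open>A condition on the symbol at position i is a finite union of cylinders of length i + 1,
  so cylinders generate all coordinate sets.\<close>

lemma sets_shift_space_cylinders: "sets (shift_space m) = sigma_sets (full_shift m) (cylinders m)"
proof
  have "sigma_sets (space (shift_space m)) (cylinders m) \<subseteq> sets (shift_space m)"
    by (rule sets.sigma_sets_subset) (use cylinders_subset in auto)
  then show "sigma_sets (full_shift m) (cylinders m) \<subseteq> sets (shift_space m)" by simp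
  interpret S: sigma_algebra "full_shift m" "sigma_sets (full_shift m) (cylinders m)"
    by (rule sigma_algebra_sigma_sets) (auto simp: cylinders_def)
  let ?N = "measure_of (full_shift m) (cylinders m) (\<lambda>_. 0)"
  have Ns: "sets ?N = sigma_sets (full_shift m) (cylinders m)" "space ?N = full_shift m"
    by (auto simp: sets_measure_of_conv space_measure_of_conv cylinders_def)
  have PF: "space (shift_space m) = (\<Pi>\<^sub>E i\<in>UNIV. space (count_space {1..m}))"
    unfolding shift_space_def by (simp add: space_PiM)
  have "sets (PiM UNIV (\<lambda>_. count_space {1..m})) \<subseteq> sets ?N"
  proof (rule sets_PiM_in_sets)
    show "space ?N = (\<Pi>\<^sub>E i\<in>UNIV. space (count_space {1..m}))" using PF Ns by simp
    fix i :: nat and A assume "A \<in> sets (count_space {1..m})"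
    have "{\<omega> \<in> space ?N. \<omega> i \<in> A}
        = (\<Union>w\<in>{w \<in> words m (Suc i). w ! i \<in> A}. {\<omega> \<in> full_shift m. pre (Suc i) \<omega> = w})"
      unfolding Ns using pre_in_words[of _ m "Suc i"] by auto
    also have "\<dots> \<in> sets ?N"
      unfolding Ns by (rule S.finite_UN) (auto simp: finite_words cylinders_def intro!: sigma_sets.Basic)
    finally show "{\<omega> \<in> space ?N. \<omega> i \<in> A} \<in> sets ?N" .
  qed
  then show "sets (shift_space m) \<subseteq> sigma_sets (full_shift m) (cylinders m)"
    unfolding Ns shift_space_def .
qed

text \<open>Uniqueness on an intersection-stable generator. The word of length 0 gives the whole
  space, so the hypothesis also fixes the total mass of \<open>N\<close>.\<close>

lemma measure_eqI_cylinders: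
  assumes M: "sets M = sets (shift_space m)" "prob_space M" and N: "sets N = sets (shift_space m)"
    and eq: "\<And>n w. w \<in> words m n \<Longrightarrow> emeasure M {\<omega> \<in> full_shift m. pre n \<omega> = w} = emeasure N {\<omega> \<in> full_shift m. pre n \<omega> = w}"
  shows "M = N"
proof -
  interpret prob_space M by fact
  let ?G = "cylinders m"
  note G_def = cylinders_def
  note gen = sets_shift_space_cylinders
  have "Int_stable ?G"
  proof (rule Int_stableI)
    fix A B assume AB: "A \<in> ?G" "B \<in> ?G"
    show "A \<inter> B \<in> ?G"
    proof (cases "A = {} \<or> B = {} \<or> A \<inter> B = {}")
      case True
      then show ?thesis by (auto simp: G_def)
    next
      case False
      then obtain n w k v where *: "A = {\<omega> \<in> full_shift m. pre n \<omega> = w}" "w \<in> words m n"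
        "B = {\<omega> \<in> full_shift m. pre k \<omega> = v}" "v \<in> words m k" using AB by (auto simp: G_def)
      obtain \<omega> where \<omega>: "\<omega> \<in> A" "\<omega> \<in> B" using False by auto
      have "A \<inter> B = A \<or> A \<inter> B = B"
      proof (cases "n \<le> k")
        case True
        have "B \<subseteq> A"
        proof
          fix x assume "x \<in> B"
          then have "pre k x = pre k \<omega>" "x \<in> full_shift m" using \<omega> by (auto simp: *)
          then show "x \<in> A" using pre_eq_mono[of k x \<omega> n] True \<omega> by (auto simp: *)
        qed
        then show ?thesis by auto
      next
        case False
        have "A \<subseteq> B"
        proof
          fix x assume "x \<in> A"
          then have "pre n x = pre n \<omega>" "x \<in> full_shift m" using \<omega> by (auto simp: *)
          then show "x \<in> B" using pre_eq_mono[of n x \<omega> k] False \<omega> by (auto simp: *)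
        qed
        then show ?thesis by auto
      qed
      then show ?thesis using AB by auto
    qed
  qed
  show ?thesis
  proof (rule measure_eqI_generator_eq[where E = ?G and \<Omega> = "full_shift m" and A = "\<lambda>_. full_shift m"])
    show "Int_stable ?G" by fact
    show "?G \<subseteq> Pow (full_shift m)" by (auto simp: G_def)
    show "emeasure M X = emeasure N X" if "X \<in> ?G" for X using that eq by (auto simp: G_def)
    show "sets M = sigma_sets (full_shift m) ?G" "sets N = sigma_sets (full_shift m) ?G" using M N gen by auto
    show "range (\<lambda>_::nat. full_shift m) \<subseteq> ?G"
      using words_0[of m] by (auto simp: G_def intro!: exI[of _ 0] exI[of _ "[]"])
    show "emeasure M (full_shift m) \<noteq> \<infinity>" by simp
  qed auto
qed

section \<open>Compactness of product spaces and uniform continuity on cylinders\<close>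

lemma compact_PiE_UNIV:
  fixes S :: "'i \<Rightarrow> 'a::topological_space set"
  assumes "\<And>i. compact (S i)" shows "compact (PiE UNIV S)"
proof -
  have "compactin (product_topology (\<lambda>i. euclidean) UNIV) (PiE UNIV S)"
    by (subst compactin_PiE) (use assms in auto)
  then show ?thesis by (metis compactin_euclidean_iff euclidean_product_topology)
qed

lemma compact_full_shift: "compact (full_shift m)"
proof -
  have "full_shift m = PiE UNIV (\<lambda>_. {1..m})"
    by (auto simp: full_shift_def PiE_def Pi_def)
  moreover have "compact (PiE UNIV (\<lambda>_::nat. {1..m}))"
    by (rule compact_PiE_UNIV) (rule finite_imp_compact, simp)
  ultimately show ?thesis by simp
qed

lemma open_cylinder: "open {\<omega>'. pre q \<omega>' = pre q (\<omega> :: nat \<Rightarrow> nat)}"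
proof -
  have "{\<omega>'. pre q \<omega>' = pre q \<omega>} = PiE UNIV (\<lambda>i. if i < q then {\<omega> i} else UNIV)"
    by (auto simp: pre_eq_iff PiE_def Pi_def split: if_splits)
  moreover have "open (PiE UNIV (\<lambda>i. if i < q then {\<omega> i} else UNIV))"
    by (rule open_PiE) (auto simp: discrete_topology_class.open_discrete)
  ultimately show ?thesis by simp
qed

text \<open>A basic open set of the product topology restricts finitely many coordinates; q only has
  to exceed all of them.\<close>

lemma open_contains_cylinder:
  fixes \<omega> :: "nat \<Rightarrow> nat"
  assumes "open U" "\<omega> \<in> U" shows "\<exists>q. {\<omega>'. pre q \<omega>' = pre q \<omega>} \<subseteq> U"
proof -
  obtain X where X: "\<omega> \<in> PiE UNIV X" "finite {i. X i \<noteq> UNIV}" "PiE UNIV X \<subseteq> U"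
    using product_topology_open_contains_basis[of "\<lambda>_. euclidean" UNIV U \<omega>] assms
    by (auto simp: open_fun_def)
  obtain q where q: "\<And>i. X i \<noteq> UNIV \<Longrightarrow> i < q"
    using X(2) finite_nat_set_iff_bounded[of "{i. X i \<noteq> UNIV}"] by auto
  have "{\<omega>'. pre q \<omega>' = pre q \<omega>} \<subseteq> PiE UNIV X"
  proof
    fix \<omega>' assume "\<omega>' \<in> {\<omega>'. pre q \<omega>' = pre q \<omega>}"
    then have "\<omega>' i \<in> X i" for i
      using q[of i] X(1) by (cases "X i = UNIV") (auto simp: pre_eq_iff PiE_def Pi_def)
    then show "\<omega>' \<in> PiE UNIV X" by auto
  qed
  then show ?thesis using X(3) by blast
qed

text \<open>Heine-Cantor with cylinders in place of balls: around each point F varies by less than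
  e/2 on some cylinder, finitely many of these cover the space, and the longest of their words gives
  a common depth.\<close>

lemma continuous_imp_cyl_cont:
  assumes "continuous_on (full_shift m) F" shows "cyl_cont m F"
  unfolding cyl_cont_def
proof safe
  fix e :: real assume "e > 0"
  have "\<exists>q. \<forall>\<omega>'\<in>full_shift m. pre q \<omega>' = pre q \<omega> \<longrightarrow> \<bar>F \<omega>' - F \<omega>\<bar> < e/2" if "\<omega> \<in> full_shift m" for \<omega>
  proof -
    have "\<exists>A. open A \<and> \<omega> \<in> A \<and> (\<forall>y\<in>full_shift m. y \<in> A \<longrightarrow> F y \<in> ball (F \<omega>) (e/2))"
      using assms[unfolded continuous_on_topological, THEN bspec, OF that, THEN spec, of "ball (F \<omega>) (e/2)"] \<open>e > 0\<close>
      by simp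
    then obtain A where A: "open A" "\<omega> \<in> A" "\<And>y. y \<in> full_shift m \<Longrightarrow> y \<in> A \<Longrightarrow> dist (F \<omega>) (F y) < e/2"
      unfolding mem_ball by blast
    obtain q where q: "{\<omega>'. pre q \<omega>' = pre q \<omega>} \<subseteq> A"
      using open_contains_cylinder[OF A(1,2)] by blast
    have "\<bar>F \<omega>' - F \<omega>\<bar> < e/2" if "\<omega>' \<in> full_shift m" "pre q \<omega>' = pre q \<omega>" for \<omega>'
      using A(3)[of \<omega>'] q that by (auto simp: dist_real_def abs_minus_commute)
    then show ?thesis by blast
  qed
  then obtain q where q: "\<And>\<omega> \<omega>'. \<omega> \<in> full_shift m \<Longrightarrow> \<omega>' \<in> full_shift m \<Longrightarrow> pre (q \<omega>) \<omega>' = pre (q \<omega>) \<omega> \<Longrightarrow> \<bar>F \<omega>' - F \<omega>\<bar> < e/2"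
    by metis
  have "full_shift m \<subseteq> (\<Union>\<omega>\<in>full_shift m. {\<omega>'. pre (q \<omega>) \<omega>' = pre (q \<omega>) \<omega>})" by auto
  then obtain S where S: "S \<subseteq> full_shift m" "finite S" "full_shift m \<subseteq> (\<Union>\<omega>\<in>S. {\<omega>'. pre (q \<omega>) \<omega>' = pre (q \<omega>) \<omega>})"
    by (rule compactE_image[OF compact_full_shift _, rotated]) (blast, rule open_cylinder)
  \<comment> \<open>The 0 keeps \<open>Max\<close> meaningful when the cover is empty, as for m =
    0.\<close>
  define Q where "Q = Max (insert 0 (q ` S))"
  have "\<bar>F \<omega> - F \<omega>'\<bar> \<le> e" if *: "\<omega> \<in> full_shift m" "\<omega>' \<in> full_shift m" "pre Q \<omega> = pre Q \<omega>'" for \<omega> \<omega>'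
  proof -
    obtain z where z: "z \<in> S" "pre (q z) \<omega> = pre (q z) z" using S(3) *(1) by blast
    have "q z \<le> Q" using S(2) z(1) by (auto simp: Q_def)
    then have "pre (q z) \<omega>' = pre (q z) z" using pre_eq_mono[OF *(3)] z(2) by simp
    then have "\<bar>F \<omega>' - F z\<bar> < e/2" "\<bar>F \<omega> - F z\<bar> < e/2"
      using q[of z \<omega>'] q[of z \<omega>] S(1) z *(1,2) by auto
    then show ?thesis by linarith
  qed
  then show "\<exists>q. \<forall>\<omega>\<in>full_shift m. \<forall>\<omega>'\<in>full_shift m. pre q \<omega> = pre q \<omega>' \<longrightarrow> \<bar>F \<omega> - F \<omega>'\<bar> \<le> e" by blast
qed

lemma cyl_contD:
  assumes "cyl_cont m F" "e > 0" obtains q where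
    "\<And>\<omega> \<omega>'. \<omega> \<in> full_shift m \<Longrightarrow> \<omega>' \<in> full_shift m \<Longrightarrow> pre q \<omega> = pre q \<omega>' \<Longrightarrow> \<bar>F \<omega> - F \<omega>'\<bar> \<le> e"
  using assms unfolding cyl_cont_def by blast

lemma cyl_cont_bounded:
  assumes "cyl_cont m F" "m \<ge> 1" obtains K where "K > 0" "\<And>\<omega>. \<omega> \<in> full_shift m \<Longrightarrow> \<bar>F \<omega>\<bar> \<le> K"
proof -
  obtain q where q: "\<And>\<omega> \<omega>'. \<omega> \<in> full_shift m \<Longrightarrow> \<omega>' \<in> full_shift m \<Longrightarrow> pre q \<omega> = pre q \<omega>' \<Longrightarrow> \<bar>F \<omega> - F \<omega>'\<bar> \<le> 1"
    using cyl_contD[OF assms(1), of 1] by auto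
  define K where "K = 1 + (\<Sum>w\<in>words m q. \<bar>F (ext w)\<bar>)"
  have "\<bar>F \<omega>\<bar> \<le> K" if "\<omega> \<in> full_shift m" for \<omega>
  proof -
    have w: "pre q \<omega> \<in> words m q" using that by (rule pre_in_words)
    have "\<bar>F \<omega> - F (ext (pre q \<omega>))\<bar> \<le> 1"
      using q[OF that ext_full_shift[OF w assms(2)]] by (simp add: pre_ext)
    moreover have "\<bar>F (ext (pre q \<omega>))\<bar> \<le> (\<Sum>w\<in>words m q. \<bar>F (ext w)\<bar>)"
      using w by (intro member_le_sum finite_words) auto
    ultimately show ?thesis unfolding K_def by linarith
  qed
  moreover have "K > 0" by (simp add: K_def sum_nonneg add_pos_nonneg)
  ultimately show ?thesis using that by blast
qed

text \<open>F is the pointwise limit of functions of finitely many symbols, which are measurable for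
  the product sigma algebra.\<close>

lemma cyl_cont_measurable:
  assumes "cyl_cont m F" "m \<ge> 1" shows "F \<in> borel_measurable (shift_space m)"
proof -
  have "\<forall>n. \<exists>q. \<forall>\<omega>\<in>full_shift m. \<forall>\<omega>'\<in>full_shift m. pre q \<omega> = pre q \<omega>' \<longrightarrow> \<bar>F \<omega> - F \<omega>'\<bar> \<le> inverse (real (Suc n))"
    using assms(1) unfolding cyl_cont_def by simp
  then obtain q where q: "\<And>n \<omega> \<omega>'. \<omega> \<in> full_shift m \<Longrightarrow> \<omega>' \<in> full_shift m \<Longrightarrow> pre (q n) \<omega> = pre (q n) \<omega>' \<Longrightarrow> \<bar>F \<omega> - F \<omega>'\<bar> \<le> inverse (real (Suc n))"
    by metis
  show ?thesis
  proof (rule borel_measurable_LIMSEQ_real)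
    show "(\<lambda>n. F (ext (pre (q n) \<omega>))) \<longlonglongrightarrow> F \<omega>" if "\<omega> \<in> space (shift_space m)" for \<omega>
    proof (rule LIM_zero_cancel, rule Lim_null_comparison[OF _ LIMSEQ_inverse_real_of_nat], rule always_eventually, rule allI)
      fix n
      have \<omega>: "\<omega> \<in> full_shift m" using that by simp
      show "norm (F (ext (pre (q n) \<omega>)) - F \<omega>) \<le> inverse (real (Suc n))"
        unfolding real_norm_def
        by (rule q[OF ext_full_shift[OF pre_in_words[OF \<omega>] assms(2)] \<omega>]) (simp add: pre_ext)
    qed
    show "(\<lambda>\<omega>. F (ext (pre (q n) \<omega>))) \<in> borel_measurable (shift_space m)" for n
      by (rule measurable_compose[OF measurable_pre]) simp
  qed
qed

text \<open>A telescoping bound in which the point may change at every step, from x to y, as it does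
  when the first symbol is removed. The steps from n < N cost K each, all others e.\<close>

lemma cesaro_bound:
  fixes r :: "nat \<Rightarrow> 'b \<Rightarrow> real"
  assumes r0: "\<And>x. r 0 x = 0"
    and step: "\<And>n x. P (Suc n) x \<Longrightarrow> \<exists>y. P n y \<and> \<bar>r (Suc n) x - r n y\<bar> \<le> K \<and> (n \<ge> N \<longrightarrow> \<bar>r (Suc n) x - r n y\<bar> \<le> e)"
    and "e \<ge> 0" "K \<ge> 0"
  shows "P n x \<Longrightarrow> \<bar>r n x\<bar> \<le> real N * K + real n * e"
proof -
  have "P n x \<Longrightarrow> \<bar>r n x\<bar> \<le> real (min n N) * K + real n * e"
  proof (induction n arbitrary: x)
    case 0
    then show ?case using r0 by simp
  next
    case (Suc n)
    obtain y where y: "P n y" "\<bar>r (Suc n) x - r n y\<bar> \<le> K" "n \<ge> N \<Longrightarrow> \<bar>r (Suc n) x - r n y\<bar> \<le> e"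
      using step[OF Suc.prems] by blast
    have IH: "\<bar>r n y\<bar> \<le> real (min n N) * K + real n * e" using Suc.IH[OF y(1)] .
    show ?case
    proof (cases "n \<ge> N")
      case True
      then show ?thesis using IH y(3) by (simp add: algebra_simps min_absorb2)
    next
      case False
      then show ?thesis using IH y(2) \<open>e \<ge> 0\<close> by (simp add: algebra_simps min_absorb1)
    qed
  qed
  moreover have "real (min n N) * K \<le> real N * K" using \<open>K \<ge> 0\<close> by (intro mult_right_mono) auto
  ultimately show "P n x \<Longrightarrow> ?thesis" by linarith
qed

text \<open>Increments that tend to 0 uniformly give r n = o(n) uniformly. The e/2 pays for the late
  steps, and n is taken so large that the early cost \<open>N * K\<close> is at most n e/2.\<close>

lemma cesaro_uniform:
  fixes r :: "nat \<Rightarrow> 'b \<Rightarrow> real"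
  assumes r0: "\<And>x. r 0 x = 0" and "K \<ge> 0"
    and step: "\<And>e. e > 0 \<Longrightarrow> \<exists>N. \<forall>n x. P (Suc n) x \<longrightarrow>
      (\<exists>y. P n y \<and> \<bar>r (Suc n) x - r n y\<bar> \<le> K \<and> (n \<ge> N \<longrightarrow> \<bar>r (Suc n) x - r n y\<bar> \<le> e))"
    and "e > 0"
  shows "\<exists>N. \<forall>n x. n \<ge> N \<longrightarrow> P n x \<longrightarrow> \<bar>r n x\<bar> \<le> real n * e"
proof -
  obtain N where N: "\<And>n x. P (Suc n) x \<Longrightarrow>
      (\<exists>y. P n y \<and> \<bar>r (Suc n) x - r n y\<bar> \<le> K \<and> (n \<ge> N \<longrightarrow> \<bar>r (Suc n) x - r n y\<bar> \<le> e/2))"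
    using step[of "e/2"] \<open>e > 0\<close> by auto
  obtain N' where N': "real N' > real N * K / (e/2)" using reals_Archimedean2 by blast
  have "\<bar>r n x\<bar> \<le> real n * e" if "n \<ge> N'" "P n x" for n x
  proof -
    have "real n > real N * K / (e/2)" using N' that by linarith
    then have "real N * K \<le> real n * (e/2)" using \<open>e > 0\<close> by (simp add: field_simps)
    moreover have "\<bar>r n x\<bar> \<le> real N * K + real n * (e/2)"
      using cesaro_bound[of r P K N "e/2", OF r0 N] that \<open>K \<ge> 0\<close> \<open>e > 0\<close> by auto
    ultimately show ?thesis by (simp add: field_simps)
  qed
  then show ?thesis by blast
qed

text \<open>Deleting the first symbol from two points that agree on n + 1 symbols leaves two points
  that agree on n symbols, and changes the difference of the Birkhoff sums by the difference of F at
  the two points. This is small once the agreement is long.\<close>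

lemma bsum_variation:
  assumes F: "cyl_cont m F" "m \<ge> 1" and "e > 0"
  obtains N where "\<And>n \<omega> \<omega>'. n \<ge> N \<Longrightarrow> \<omega> \<in> full_shift m \<Longrightarrow> \<omega>' \<in> full_shift m \<Longrightarrow> pre n \<omega> = pre n \<omega>' \<Longrightarrow>
     \<bar>bsum F n \<omega> - bsum F n \<omega>'\<bar> \<le> real n * e"
proof -
  obtain K where K: "K > 0" "\<And>\<omega>. \<omega> \<in> full_shift m \<Longrightarrow> \<bar>F \<omega>\<bar> \<le> K" using cyl_cont_bounded[OF F] by blast
  define P where "P = (\<lambda>n (\<omega>, \<omega>'). \<omega> \<in> full_shift m \<and> \<omega>' \<in> full_shift m \<and> pre n \<omega> = pre n \<omega>')"
  define r where "r = (\<lambda>n (\<omega>, \<omega>'). bsum F n \<omega> - bsum F n \<omega>')"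
  have "\<exists>N. \<forall>n x. P (Suc n) x \<longrightarrow> (\<exists>y. P n y \<and> \<bar>r (Suc n) x - r n y\<bar> \<le> 2 * K \<and> (n \<ge> N \<longrightarrow> \<bar>r (Suc n) x - r n y\<bar> \<le> d))"
    if d: "d > 0" for d
  proof -
    obtain q where q: "\<And>\<omega> \<omega>'. \<omega> \<in> full_shift m \<Longrightarrow> \<omega>' \<in> full_shift m \<Longrightarrow> pre q \<omega> = pre q \<omega>' \<Longrightarrow> \<bar>F \<omega> - F \<omega>'\<bar> \<le> d"
      using cyl_contD[OF F(1) d] by metis
    show ?thesis
    proof (intro exI[of _ q] allI impI)
      fix n x assume Px: "P (Suc n) x"
      obtain \<omega> \<omega>' where x: "x = (\<omega>, \<omega>')" by (cases x)
      have *: "\<omega> \<in> full_shift m" "\<omega>' \<in> full_shift m" "pre (Suc n) \<omega> = pre (Suc n) \<omega>'" using Px by (auto simp: P_def x)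
      have "P n (shift \<omega>, shift \<omega>')" using * by (auto simp: P_def full_shift_shift pre_Suc_shift)
      moreover have "r (Suc n) x - r n (shift \<omega>, shift \<omega>') = F \<omega> - F \<omega>'" by (simp add: r_def x bsum_Suc)
      moreover have "\<bar>F \<omega> - F \<omega>'\<bar> \<le> 2 * K" using K(2)[OF *(1)] K(2)[OF *(2)] by linarith
      moreover have "\<bar>F \<omega> - F \<omega>'\<bar> \<le> d" if "n \<ge> q"
        using that * by (intro q pre_eq_mono[OF *(3)]) auto
      ultimately show "\<exists>y. P n y \<and> \<bar>r (Suc n) x - r n y\<bar> \<le> 2 * K \<and> (n \<ge> q \<longrightarrow> \<bar>r (Suc n) x - r n y\<bar> \<le> d)" by metis
    qed
  qed
  moreover have "r 0 x = 0" for x by (cases x) (simp add: r_def)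
  ultimately have "\<exists>N. \<forall>n x. n \<ge> N \<longrightarrow> P n x \<longrightarrow> \<bar>r n x\<bar> \<le> real n * e"
    using K(1) \<open>e > 0\<close> by (intro cesaro_uniform[of r "2*K" P e]) auto
  then obtain N where "\<And>n x. n \<ge> N \<Longrightarrow> P n x \<Longrightarrow> \<bar>r n x\<bar> \<le> real n * e" by blast
  then show ?thesis using that[of N] by (auto simp: P_def r_def)
qed

subsection \<open>Entropy of random variables and of partitions\<close>

text \<open>Shannon entropy, with natural logarithm, of the partition into the fibres of X. Working
  with random variables makes the chain rule and the data processing inequality available.\<close>

definition rv_ent :: "'a measure \<Rightarrow> ('a \<Rightarrow> 'b) \<Rightarrow> real" where
  "rv_ent M X = (\<Sum>x\<in>X ` space M. ent_fun (measure M (X -` {x} \<inter> space M)))"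

definition itin :: "('a \<Rightarrow> 'a) \<Rightarrow> ('a \<Rightarrow> 'b) \<Rightarrow> nat \<Rightarrow> 'a \<Rightarrow> 'b list" where
  "itin T X n x = map (\<lambda>i. X ((T ^^ i) x)) [0..<n]"

lemma ent_fun_0 [simp]: "ent_fun 0 = 0" by (simp add: ent_fun_def)
lemma ent_fun_pos: "p > 0 \<Longrightarrow> ent_fun p = - p * ln p" by (simp add: ent_fun_def)
lemma ent_fun_nonneg: "p \<le> 1 \<Longrightarrow> ent_fun p \<ge> 0"
  by (auto simp: ent_fun_def mult_nonneg_nonpos)

text \<open>Controls an atom of mass close to 1. Its companion with the square root controls atoms
  of small mass and gives continuity of \<open>ent_fun\<close> at 0.\<close>

lemma ent_fun_le_one_minus: "p \<ge> 0 \<Longrightarrow> ent_fun p \<le> 1 - p"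
proof (cases "p > 0")
  case True
  have "ln (1 / p) \<le> 1 / p - 1" using True by (intro ln_le_minus_one) auto
  then have "p * ln (1 / p) \<le> p * (1 / p - 1)" using True by (intro mult_left_mono) auto
  then show ?thesis using True by (simp add: ent_fun_pos ln_div algebra_simps)
qed (simp add: ent_fun_def)

lemma ent_fun_le_sqrt: "p \<ge> 0 \<Longrightarrow> ent_fun p \<le> 2 * sqrt p"
proof (cases "p > 0")
  case True
  have "ln (1 / sqrt p) \<le> 1 / sqrt p - 1" using True by (intro ln_le_minus_one) auto
  moreover have "ln (1 / sqrt p) = - ln p / 2" using True by (simp add: ln_div ln_sqrt)
  ultimately have "- ln p \<le> 2 / sqrt p" by simp
  then have "p * (- ln p) \<le> p * (2 / sqrt p)" using True by (intro mult_left_mono) auto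
  also have "p * (2 / sqrt p) = 2 * sqrt p" using True by (simp add: field_simps real_sqrt_mult_self)
  finally show ?thesis using True by (simp add: ent_fun_pos)
qed (simp add: ent_fun_def)

lemma rv_ent_superset:
  assumes "finite S" "X ` space M \<subseteq> S"
  shows "rv_ent M X = (\<Sum>x\<in>S. ent_fun (measure M (X -` {x} \<inter> space M)))"
proof -
  have "ent_fun (measure M (X -` {x} \<inter> space M)) = 0" if "x \<notin> X ` space M" for x
  proof -
    have "X -` {x} \<inter> space M = {}" using that by auto
    then show ?thesis by simp
  qed
  then show ?thesis unfolding rv_ent_def using assms by (intro sum.mono_neutral_left) auto
qed

context prob_space
begin

lemma information_space_exp: "information_space M (exp 1)"
  by unfold_locales auto

lemma rv_ent_eq_entropy:
  assumes "simple_function M X"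
  shows "rv_ent M X = entropy (exp 1) (count_space (X ` space M)) X"
proof -
  interpret information_space M "exp 1" by (rule information_space_exp)
  have "entropy (exp 1) (count_space (X ` space M)) X
     = - (\<Sum>x\<in>X ` space M. prob (X -` {x} \<inter> space M) * log (exp 1) (prob (X -` {x} \<inter> space M)))"
    by (rule entropy_simple_distributed[OF simple_distributedI[OF assms measure_nonneg refl]])
  also have "\<dots> = rv_ent M X"
    unfolding rv_ent_def by (auto simp: sum_negf[symmetric] ent_fun_def log_def not_le measure_le_0_iff intro!: sum.cong)
  finally show ?thesis by simp
qed

lemma rv_ent_nonneg: "rv_ent M X \<ge> 0"
  unfolding rv_ent_def by (intro sum_nonneg ent_fun_nonneg) simp

lemma rv_ent_Pair_le:
  assumes "simple_function M X" "simple_function M Y"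
  shows "rv_ent M (\<lambda>x. (X x, Y x)) \<le> rv_ent M X + rv_ent M Y"
proof -
  interpret information_space M "exp 1" by (rule information_space_exp)
  show ?thesis
    using entropy_chain_rule[OF assms] conditional_entropy_less_eq_entropy[OF assms(2,1)]
    by (simp add: rv_ent_eq_entropy assms simple_function_Pair)
qed

text \<open>On the space Y is a function of X, obtained by choosing a point in each fibre of X, so
  data processing applies.\<close>

lemma rv_ent_mono:
  assumes X: "simple_function M X" and Y: "simple_function M Y"
    and det: "\<And>x y. x \<in> space M \<Longrightarrow> y \<in> space M \<Longrightarrow> X x = X y \<Longrightarrow> Y x = Y y"
  shows "rv_ent M Y \<le> rv_ent M X"
proof -
  interpret information_space M "exp 1" by (rule information_space_exp)
  define f where "f v = Y (SOME x. x \<in> space M \<and> X x = v)" for v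
  have f: "f (X x) = Y x" if "x \<in> space M" for x
  proof -
    have "(SOME y. y \<in> space M \<and> X y = X x) \<in> space M \<and> X (SOME y. y \<in> space M \<and> X y = X x) = X x"
      by (rule someI[of _ x]) (use that in simp)
    then show ?thesis unfolding f_def using det[OF _ that] by blast
  qed
  have "rv_ent M Y = rv_ent M (f \<circ> X)"
  proof -
    have "Y ` space M = (f \<circ> X) ` space M" using f by auto
    moreover have "Y -` {x} \<inter> space M = (f \<circ> X) -` {x} \<inter> space M" for x using f by auto
    ultimately show ?thesis by (simp add: rv_ent_def)
  qed
  also have "\<dots> \<le> rv_ent M X"
    using entropy_data_processing[OF X, of f]
    by (simp add: rv_ent_eq_entropy X simple_function_compose[OF X])
  finally show ?thesis .
qed

text \<open>Monotonicity and subadditivity in one rule. The entropy estimates below split an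
  itinerary into two pieces that determine it jointly.\<close>

lemma rv_ent_le_Pair:
  assumes X: "simple_function M X" and Y: "simple_function M Y" and Z: "simple_function M Z"
    and det: "\<And>x y. x \<in> space M \<Longrightarrow> y \<in> space M \<Longrightarrow> X x = X y \<Longrightarrow> Y x = Y y \<Longrightarrow> Z x = Z y"
  shows "rv_ent M Z \<le> rv_ent M X + rv_ent M Y"
proof -
  have "rv_ent M Z \<le> rv_ent M (\<lambda>x. (X x, Y x))"
    by (rule rv_ent_mono[OF simple_function_Pair[OF X Y] Z]) (blast intro: det)
  then show ?thesis using rv_ent_Pair_le[OF X Y] by linarith
qed

lemma rv_ent_le_ln_card:
  assumes X: "simple_function M X" and S: "finite S" "X ` space M \<subseteq> S"
  shows "rv_ent M X \<le> ln (real (card S))"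
proof -
  interpret information_space M "exp 1" by (rule information_space_exp)
  have "rv_ent M X \<le> ln (real (card (X ` space M)))"
    using entropy_le_card[OF simple_distributedI[OF X measure_nonneg refl]] by (simp add: rv_ent_eq_entropy X log_def)
  also have "\<dots> \<le> ln (real (card S))"
    using S card_mono[OF S] not_empty by (intro ln_mono) (auto simp: card_gt_0_iff finite_subset)
  finally show ?thesis .
qed

end

section \<open>Finite partitions as random variables, and their dynamical joins\<close>

lemma itin_determined: "itin T X n x = itin T X n y \<longleftrightarrow> (\<forall>i<n. X ((T ^^ i) x) = X ((T ^^ i) y))"
  by (auto simp: itin_def)

lemma partition_entropy_fibers:
  "partition_entropy M ((\<lambda>v. X -` {v} \<inter> space M) ` (X ` space M)) = rv_ent M X"
proof -
  have "inj_on (\<lambda>v. X -` {v} \<inter> space M) (X ` space M)"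
    by (rule inj_onI) blast
  then show ?thesis unfolding partition_entropy_def rv_ent_def by (simp add: sum.reindex)
qed

definition atom_of :: "'a set set \<Rightarrow> 'a \<Rightarrow> 'a set" where
  "atom_of P x = (THE A. A \<in> P \<and> x \<in> A)"

lemma atom_of_eq:
  assumes "fin_partition M P" "A \<in> P" "x \<in> A" shows "atom_of P x = A"
  unfolding atom_of_def
proof (rule the_equality)
  fix B assume "B \<in> P \<and> x \<in> B"
  then show "B = A" using assms unfolding fin_partition_def disjoint_def by blast
qed (use assms in auto)

lemma atom_of_mem:
  assumes "fin_partition M P" "x \<in> space M" shows "atom_of P x \<in> P" "x \<in> atom_of P x"
proof -
  obtain A where A: "A \<in> P" "x \<in> A" using assms unfolding fin_partition_def by blast
  then show "atom_of P x \<in> P" "x \<in> atom_of P x" using atom_of_eq[OF assms(1) A] by auto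
qed

lemma simple_function_atom_of:
  assumes "fin_partition M P" shows "simple_function M (atom_of P)"
  unfolding simple_function_def
proof safe
  have "atom_of P ` space M \<subseteq> P" using atom_of_mem(1)[OF assms] by auto
  then show "finite (atom_of P ` space M)"
    using assms finite_subset by (auto simp: fin_partition_def)
  fix x assume x: "x \<in> space M"
  have "atom_of P -` {atom_of P x} \<inter> space M = atom_of P x"
  proof -
    have "atom_of P x \<subseteq> space M" using atom_of_mem(1)[OF assms x] assms by (auto simp: fin_partition_def)
    then show ?thesis using atom_of_mem(2)[OF assms] atom_of_eq[OF assms atom_of_mem(1)[OF assms x]] by auto
  qed
  then show "atom_of P -` {atom_of P x} \<inter> space M \<in> sets M"
    using atom_of_mem(1)[OF assms x] assms by (auto simp: fin_partition_def)
qed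

text \<open>Because \<open>dyn_join\<close> discards the empty set, its elements are exactly the
  fibres of the map that sends a point to the sequence of atoms it visits.\<close>

lemma partition_entropy_dyn_join:
  assumes P: "fin_partition M P" and T: "\<And>x. x \<in> space M \<Longrightarrow> T x \<in> space M"
  shows "partition_entropy M (dyn_join M T P n) = rv_ent M (itin T (atom_of P) n)"
proof -
  have Tn: "(T ^^ i) x \<in> space M" if "x \<in> space M" for i x using that T by (induction i) auto
  let ?fib = "\<lambda>z. itin T (atom_of P) n -` {itin T (atom_of P) n z} \<inter> space M"
  have fib: "{x \<in> space M. \<forall>i<n. (T ^^ i) x \<in> w i} = ?fib z"
    if "w \<in> {0..<n} \<rightarrow>\<^sub>E P" "z \<in> space M" "\<forall>i<n. (T ^^ i) z \<in> w i" for w z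
  proof -
    have wi: "w i = atom_of P ((T ^^ i) z)" "w i \<in> P" if "i < n" for i
      using atom_of_eq[OF P, of "w i"] that \<open>w \<in> _\<close> \<open>\<forall>i<n. _\<close> by (auto simp: PiE_def Pi_def)
    have one: "(T ^^ i) x \<in> w i \<longleftrightarrow> atom_of P ((T ^^ i) x) = atom_of P ((T ^^ i) z)" if "x \<in> space M" "i < n" for x i
    proof
      assume "(T ^^ i) x \<in> w i"
      then show "atom_of P ((T ^^ i) x) = atom_of P ((T ^^ i) z)"
        using atom_of_eq[OF P wi(2)[OF that(2)]] wi(1)[OF that(2)] by simp
    next
      assume "atom_of P ((T ^^ i) x) = atom_of P ((T ^^ i) z)"
      then show "(T ^^ i) x \<in> w i"
        using atom_of_mem(2)[OF P Tn[OF that(1), of i]] wi(1)[OF that(2)] by simp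
    qed
    show ?thesis
    proof (rule set_eqI)
      fix x show "x \<in> {x \<in> space M. \<forall>i<n. (T ^^ i) x \<in> w i} \<longleftrightarrow> x \<in> ?fib z"
        using one[of x] by (cases "x \<in> space M") (simp_all add: itin_determined)
    qed
  qed
  have "dyn_join M T P n = ?fib ` space M"
  proof safe
    fix C assume "C \<in> dyn_join M T P n"
    then obtain w z where "w \<in> {0..<n} \<rightarrow>\<^sub>E P" "C = {x \<in> space M. \<forall>i<n. (T ^^ i) x \<in> w i}" "z \<in> C"
      unfolding dyn_join_def by blast
    then show "C \<in> ?fib ` space M" using fib[of w z] by auto
  next
    fix z assume z: "z \<in> space M"
    define w where "w = restrict (\<lambda>i. atom_of P ((T ^^ i) z)) {0..<n}"
    have w: "w \<in> {0..<n} \<rightarrow>\<^sub>E P" unfolding w_def using atom_of_mem(1)[OF P Tn[OF z]] by auto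
    have "\<forall>i<n. (T ^^ i) z \<in> w i" unfolding w_def using atom_of_mem(2)[OF P Tn[OF z]] by auto
    then have "?fib z = {x \<in> space M. \<forall>i<n. (T ^^ i) x \<in> w i}" using fib[OF w z] by simp
    then show "?fib z \<in> dyn_join M T P n" unfolding dyn_join_def using w z by blast
  qed
  also have "?fib ` space M = (\<lambda>v. itin T (atom_of P) n -` {v} \<inter> space M) ` (itin T (atom_of P) n ` space M)"
    by (simp add: image_image)
  finally show ?thesis by (simp only: partition_entropy_fibers)
qed

text \<open>The limit is the infimum of the quotients. This second piece of information matters as
  much as convergence: it bounds the entropy rate by the quotient at any single n.\<close>

lemma fekete:
  fixes a :: "nat \<Rightarrow> real"
  assumes sub: "\<And>n k. a (n + k) \<le> a n + a k" and nonneg: "\<And>n. a n \<ge> 0"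
  obtains L where "(\<lambda>n. a n / real n) \<longlonglongrightarrow> L" "\<And>n. n \<ge> 1 \<Longrightarrow> L \<le> a n / real n"
proof -
  define L where "L = (INF n\<in>{1::nat..}. a n / real n)"
  have bdd: "bdd_below ((\<lambda>n. a n / real n) ` {1..})" using nonneg by (intro bdd_belowI[of _ 0]) auto
  have low: "L \<le> a n / real n" if "n \<ge> 1" for n
    unfolding L_def using bdd that by (intro cINF_lower) auto
  have mult: "a (r + q * N) \<le> a r + real q * a N" for r q N
  proof (induction q)
    case (Suc q)
    have "a (r + Suc q * N) = a ((r + q * N) + N)" by (simp add: algebra_simps)
    also have "\<dots> \<le> a (r + q * N) + a N" by (rule sub)
    finally show ?case using Suc by (simp add: algebra_simps)
  qed simp
  have "(\<lambda>n. a n / real n) \<longlonglongrightarrow> L"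
  proof (rule LIMSEQ_I)
    fix e :: real assume e: "e > 0"
    have "Inf ((\<lambda>n. a n / real n) ` {1..}) < L + e/2" using e unfolding L_def by simp
    then have "\<exists>x\<in>(\<lambda>n. a n / real n) ` {1..}. x < L + e/2"
      by (rule cInf_lessD[rotated]) auto
    then obtain N where N: "N \<ge> 1" "a N / real N < L + e/2" by auto
    \<comment> \<open>One bound for \<open>a r\<close> over all remainders r < N.\<close>
    define C where "C = (\<Sum>r<N. a r)"
    have C: "a r \<le> C" if "r < N" for r unfolding C_def using that nonneg by (intro member_le_sum) auto
    have "C \<ge> 0" unfolding C_def using nonneg by (intro sum_nonneg) auto
    obtain n0 where n0: "real n0 > C / (e/2)" using reals_Archimedean2 by blast
    have "norm (a n / real n - L) < e" if n: "n \<ge> max 1 n0" for n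
    proof -
      have n_pos: "real n > 0" using n by auto
      define q r where "q = n div N" and "r = n mod N"
      have nqr: "n = r + q * N" "r < N" using N by (auto simp: q_def r_def)
      have "a n \<le> C + real q * a N" using mult[of r q N] C[OF nqr(2)] nqr(1) by simp
      also have "real q * a N = real (q * N) * (a N / real N)" using N by simp
      also have "real (q * N) * (a N / real N) \<le> real n * (a N / real N)"
        using nqr nonneg N by (intro mult_right_mono) auto
      finally have "a n / real n \<le> C / real n + a N / real N" using n_pos by (simp add: field_simps)
      moreover have "C / real n < e/2"
      proof -
        have "real n > C / (e/2)" using n0 n by linarith
        then show ?thesis using n_pos e by (simp add: field_simps)
      qed
      ultimately have "a n / real n < L + e" using N(2) by linarith
      then show ?thesis using low[of n] n by (simp add: abs_if)
    qed
    then show "\<exists>no. \<forall>n\<ge>no. norm (a n / real n - L) < e" by blast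
  qed
  then show ?thesis using low that by blast
qed

subsection \<open>Kolmogorov-Sinai entropy of the shift\<close>

locale shift_invariant = prob_space \<mu> for \<mu> :: "(nat \<Rightarrow> nat) measure" and m :: nat +
  assumes inv: "\<mu> \<in> invariant_measures m" and m_ge_1: "m \<ge> 1"

lemma shift_invariantI: "\<mu> \<in> invariant_measures m \<Longrightarrow> m \<ge> 1 \<Longrightarrow> shift_invariant \<mu> m"
  by (simp add: shift_invariant_def shift_invariant_axioms_def invariant_measures_def)

context shift_invariant
begin

lemma sets_mu [measurable_cong, simp]: "sets \<mu> = sets (shift_space m)"
  using inv by (simp add: invariant_measures_def)

lemma space_mu [simp]: "space \<mu> = full_shift m"
  using sets_eq_imp_space_eq[OF sets_mu] by simp

lemma shift_in_space: "x \<in> space \<mu> \<Longrightarrow> (shift ^^ k) x \<in> space \<mu>"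
  by (simp add: full_shift_funpow)

lemma measurable_mu_shift: "(shift ^^ k) \<in> measurable \<mu> \<mu>"
  using measurable_shift_funpow[of k m] by (simp add: measurable_cong_sets[OF sets_mu sets_mu])

lemma distr_shift: "distr \<mu> \<mu> (shift ^^ k) = \<mu>"
proof (induction k)
  case 0
  then show ?case using distr_id2[of \<mu> \<mu>] by (simp add: id_def)
next
  case (Suc k)
  have s: "shift \<in> measurable \<mu> \<mu>" using measurable_mu_shift[of 1] by (simp add: o_def)
  have 1: "distr \<mu> \<mu> shift = \<mu>"
  proof (rule measure_eqI)
    fix A assume "A \<in> sets (distr \<mu> \<mu> shift)"
    then have A: "A \<in> sets \<mu>" by simp
    then show "emeasure (distr \<mu> \<mu> shift) A = emeasure \<mu> A"
      using inv s by (subst emeasure_distr) (auto simp: invariant_measures_def)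
  qed simp
  have d: "distr \<mu> \<mu> (shift ^^ Suc k) = distr (distr \<mu> \<mu> (shift ^^ k)) \<mu> shift"
    using s measurable_mu_shift[of k] by (simp add: distr_distr o_def)
  show ?case by (simp only: d Suc 1)
qed

lemma prob_shift: "A \<in> sets \<mu> \<Longrightarrow> prob ((shift ^^ k) -` A \<inter> space \<mu>) = prob A"
  using measure_distr[OF measurable_mu_shift[of k], of A] distr_shift[of k] by simp

lemma integral_shift:
  fixes F :: "_ \<Rightarrow> real"
  assumes "F \<in> borel_measurable \<mu>" shows "integral\<^sup>L \<mu> (\<lambda>x. F ((shift ^^ k) x)) = integral\<^sup>L \<mu> F"
  using integral_distr[OF measurable_mu_shift[of k] assms] distr_shift[of k] by simp

lemma simple_function_shift:
  assumes "simple_function \<mu> X" shows "simple_function \<mu> (\<lambda>x. X ((shift ^^ k) x))"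
proof -
  have "(\<lambda>x. X ((shift ^^ k) x)) ` space \<mu> \<subseteq> X ` space \<mu>" using shift_in_space by blast
  then show ?thesis
    using assms measurable_compose[OF measurable_mu_shift[of k]] finite_subset
    unfolding simple_function_eq_measurable by blast
qed

lemma rv_ent_shift:
  assumes X: "simple_function \<mu> X" shows "rv_ent \<mu> (\<lambda>x. X ((shift ^^ k) x)) = rv_ent \<mu> X"
proof -
  have fin: "finite (X ` space \<mu>)" using X simple_functionD(1) by blast
  have sub: "(\<lambda>x. X ((shift ^^ k) x)) ` space \<mu> \<subseteq> X ` space \<mu>" using shift_in_space by blast
  have "prob ((\<lambda>x. X ((shift ^^ k) x)) -` {v} \<inter> space \<mu>) = prob (X -` {v} \<inter> space \<mu>)" for v
  proof -
    have "(\<lambda>x. X ((shift ^^ k) x)) -` {v} \<inter> space \<mu> = (shift ^^ k) -` (X -` {v} \<inter> space \<mu>) \<inter> space \<mu>"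
      using shift_in_space[of _ k] by blast
    then show ?thesis using prob_shift[OF simple_functionD(2)[OF X, of "{v}"], of k] by simp
  qed
  then show ?thesis by (simp add: rv_ent_superset[OF fin sub] rv_ent_def[of \<mu> X])
qed

lemma simple_function_itin:
  assumes X: "simple_function \<mu> X" shows "simple_function \<mu> (itin shift X n)"
proof (induction n)
  case 0
  then show ?case by (simp add: itin_def)
next
  case (Suc n)
  have eq: "itin shift X (Suc n) = (\<lambda>(w, a). w @ [a]) \<circ> (\<lambda>x. (itin shift X n x, X ((shift ^^ n) x)))"
    by (auto simp: itin_def)
  show ?case
    unfolding eq by (rule simple_function_compose[OF simple_function_Pair[OF Suc simple_function_shift[OF X]]])
qed

lemma itin_add: "itin shift X (n + k) x = itin shift X n x @ itin shift X k ((shift ^^ n) x)"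
  by (rule nth_equalityI) (auto simp: itin_def nth_append shift_funpow)

lemma rv_ent_itin_add:
  assumes X: "simple_function \<mu> X"
  shows "rv_ent \<mu> (itin shift X (n + k)) \<le> rv_ent \<mu> (itin shift X n) + rv_ent \<mu> (itin shift X k)"
proof -
  have "rv_ent \<mu> (itin shift X (n + k))
      \<le> rv_ent \<mu> (itin shift X n) + rv_ent \<mu> (\<lambda>x. itin shift X k ((shift ^^ n) x))"
    by (rule rv_ent_le_Pair) (simp_all add: simple_function_itin[OF X] simple_function_shift itin_add)
  then show ?thesis by (simp add: rv_ent_shift simple_function_itin[OF X])
qed

lemma rv_ent_const: "rv_ent \<mu> (\<lambda>x. c) = 0"
  using not_empty by (simp add: rv_ent_def image_constant_conv prob_space[simplified] ent_fun_pos)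

lemma rv_ent_itin_le:
  assumes X: "simple_function \<mu> X" shows "rv_ent \<mu> (itin shift X n) \<le> real n * rv_ent \<mu> X"
proof (induction n)
  case 0
  have "itin shift X 0 = (\<lambda>x. [])" by (auto simp: itin_def)
  then show ?case by (simp add: rv_ent_const)
next
  case (Suc n)
  have "rv_ent \<mu> (itin shift X (Suc 0)) \<le> rv_ent \<mu> X"
    by (rule rv_ent_mono[OF X simple_function_itin[OF X]]) (simp add: itin_def)
  then show ?case using Suc rv_ent_itin_add[OF X, of n "Suc 0"] by (simp add: algebra_simps)
qed

lemma simple_function_coord: "simple_function \<mu> (\<lambda>\<omega>. \<omega> 0)"
proof -
  have "(\<lambda>\<omega>. \<omega> 0) ` space \<mu> \<subseteq> {1..m}" by (auto dest: full_shiftD)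
  then have "finite ((\<lambda>\<omega>. \<omega> 0) ` space \<mu>)" by (rule finite_subset) simp
  moreover have "(\<lambda>\<omega>. \<omega> 0) \<in> measurable \<mu> (count_space UNIV)" by measurable
  ultimately show ?thesis unfolding simple_function_eq_measurable by blast
qed

lemma itin_coord: "itin shift (\<lambda>\<omega>. \<omega> 0) n = pre n"
  by (auto simp: itin_def pre_def shift_funpow)

lemma simple_function_pre: "simple_function \<mu> (pre n)"
  using simple_function_itin[OF simple_function_coord, of n] by (simp add: itin_coord)

lemma cyl_ent_add: "rv_ent \<mu> (pre (n + k)) \<le> rv_ent \<mu> (pre n) + rv_ent \<mu> (pre k)"
  using rv_ent_itin_add[OF simple_function_coord] by (simp add: itin_coord)

section \<open>Approximation of measurable sets and partitions by cylinders\<close>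

definition determined :: "nat \<Rightarrow> (nat \<Rightarrow> nat) set \<Rightarrow> bool" where
  "determined k C \<longleftrightarrow> C \<subseteq> full_shift m \<and> (\<forall>x\<in>C. \<forall>y\<in>full_shift m. pre k x = pre k y \<longrightarrow> y \<in> C)"

lemma determined_mono: "determined k C \<Longrightarrow> k \<le> l \<Longrightarrow> determined l C"
  unfolding determined_def using pre_eq_mono by blast

lemma determined_sets: assumes "determined k C" shows "C \<in> sets \<mu>"
proof -
  have "C = {\<omega> \<in> full_shift m. pre k \<omega> \<in> pre k ` C}"
    using assms unfolding determined_def by (auto simp: image_iff)
  then show ?thesis using cylinder_sets[of m k "pre k ` C"] by simp
qed

text \<open>The determined sets are the finite unions of cylinders, and the sets that they
  approximate in measure are closed under complements and countable unions; the induction follows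
  the generation of the sigma algebra.\<close>

lemma approx_determined:
  assumes "A \<in> sets \<mu>" "e > 0"
  shows "\<exists>k C. determined k C \<and> prob ((A - C) \<union> (C - A)) < e"
proof -
  have "A \<in> sigma_sets (full_shift m) (cylinders m)" using assms by (simp add: sets_shift_space_cylinders)
  then show ?thesis using \<open>e > 0\<close>
  proof (induction A arbitrary: e rule: sigma_sets.induct)
    case (Basic A)
    have "\<exists>k. determined k A"
    proof (cases "A = {}")
      case False
      then obtain n w where "A = {\<omega> \<in> full_shift m. pre n \<omega> = w}" using Basic by (auto simp: cylinders_def)
      then have "determined n A" by (auto simp: determined_def)
      then show ?thesis by blast
    qed (auto simp: determined_def)
    then obtain k where "determined k A" by blast
    then show ?case using Basic.prems by (intro exI[of _ k] exI[of _ A]) simp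
  next
    case Empty
    then show ?case by (intro exI[of _ 0] exI[of _ "{}"]) (simp add: determined_def)
  next
    case (Compl A)
    then obtain k C where C: "determined k C" "prob ((A - C) \<union> (C - A)) < e" by blast
    have A: "A \<in> sets \<mu>" using Compl.hyps by (simp add: sets_shift_space_cylinders)
    then have "A \<subseteq> full_shift m" using sets.sets_into_space by fastforce
    then have "((full_shift m - A) - (full_shift m - C)) \<union> ((full_shift m - C) - (full_shift m - A)) = (A - C) \<union> (C - A)"
      using C(1) by (auto simp: determined_def)
    moreover have "determined k (full_shift m - C)"
    proof -
      have "y \<notin> C" if "x \<in> full_shift m" "x \<notin> C" "pre k x = pre k y" for x y
        using that C(1) unfolding determined_def by metis
      then show ?thesis unfolding determined_def by blast
    qed
    ultimately show ?case using C(2) by metis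
  next
    case (Union A)
    have A: "A i \<in> sets \<mu>" for i using Union.hyps by (simp add: sets_shift_space_cylinders)
    have "(\<lambda>n. prob (\<Union>i<n. A i)) \<longlonglongrightarrow> prob (\<Union>n. \<Union>i<n. A i)"
    proof (rule finite_Lim_measure_incseq)
      show "range (\<lambda>n. \<Union>i<n. A i) \<subseteq> sets \<mu>" using A by auto
      show "incseq (\<lambda>n. \<Union>i<n. A i)" by (intro incseq_SucI) (auto simp: lessThan_Suc)
    qed
    moreover have "(\<Union>n. \<Union>i<n. A i) = (\<Union>i. A i)" by auto
    ultimately have "(\<lambda>n. prob (\<Union>i<n. A i)) \<longlonglongrightarrow> prob (\<Union>i. A i)" by simp
    then have "eventually (\<lambda>n. prob (\<Union>i<n. A i) > prob (\<Union>i. A i) - e/2) sequentially"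
      using Union.prems by (intro order_tendstoD(1)) auto
    then obtain N where N: "prob (\<Union>i<N. A i) > prob (\<Union>i. A i) - e/2" by (auto simp: eventually_sequentially)
    \<comment> \<open>The cut to N sets uses e/2, and the N approximations share the other half; the
      summand 1 covers N = 0.\<close>
    define d where "d = e / (2 * (real N + 1))"
    have d: "d > 0" using Union.prems by (simp add: d_def)
    have "\<exists>k C. determined k C \<and> prob ((A i - C) \<union> (C - A i)) < d" for i by (rule Union.IH[OF d])
    then obtain k C where C: "\<And>i. determined (k i) (C i)" "\<And>i. prob ((A i - C i) \<union> (C i - A i)) < d" by metis
    have Cs: "C i \<in> sets \<mu>" for i using determined_sets[OF C(1)] .
    have [measurable]: "A i \<in> sets (shift_space m)" "C i \<in> sets (shift_space m)" for i using A Cs by auto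
    define K where "K = (\<Sum>i<N. k i)"
    have "determined K (\<Union>i<N. C i)"
    proof -
      have "determined K (C i)" if "i < N" for i
        using that by (intro determined_mono[OF C(1)]) (auto simp: K_def intro!: member_le_sum)
      then show ?thesis unfolding determined_def by blast
    qed
    moreover have "prob (((\<Union>i. A i) - (\<Union>i<N. C i)) \<union> ((\<Union>i<N. C i) - (\<Union>i. A i))) < e"
    proof -
      have H: "((\<Union>i. A i) - (\<Union>i<N. C i)) \<union> ((\<Union>i<N. C i) - (\<Union>i. A i))
          \<subseteq> ((\<Union>i. A i) - (\<Union>i<N. A i)) \<union> (\<Union>i<N. (A i - C i) \<union> (C i - A i))" by auto
      have "prob (((\<Union>i. A i) - (\<Union>i<N. C i)) \<union> ((\<Union>i<N. C i) - (\<Union>i. A i)))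
          \<le> prob (((\<Union>i. A i) - (\<Union>i<N. A i)) \<union> (\<Union>i<N. (A i - C i) \<union> (C i - A i)))"
        by (rule finite_measure_mono[OF H]) (unfold sets_mu, measurable)
      also have "\<dots> \<le> prob ((\<Union>i. A i) - (\<Union>i<N. A i)) + prob (\<Union>i<N. (A i - C i) \<union> (C i - A i))"
        by (rule measure_Un_le; unfold sets_mu; measurable)
      also have "prob ((\<Union>i. A i) - (\<Union>i<N. A i)) = prob (\<Union>i. A i) - prob (\<Union>i<N. A i)"
        by (rule finite_measure_Diff) (unfold sets_mu, measurable, auto)
      also have "prob (\<Union>i<N. (A i - C i) \<union> (C i - A i)) \<le> (\<Sum>i<N. prob ((A i - C i) \<union> (C i - A i)))"
        using A Cs by (intro measure_UNION_le) auto
      also have "\<dots> \<le> (\<Sum>i<N. d)" by (intro sum_mono less_imp_le C(2))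
      also have "(\<Sum>i<N. d) \<le> e/2" using Union.prems by (simp add: d_def field_simps)
      finally show ?thesis using N by linarith
    qed
    ultimately show ?case by blast
  qed
qed

text \<open>The result is a guess \<open>f\<close> of the atom from the first k symbols, wrong only
  with small probability. Each atom is approximated by a set of words up to d divided by the number
  of atoms.\<close>

lemma approx_partition:
  assumes P: "fin_partition \<mu> P" and "d > 0"
  shows "\<exists>k f. range f \<subseteq> P \<and> prob {x \<in> space \<mu>. f (pre k x) \<noteq> atom_of P x} \<le> d"
proof -
  have finP: "finite P" and setsP: "\<And>A. A \<in> P \<Longrightarrow> A \<in> sets \<mu>" using P by (auto simp: fin_partition_def)
  define c where "c = real (card P)"
  have "P \<noteq> {}" using P not_empty by (auto simp: fin_partition_def)
  then have c: "c > 0" using finP by (simp add: c_def card_gt_0_iff)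
  have "\<forall>A\<in>P. \<exists>k C. determined k C \<and> prob ((A - C) \<union> (C - A)) < d / c"
    using approx_determined setsP \<open>d > 0\<close> c by simp
  then obtain k C where C: "\<And>A. A \<in> P \<Longrightarrow> determined (k A) (C A)"
     "\<And>A. A \<in> P \<Longrightarrow> prob ((A - C A) \<union> (C A - A)) < d / c" by metis
  have Cs: "C A \<in> sets \<mu>" if "A \<in> P" for A using determined_sets[OF C(1)[OF that]] .
  define K where "K = (\<Sum>A\<in>P. k A)"
  have K: "determined K (C A)" if "A \<in> P" for A
    using that finP by (intro determined_mono[OF C(1)]) (auto simp: K_def intro!: member_le_sum)
  obtain A0 where A0: "A0 \<in> P" using \<open>P \<noteq> {}\<close> by blast
  \<comment> \<open>The sets \<open>C A\<close> may overlap or miss points, so some fitting atom is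
    chosen and \<open>A0\<close> is the default. In either case a wrong guess places the point in
    one of the symmetric differences.\<close>
  define g where "g w = (if \<exists>A\<in>P. w \<in> pre K ` C A then SOME A. A \<in> P \<and> w \<in> pre K ` C A else A0)" for w
  have g: "g w \<in> P" "(\<exists>A\<in>P. w \<in> pre K ` C A) \<Longrightarrow> w \<in> pre K ` C (g w)" for w
    using someI_ex[of "\<lambda>A. A \<in> P \<and> w \<in> pre K ` C A"] A0 unfolding g_def by (auto simp: Bex_def)
  have "{x \<in> space \<mu>. g (pre K x) \<noteq> atom_of P x} \<subseteq> (\<Union>A\<in>P. (A - C A) \<union> (C A - A))"
  proof
    fix x assume "x \<in> {x \<in> space \<mu>. g (pre K x) \<noteq> atom_of P x}"
    then have x: "x \<in> space \<mu>" and ne: "g (pre K x) \<noteq> atom_of P x" by blast+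
    have a: "atom_of P x \<in> P" "x \<in> atom_of P x" using atom_of_mem[OF P x] by auto
    show "x \<in> (\<Union>A\<in>P. (A - C A) \<union> (C A - A))"
    proof (cases "x \<in> C (atom_of P x)")
      case False
      then show ?thesis using a by blast
    next
      case True
      then have "pre K x \<in> pre K ` C (g (pre K x))" using a(1) by (intro g(2)) blast
      then obtain y where y: "y \<in> C (g (pre K x))" "pre K x = pre K y" by blast
      have "x \<in> C (g (pre K x))" using K[OF g(1), of "pre K x"] y x unfolding determined_def space_mu by metis
      moreover have "x \<notin> g (pre K x)" using atom_of_eq[OF P g(1)] ne by metis
      ultimately show ?thesis using g(1) by blast
    qed
  qed
  then have "prob {x \<in> space \<mu>. g (pre K x) \<noteq> atom_of P x} \<le> prob (\<Union>A\<in>P. (A - C A) \<union> (C A - A))"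
    using finP setsP Cs by (intro finite_measure_mono) auto
  also have "\<dots> \<le> (\<Sum>A\<in>P. prob ((A - C A) \<union> (C A - A)))"
    using finP setsP Cs by (intro measure_UNION_le) auto
  also have "\<dots> \<le> (\<Sum>A\<in>P. d / c)" by (intro sum_mono less_imp_le C(2))
  also have "\<dots> = d" using c by (simp add: c_def)
  finally show ?thesis using g(1) by (intro exI[of _ K] exI[of _ g]) auto
qed

text \<open>\<open>E\<close> is the correction of the guess: nothing when the guess is right, the
  true atom otherwise. Its value \<open>None\<close> has mass at least 1 - d and contributes at most
  d, and every other value has mass at most d.\<close>

lemma entropy_error_small:
  assumes P: "fin_partition \<mu> P" and f: "range f \<subseteq> P"
    and d: "prob {x \<in> space \<mu>. f (pre k x) \<noteq> atom_of P x} \<le> d"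
    and E: "E = (\<lambda>x. if f (pre k x) = atom_of P x then None else Some (atom_of P x))"
  shows "simple_function \<mu> E" "rv_ent \<mu> E \<le> d + real (card P) * (2 * sqrt d)"
proof -
  have finP: "finite P" using P by (auto simp: fin_partition_def)
  have eq: "E = (\<lambda>(w, a). if f w = a then None else Some a) \<circ> (\<lambda>x. (pre k x, atom_of P x))"
    by (auto simp: E)
  show sE: "simple_function \<mu> E"
    unfolding eq by (rule simple_function_compose[OF simple_function_Pair[OF simple_function_pre simple_function_atom_of[OF P]]])
  define B where "B = {x \<in> space \<mu>. f (pre k x) \<noteq> atom_of P x}"
  have EN: "E x = None \<longleftrightarrow> f (pre k x) = atom_of P x" for x by (simp add: E)
  have None_B: "E -` {None} \<inter> space \<mu> = space \<mu> - B" unfolding B_def using EN by blast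
  have "B = space \<mu> - (E -` {None} \<inter> space \<mu>)" unfolding B_def using EN by blast
  then have B: "B \<in> sets \<mu>"
    using sets.Diff[OF sets.top simple_functionD(2)[OF sE, of "{None}"]] by simp
  have "E ` space \<mu> \<subseteq> insert None (Some ` P)" using atom_of_mem(1)[OF P] by (auto simp: E)
  then have "rv_ent \<mu> E = (\<Sum>v\<in>insert None (Some ` P). ent_fun (prob (E -` {v} \<inter> space \<mu>)))"
    using finP by (intro rv_ent_superset) auto
  also have "\<dots> = ent_fun (prob (space \<mu> - B)) + (\<Sum>A\<in>P. ent_fun (prob (E -` {Some A} \<inter> space \<mu>)))"
    using finP by (simp add: None_B sum.reindex image_iff o_def del: space_mu)
  also have "ent_fun (prob (space \<mu> - B)) \<le> d"
    using ent_fun_le_one_minus[of "prob (space \<mu> - B)"] d prob_compl[OF B] unfolding B_def[symmetric] by simp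
  also have "(\<Sum>A\<in>P. ent_fun (prob (E -` {Some A} \<inter> space \<mu>))) \<le> (\<Sum>A\<in>P. 2 * sqrt d)"
  proof (rule sum_mono)
    fix A
    have "prob (E -` {Some A} \<inter> space \<mu>) \<le> prob B"
    proof (rule finite_measure_mono[OF _ B], rule subsetI)
      fix x assume "x \<in> E -` {Some A} \<inter> space \<mu>"
      then have "E x \<noteq> None" "x \<in> space \<mu>" by auto
      then show "x \<in> B" using EN[of x] by (simp add: B_def)
    qed
    then have "prob (E -` {Some A} \<inter> space \<mu>) \<le> d" using d unfolding B_def by linarith
    then have "sqrt (prob (E -` {Some A} \<inter> space \<mu>)) \<le> sqrt d" by (rule real_sqrt_le_mono)
    then show "ent_fun (prob (E -` {Some A} \<inter> space \<mu>)) \<le> 2 * sqrt d"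
      using ent_fun_le_sqrt[OF measure_nonneg, of \<mu> "E -` {Some A} \<inter> space \<mu>"] by linarith
  qed
  finally show "rv_ent \<mu> E \<le> d + real (card P) * (2 * sqrt d)" by simp
qed

text \<open>The first n + k symbols yield all n guesses, and the itinerary of corrections repairs
  them. The corrections cost at most e per step, the k extra symbols a constant.\<close>

lemma itin_entropy_le:
  assumes P: "fin_partition \<mu> P" and "e > 0"
  shows "\<exists>c. \<forall>n. rv_ent \<mu> (itin shift (atom_of P) n) \<le> rv_ent \<mu> (pre n) + c + real n * e"
proof -
  \<comment> \<open>The error probability will be r^2. As r \<le> 1, the entropy of the correction
    is then at most r (1 + 2 \<open>card P\<close>), hence at most e.\<close>
  define r where "r = min 1 (e / (1 + 2 * real (card P)))"
  have r: "r > 0" "r \<le> 1" "r \<le> e / (1 + 2 * real (card P))"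
    using \<open>e > 0\<close> unfolding r_def by (auto simp: add_pos_nonneg)
  then have r3: "r * (1 + 2 * real (card P)) \<le> e" by (simp add: field_simps)
  obtain k f where f: "range f \<subseteq> P" "prob {x \<in> space \<mu>. f (pre k x) \<noteq> atom_of P x} \<le> r\<^sup>2"
    using approx_partition[OF P, of "r\<^sup>2"] r(1) by auto
  define E where "E = (\<lambda>x. if f (pre k x) = atom_of P x then None else Some (atom_of P x))"
  note ee = entropy_error_small[OF P f E_def]
  have "r\<^sup>2 \<le> r" using r by (simp add: power2_eq_square mult_left_le)
  then have Ee: "rv_ent \<mu> E \<le> e" using ee(2) r3 r(1) by (simp add: algebra_simps)
  have "rv_ent \<mu> (itin shift (atom_of P) n) \<le> rv_ent \<mu> (pre n) + rv_ent \<mu> (pre k) + real n * e" for n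
  proof -
    have "rv_ent \<mu> (itin shift (atom_of P) n) \<le> rv_ent \<mu> (pre (n + k)) + rv_ent \<mu> (itin shift E n)"
    proof (rule rv_ent_le_Pair[OF simple_function_pre simple_function_itin[OF ee(1)] simple_function_itin[OF simple_function_atom_of[OF P]]])
      fix x y assume eq: "pre (n + k) x = pre (n + k) y" "itin shift E n x = itin shift E n y"
      have "atom_of P ((shift ^^ i) x) = atom_of P ((shift ^^ i) y)" if "i < n" for i
      proof -
        have "pre k ((shift ^^ i) x) = pre k ((shift ^^ i) y)"
          using pre_eq_mono[OF pre_eq_shift[OF eq(1), of i], of k] that by simp
        moreover have "E ((shift ^^ i) x) = E ((shift ^^ i) y)"
          using eq(2) that by (simp add: itin_determined)
        ultimately show ?thesis by (auto simp: E_def split: if_splits)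
      qed
      then show "itin shift (atom_of P) n x = itin shift (atom_of P) n y" by (simp add: itin_determined)
    qed
    also have "rv_ent \<mu> (pre (n + k)) \<le> rv_ent \<mu> (pre n) + rv_ent \<mu> (pre k)" by (rule cyl_ent_add)
    also have "rv_ent \<mu> (itin shift E n) \<le> real n * rv_ent \<mu> E" by (rule rv_ent_itin_le[OF ee(1)])
    also have "real n * rv_ent \<mu> E \<le> real n * e" using Ee by (intro mult_left_mono) auto
    finally show ?thesis by simp
  qed
  then show ?thesis by blast
qed

lemma entropy_rel_lim:
  assumes P: "fin_partition \<mu> P"
  shows "(\<lambda>n. rv_ent \<mu> (itin shift (atom_of P) n) / real n) \<longlonglongrightarrow> entropy_rel \<mu> shift P"
proof -
  obtain L where L: "(\<lambda>n. rv_ent \<mu> (itin shift (atom_of P) n) / real n) \<longlonglongrightarrow> L"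
    by (rule fekete[of "\<lambda>n. rv_ent \<mu> (itin shift (atom_of P) n)", OF rv_ent_itin_add[OF simple_function_atom_of[OF P]] rv_ent_nonneg]) blast
  have "partition_entropy \<mu> (dyn_join \<mu> shift P n) = rv_ent \<mu> (itin shift (atom_of P) n)" for n
    by (rule partition_entropy_dyn_join[OF P]) (simp add: full_shift_shift)
  then have "entropy_rel \<mu> shift P = lim (\<lambda>n. rv_ent \<mu> (itin shift (atom_of P) n) / real n)"
    by (simp add: entropy_rel_def)
  then show ?thesis using L limI[OF L] by simp
qed

text \<open>No partition has a larger entropy rate than the cylinders, because the comparison of
  itineraries loses an arbitrarily small e per step; and the cylinder rate is an infimum.\<close>

lemma entropy_rel_le:
  assumes P: "fin_partition \<mu> P" and "n \<ge> 1"
  shows "entropy_rel \<mu> shift P \<le> rv_ent \<mu> (pre n) / real n"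
proof -
  obtain L where L: "(\<lambda>n. rv_ent \<mu> (pre n) / real n) \<longlonglongrightarrow> L" "\<And>n. n \<ge> 1 \<Longrightarrow> L \<le> rv_ent \<mu> (pre n) / real n"
    by (rule fekete[of "\<lambda>n. rv_ent \<mu> (pre n)", OF cyl_ent_add rv_ent_nonneg]) blast
  have "entropy_rel \<mu> shift P \<le> L"
  proof (rule field_le_epsilon)
    fix e :: real assume "e > 0"
    then obtain c where c: "\<And>n. rv_ent \<mu> (itin shift (atom_of P) n) \<le> rv_ent \<mu> (pre n) + c + real n * e"
      using itin_entropy_le[OF P] by blast
    have "(\<lambda>n. rv_ent \<mu> (pre n) / real n + c / real n + e) \<longlonglongrightarrow> L + 0 + e"
      by (intro tendsto_add L(1) lim_const_over_n tendsto_const)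
    moreover have "eventually (\<lambda>n. rv_ent \<mu> (itin shift (atom_of P) n) / real n \<le> rv_ent \<mu> (pre n) / real n + c / real n + e) sequentially"
      using eventually_gt_at_top[of 0] by eventually_elim (use c in \<open>simp add: field_simps\<close>)
    ultimately show "entropy_rel \<mu> shift P \<le> L + e"
      using tendsto_le[OF sequentially_bot _ entropy_rel_lim[OF P]] by simp
  qed
  then show ?thesis using L(2)[OF \<open>n \<ge> 1\<close>] by linarith
qed

section \<open>Entropy of the shift in terms of words\<close>

lemma partition_exists: "fin_partition \<mu> {space \<mu>}"
  using sets.top[of \<mu>] by (auto simp: fin_partition_def disjoint_def)

theorem ks_entropy_le: "n \<ge> 1 \<Longrightarrow> ks_entropy \<mu> shift \<le> rv_ent \<mu> (pre n) / real n"
  unfolding ks_entropy_def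
proof (rule cSUP_least)
  show "{P. fin_partition \<mu> P} \<noteq> {}" using partition_exists by blast
qed (rule entropy_rel_le, auto)

definition coord_partition :: "(nat \<Rightarrow> nat) set set" where
  "coord_partition = (\<lambda>a. {\<omega> \<in> space \<mu>. \<omega> 0 = a}) ` {1..m}"

lemma coord_partition: "fin_partition \<mu> coord_partition"
proof -
  have "{\<omega> \<in> full_shift m. \<omega> 0 = a} \<in> sets (shift_space m)" for a
  proof -
    have "{\<omega> \<in> full_shift m. \<omega> 0 = a} = {\<omega> \<in> full_shift m. pre 1 \<omega> \<in> {[a]}}"
      by (simp add: pre_def)
    then show ?thesis using cylinder_sets[of m 1 "{[a]}"] by (simp only:)
  qed
  moreover have "disjoint coord_partition"
  proof (rule disjointI)
    fix A B assume "A \<in> coord_partition" "B \<in> coord_partition" and ne: "A \<noteq> B"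
    from \<open>A \<in> coord_partition\<close> obtain a where a: "A = {\<omega> \<in> space \<mu>. \<omega> 0 = a}"
      unfolding coord_partition_def by (elim imageE)
    from \<open>B \<in> coord_partition\<close> obtain b where b: "B = {\<omega> \<in> space \<mu>. \<omega> 0 = b}"
      unfolding coord_partition_def by (elim imageE)
    have "a \<noteq> b" using ne unfolding a b by (rule contrapos_nn) simp
    then have "x \<notin> B" if "x \<in> A" for x using that unfolding a b mem_Collect_eq by simp
    then show "A \<inter> B = {}" unfolding disjoint_iff by simp
  qed
  moreover have "\<Union>coord_partition = space \<mu>"
  proof
    show "space \<mu> \<subseteq> \<Union>coord_partition"
    proof
      fix \<omega> assume w: "\<omega> \<in> space \<mu>"
      then have "\<omega> 0 \<in> {1..m}" using full_shiftD by simp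
      then show "\<omega> \<in> \<Union>coord_partition"
        unfolding coord_partition_def using w by (intro UnionI[OF imageI]) simp_all
    qed
  qed (unfold coord_partition_def, blast)
  moreover have "finite coord_partition" by (simp add: coord_partition_def)
  ultimately show ?thesis unfolding fin_partition_def by (simp add: coord_partition_def image_subset_iff)
qed

text \<open>The coordinate partition is a competitor in the supremum, and its itineraries determine
  the words.\<close>

theorem ks_entropy_ge:
  assumes "\<And>n. n \<ge> 1 \<Longrightarrow> c \<le> rv_ent \<mu> (pre n) / real n"
  shows "c \<le> ks_entropy \<mu> shift"
proof -
  let ?P = coord_partition
  have at: "x 0 = y 0" if "atom_of ?P x = atom_of ?P y" "x \<in> space \<mu>" "y \<in> space \<mu>" for x y
  proof -
    have "x \<in> atom_of ?P x" "y \<in> atom_of ?P x" "atom_of ?P x \<in> ?P"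
      using atom_of_mem[OF coord_partition that(2)] atom_of_mem[OF coord_partition that(3)] that(1) by auto
    from \<open>atom_of ?P x \<in> ?P\<close> obtain a where "atom_of ?P x = {\<omega> \<in> space \<mu>. \<omega> 0 = a}"
      unfolding coord_partition_def by (elim imageE)
    then show ?thesis using \<open>x \<in> atom_of ?P x\<close> \<open>y \<in> atom_of ?P x\<close> by simp
  qed
  have "rv_ent \<mu> (pre n) \<le> rv_ent \<mu> (itin shift (atom_of ?P) n)" for n
  proof (rule rv_ent_mono[OF simple_function_itin[OF simple_function_atom_of[OF coord_partition]] simple_function_pre])
    fix x y assume xy: "x \<in> space \<mu>" "y \<in> space \<mu>" "itin shift (atom_of ?P) n x = itin shift (atom_of ?P) n y"
    then have "(shift ^^ i) x 0 = (shift ^^ i) y 0" if "i < n" for i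
      using at[OF _ shift_in_space shift_in_space, of i x i y] that by (simp add: itin_determined)
    then show "pre n x = pre n y" by (simp add: pre_eq_iff shift_funpow)
  qed
  then have "c \<le> rv_ent \<mu> (itin shift (atom_of ?P) n) / real n" if "n \<ge> 1" for n
    using assms[OF that] by (meson divide_right_mono of_nat_0_le_iff order_trans)
  then have "c \<le> entropy_rel \<mu> shift ?P"
    by (intro LIMSEQ_le_const[OF entropy_rel_lim[OF coord_partition]]) auto
  also have "\<dots> \<le> ks_entropy \<mu> shift"
    unfolding ks_entropy_def
  proof (rule cSUP_upper)
    \<comment> \<open>A real supremum has its intended meaning only for a bounded family; the
      entropy of the first symbol bounds every partition.\<close>
    show "bdd_above (entropy_rel \<mu> shift ` {P. fin_partition \<mu> P})"
      using entropy_rel_le[of _ 1] by (intro bdd_aboveI2[of _ _ "rv_ent \<mu> (pre 1) / real 1"]) simp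
  qed (simp add: coord_partition)
  finally show ?thesis .
qed

end

subsection \<open>Hausdorff null sets and the mass distribution principle\<close>

lemma hausdorff_measure_eq_0I:
  assumes "\<And>d e. d > 0 \<Longrightarrow> e > 0 \<Longrightarrow> \<exists>U :: nat \<Rightarrow> 'a::metric_space set. E \<subseteq> (\<Union>i. U i) \<and>
      (\<forall>i. bounded (U i) \<and> diameter (U i) \<le> d) \<and> (\<Sum>i. ennreal (diameter (U i) powr s)) \<le> ennreal e"
  shows "hausdorff_measure s E = 0"
proof -
  have "hausdorff_content s d E \<le> 0" if d: "d > 0" for d
  proof (rule ennreal_le_epsilon)
    fix e :: real assume "e > 0"
    obtain U where U: "E \<subseteq> (\<Union>i. U i)" "\<forall>i. bounded (U i) \<and> diameter (U i) \<le> d"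
      "(\<Sum>i. ennreal (diameter (U i) powr s)) \<le> ennreal e"
      using assms[OF d \<open>e > 0\<close>] by blast
    have "hausdorff_content s d E \<le> (\<Sum>i. ennreal (diameter (U i) powr s))"
      unfolding hausdorff_content_def by (rule INF_lower) (use U in blast)
    then show "hausdorff_content s d E \<le> 0 + ennreal e" using U(3) by simp
  qed
  then have "(SUP d\<in>{0<..}. hausdorff_content s d E) \<le> 0" by (intro SUP_least) simp
  then show ?thesis by (simp add: hausdorff_measure_def)
qed

lemma hausdorff_measure_eq_0E:
  fixes E :: "'a::metric_space set"
  assumes "hausdorff_measure s E = 0" "d > 0" "e > 0"
  obtains U :: "nat \<Rightarrow> 'a set" where "E \<subseteq> (\<Union>i. U i)" "\<And>i. bounded (U i)" "\<And>i. diameter (U i) \<le> d"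
    "(\<Sum>i. ennreal (diameter (U i) powr s)) < ennreal e"
proof -
  have "hausdorff_content s d E \<le> hausdorff_measure s E"
    unfolding hausdorff_measure_def by (rule SUP_upper) (use assms in auto)
  then have "hausdorff_content s d E < ennreal e" using assms by simp
  then show ?thesis unfolding hausdorff_content_def INF_less_iff using that by blast
qed

lemma hausdorff_null_mono:
  assumes "hausdorff_measure s F = 0" "E \<subseteq> F" shows "hausdorff_measure s E = 0"
proof (rule hausdorff_measure_eq_0I)
  fix d e :: real assume "d > 0" "e > 0"
  obtain U where U: "F \<subseteq> (\<Union>i. U i)" "\<And>i. bounded (U i)" "\<And>i. diameter (U i) \<le> d"
    "(\<Sum>i. ennreal (diameter (U i) powr s)) < ennreal e"
    using hausdorff_measure_eq_0E[OF assms(1) \<open>d > 0\<close> \<open>e > 0\<close>] by metis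
  then show "\<exists>U. E \<subseteq> (\<Union>i. U i) \<and> (\<forall>i. bounded (U i) \<and> diameter (U i) \<le> d) \<and>
      (\<Sum>i. ennreal (diameter (U i) powr s)) \<le> ennreal e"
    using assms(2) by (intro exI[of _ U]) auto
qed

text \<open>Adapts finite covers, with an index type of the user's choice, to the sequences of sets
  that the Hausdorff content requires.\<close>

lemma hausdorff_null_finite_cover:
  fixes E :: "'a::metric_space set"
  assumes "\<And>d e. d > 0 \<Longrightarrow> e > 0 \<Longrightarrow> \<exists>(I :: 'i set) V. finite I \<and> E \<subseteq> (\<Union>i\<in>I. V i) \<and>
      (\<forall>i\<in>I. bounded (V i) \<and> diameter (V i) \<le> d) \<and> (\<Sum>i\<in>I. diameter (V i) powr s) \<le> e"
  shows "hausdorff_measure s E = 0"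
proof (rule hausdorff_measure_eq_0I)
  fix d e :: real assume de: "d > 0" "e > 0"
  obtain I :: "'i set" and V where V: "finite I" "E \<subseteq> (\<Union>i\<in>I. V i)"
    "\<forall>i\<in>I. bounded (V i) \<and> diameter (V i) \<le> d" "(\<Sum>i\<in>I. diameter (V i) powr s) \<le> e"
    using assms[OF de] by blast
  obtain h where h: "bij_betw h {0..<card I} I" using ex_bij_betw_nat_finite[OF V(1)] by blast
  \<comment> \<open>The tail of empty sets contributes nothing, since
    \<open>0 powr s = 0\<close>.\<close>
  define U where "U n = (if n < card I then V (h n) else {})" for n
  have hI: "h n \<in> I" if "n < card I" for n using bij_betwE[OF h] that by simp
  have "E \<subseteq> (\<Union>n. U n)"
  proof
    fix x assume "x \<in> E"
    then obtain i where i: "i \<in> I" "x \<in> V i" using V(2) by blast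
    then obtain n where "n < card I" "h n = i" using bij_betw_imp_surj_on[OF h] by (metis atLeastLessThan_iff imageE)
    then show "x \<in> (\<Union>n. U n)" using i unfolding U_def by auto
  qed
  moreover have "bounded (U n) \<and> diameter (U n) \<le> d" for n
    using hI[of n] V(3) de by (simp add: U_def)
  moreover have "(\<Sum>n. ennreal (diameter (U n) powr s)) = ennreal (\<Sum>i\<in>I. diameter (V i) powr s)"
  proof -
    have "(\<Sum>n. ennreal (diameter (U n) powr s)) = (\<Sum>n\<in>{0..<card I}. ennreal (diameter (U n) powr s))"
      by (rule suminf_finite) (auto simp: U_def)
    also have "\<dots> = (\<Sum>n\<in>{0..<card I}. ennreal (diameter (V (h n)) powr s))" by (simp add: U_def)
    also have "\<dots> = (\<Sum>i\<in>I. ennreal (diameter (V i) powr s))" by (rule sum.reindex_bij_betw[OF h])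
    finally show ?thesis by simp
  qed
  ultimately show "\<exists>U. E \<subseteq> (\<Union>i. U i) \<and> (\<forall>i. bounded (U i) \<and> diameter (U i) \<le> d) \<and>
      (\<Sum>i. ennreal (diameter (U i) powr s)) \<le> ennreal e"
    using V(4) de by (intro exI[of _ U]) (simp add: ennreal_leI)
qed

lemma suminf_half_powers: "e \<ge> 0 \<Longrightarrow> (\<Sum>i. ennreal (e * (1/2) ^ Suc i)) = ennreal e"
  using sums_mult[OF power_half_series, of e] by (intro suminf_ennreal_eq) auto

lemma hausdorff_null_UN:
  fixes E :: "nat \<Rightarrow> 'a::metric_space set"
  assumes "\<And>k. hausdorff_measure s (E k) = 0" shows "hausdorff_measure s (\<Union>k. E k) = 0"
proof (rule hausdorff_measure_eq_0I)
  fix d e :: real assume de: "d > 0" "e > 0"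
  have "\<forall>k. \<exists>U. E k \<subseteq> (\<Union>i. U i) \<and> (\<forall>i. bounded (U i) \<and> diameter (U i) \<le> d) \<and>
      (\<Sum>i. ennreal (diameter (U i) powr s)) \<le> ennreal (e * (1/2) ^ Suc k)"
  proof
    fix k
    have ek: "e * (1/2) ^ Suc k > 0" using de by simp
    obtain U where "E k \<subseteq> (\<Union>i. U i)" "\<And>i. bounded (U i)" "\<And>i. diameter (U i) \<le> d"
      "(\<Sum>i. ennreal (diameter (U i) powr s)) < ennreal (e * (1/2) ^ Suc k)"
      by (rule hausdorff_measure_eq_0E[OF assms[of k] de(1) ek]) blast
    then show "\<exists>U. E k \<subseteq> (\<Union>i. U i) \<and> (\<forall>i. bounded (U i) \<and> diameter (U i) \<le> d) \<and>
      (\<Sum>i. ennreal (diameter (U i) powr s)) \<le> ennreal (e * (1/2) ^ Suc k)"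
      by (intro exI[of _ U]) (simp add: order_less_imp_le)
  qed
  from choice[OF this] obtain U where "\<forall>k. E k \<subseteq> (\<Union>i. U k i) \<and> (\<forall>i. bounded (U k i) \<and> diameter (U k i) \<le> d) \<and>
      (\<Sum>i. ennreal (diameter (U k i) powr s)) \<le> ennreal (e * (1/2) ^ Suc k)"
    by (elim exE)
  then have U: "\<And>k. E k \<subseteq> (\<Union>i. U k i)" "\<And>k i. bounded (U k i)" "\<And>k i. diameter (U k i) \<le> d"
     "\<And>k. (\<Sum>i. ennreal (diameter (U k i) powr s)) \<le> ennreal (e * (1/2) ^ Suc k)"
    by blast+
  define V where "V n = (case prod_decode n of (k, i) \<Rightarrow> U k i)" for n
  have "(\<Sum>n. ennreal (diameter (V n) powr s)) = (\<Sum>k. \<Sum>i. ennreal (diameter (U k i) powr s))"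
  proof -
    have "(\<Sum>n. (\<lambda>p. ennreal (diameter (U (fst p) (snd p)) powr s)) (prod_decode n))
        = (\<Sum>k. \<Sum>i. ennreal (diameter (U k i) powr s))"
      by (rule suminf_ennreal_2dimen) (simp only: fst_conv snd_conv)
    then show ?thesis unfolding V_def case_prod_beta .
  qed
  also have "\<dots> \<le> (\<Sum>k. ennreal (e * (1/2) ^ Suc k))" by (intro suminf_le U(4)) auto
  also have "\<dots> = ennreal e" using de by (intro suminf_half_powers) auto
  finally have "(\<Sum>n. ennreal (diameter (V n) powr s)) \<le> ennreal e" .
  moreover have "(\<Union>k. E k) \<subseteq> (\<Union>n. V n)"
  proof
    fix x assume "x \<in> (\<Union>k. E k)"
    then obtain k i where "x \<in> U k i" using U(1) by blast
    then have "x \<in> V (prod_encode (k, i))" by (simp add: V_def)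
    then show "x \<in> (\<Union>n. V n)" by blast
  qed
  moreover have "bounded (V n) \<and> diameter (V n) \<le> d" for n
    using U(2,3) by (simp add: V_def case_prod_beta)
  ultimately show "\<exists>U. (\<Union>k. E k) \<subseteq> (\<Union>i. U i) \<and> (\<forall>i. bounded (U i) \<and> diameter (U i) \<le> d) \<and>
      (\<Sum>i. ennreal (diameter (U i) powr s)) \<le> ennreal e" by blast
qed

text \<open>The mass bound is stated on the parameter side: Q lives on codes, x maps them to points,
  and \<open>B\<close> is a measurable set covering the codes that land in U. The radius r may
  exceed the diameter, which is needed for sets of diameter 0.\<close>

lemma mass_distribution:
  fixes x :: "'b \<Rightarrow> 'a::metric_space"
  assumes Q: "prob_space Q" and G: "G \<in> sets Q" "measure Q G > 0" and pos: "C > 0" "s > 0" "d > 0"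
    and mass: "\<And>U r. bounded U \<Longrightarrow> diameter U \<le> r \<Longrightarrow> 0 < r \<Longrightarrow> r \<le> d \<Longrightarrow>
       \<exists>B\<in>sets Q. {w \<in> G. x w \<in> U} \<subseteq> B \<and> measure Q B \<le> C * r powr s"
    and E: "x ` G \<subseteq> E"
  shows "hausdorff_measure s E \<noteq> 0"
proof
  assume null: "hausdorff_measure s E = 0"
  interpret prob_space Q by fact
  \<comment> \<open>The cover and the correction of its radii each contribute at most e, so G would
    have at most C (2 e), half of its own mass.\<close>
  define e where "e = measure Q G / (4 * C)"
  have e: "e > 0" using G pos by (simp add: e_def)
  obtain U where U: "E \<subseteq> (\<Union>i. U i)" "\<And>i. bounded (U i)" "\<And>i. diameter (U i) \<le> d"
    "(\<Sum>i. ennreal (diameter (U i) powr s)) < ennreal e"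
    using hausdorff_measure_eq_0E[OF null \<open>d > 0\<close> e] by metis
  \<comment> \<open>A set of diameter 0 contributes 0 to the sum but may carry mass. It receives a
    positive radius whose s-th power is at most the i-th term of a geometric series with sum
    e.\<close>
  define r where "r i = (if diameter (U i) > 0 then diameter (U i) else min d ((e * (1/2) ^ Suc i) powr (1 / s)))" for i :: nat
  have r: "diameter (U i) \<le> r i" "0 < r i" "r i \<le> d" for i
    using U(3)[of i] pos e diameter_ge_0[OF U(2)[of i]] by (auto simp: r_def)
  have "r i powr s \<le> diameter (U i) powr s + e * (1/2) ^ Suc i" for i
  proof (cases "diameter (U i) > 0")
    case False
    have "r i powr s \<le> ((e * (1/2) ^ Suc i) powr (1 / s)) powr s"
      using False r[of i] pos by (intro powr_mono2) (auto simp: r_def)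
    also have "\<dots> = e * (1/2) ^ Suc i" using pos e by (simp add: powr_powr)
    finally show ?thesis by (smt (verit) powr_ge_zero)
  qed (use e in \<open>simp add: r_def\<close>)
  then have rs: "ennreal (r i powr s) \<le> ennreal (diameter (U i) powr s) + ennreal (e * (1/2) ^ Suc i)" for i
  proof -
    have "ennreal (r i powr s) \<le> ennreal (diameter (U i) powr s + e * (1/2) ^ Suc i)"
      by (rule ennreal_leI) fact
    also have "\<dots> = ennreal (diameter (U i) powr s) + ennreal (e * (1/2) ^ Suc i)"
      using e by (intro ennreal_plus) auto
    finally show ?thesis .
  qed
  obtain B where B: "\<And>i. B i \<in> sets Q" "\<And>i. {w \<in> G. x w \<in> U i} \<subseteq> B i" "\<And>i. measure Q (B i) \<le> C * r i powr s"
    using mass[OF U(2) r] by metis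
  have "G \<subseteq> (\<Union>i. B i)"
  proof
    fix w assume w: "w \<in> G"
    then have "x w \<in> E" using E by blast
    then obtain i where "x w \<in> U i" using U(1) by blast
    then show "w \<in> (\<Union>i. B i)" using B(2) w by blast
  qed
  then have "emeasure Q G \<le> emeasure Q (\<Union>i. B i)" using B(1) by (intro emeasure_mono) auto
  also have "\<dots> \<le> (\<Sum>i. emeasure Q (B i))" using B(1) by (intro emeasure_subadditive_countably) auto
  also have "\<dots> \<le> (\<Sum>i. ennreal C * (ennreal (diameter (U i) powr s) + ennreal (e * (1/2) ^ Suc i)))"
  proof (rule suminf_le)
    fix i
    have "emeasure Q (B i) \<le> ennreal (C * r i powr s)"
      using B(3)[of i] by (simp add: emeasure_eq_measure ennreal_leI)
    also have "\<dots> = ennreal C * ennreal (r i powr s)" using pos by (simp add: ennreal_mult)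
    also have "\<dots> \<le> ennreal C * (ennreal (diameter (U i) powr s) + ennreal (e * (1/2) ^ Suc i))"
      using rs by (intro mult_left_mono) auto
    finally show "emeasure Q (B i) \<le> ennreal C * (ennreal (diameter (U i) powr s) + ennreal (e * (1/2) ^ Suc i))" .
  qed auto
  also have "\<dots> = ennreal C * ((\<Sum>i. ennreal (diameter (U i) powr s)) + (\<Sum>i. ennreal (e * (1/2) ^ Suc i)))"
    by (subst ennreal_suminf_cmult, subst suminf_add) auto
  also have "(\<Sum>i. ennreal (e * (1/2) ^ Suc i)) = ennreal e" using e by (intro suminf_half_powers) auto
  also have "ennreal C * ((\<Sum>i. ennreal (diameter (U i) powr s)) + ennreal e) \<le> ennreal C * (ennreal e + ennreal e)"
    using U(4) by (intro mult_left_mono add_right_mono) auto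
  also have "\<dots> = ennreal (C * (2 * e))" using e pos by (simp add: ennreal_mult flip: ennreal_plus)
  finally have "measure Q G \<le> C * (2 * e)" using e pos by (simp add: emeasure_eq_measure ennreal_le_iff)
  then show False using G pos by (simp add: e_def)
qed

text \<open>The n + 1 intervals of length 1/n cost (n + 1) / n^2 \<le> 2/n. The exponent 2 is a
  convenient number above 1: it supplies an a priori bound for the supremum in the dimension
  formula.\<close>

lemma hausdorff_null_2_unit_interval:
  assumes "E \<subseteq> {0..1::real}" shows "hausdorff_measure 2 E = 0"
proof (rule hausdorff_null_finite_cover[where 'i = nat])
  fix d e :: real assume de: "d > 0" "e > 0"
  obtain n :: nat where n: "n > 0" "1 / real n < min d (e/2)"
    using real_arch_inverse[of "min d (e/2)"] de by (auto simp: inverse_eq_divide)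
  define V where "V i = {real i / real n .. real (Suc i) / real n}" for i
  have diam: "diameter (V i) = 1 / real n" for i
    using n(1) by (simp add: V_def diameter_closed_interval divide_right_mono field_simps)
  have "E \<subseteq> (\<Union>i\<in>{..<Suc n}. V i)"
  proof
    fix x assume "x \<in> E"
    then have x: "0 \<le> x" "x \<le> 1" using assms by auto
    define i where "i = nat \<lfloor>x * real n\<rfloor>"
    have i: "real i \<le> x * real n" "x * real n < real i + 1" using x unfolding i_def by (auto simp: of_nat_nat)
    have "x * real n \<le> real n" using x by (simp add: mult_left_le_one_le)
    then have "i < Suc n" using i(1) by linarith
    moreover have "x \<in> V i" using i n(1) by (auto simp: V_def field_simps)
    ultimately show "x \<in> (\<Union>i\<in>{..<Suc n}. V i)" by blast
  qed
  moreover have "(\<Sum>i\<in>{..<Suc n}. diameter (V i) powr 2) \<le> 2 * (1 / real n)"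
    using n(1) by (simp add: diam power2_eq_square field_simps)
  ultimately show "\<exists>(I :: nat set) V. finite I \<and> E \<subseteq> (\<Union>i\<in>I. V i) \<and>
      (\<forall>i\<in>I. bounded (V i) \<and> diameter (V i) \<le> d) \<and> (\<Sum>i\<in>I. diameter (V i) powr 2) \<le> e"
    using n(2) by (intro exI[of _ "{..<Suc n}"] exI[of _ V]) (auto simp: diam, auto simp: V_def)
qed

lemma hausdorff_dim_eqI:
  assumes null: "\<And>s. s > S \<Longrightarrow> hausdorff_measure s E = 0" and "S \<ge> 0"
    and low: "\<And>s. s > 0 \<Longrightarrow> hausdorff_measure s E = 0 \<Longrightarrow> S \<le> s"
  shows "hausdorff_dim E = S"
proof -
  let ?A = "{s. s > 0 \<and> hausdorff_measure s E = 0}"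
  have mem: "s \<in> ?A" if "s > S" for s using that null \<open>S \<ge> 0\<close> by auto
  have "Inf ?A \<ge> S" by (rule cInf_greatest) (use mem[of "S + 1"] low in auto)
  moreover have "Inf ?A \<le> S"
  proof (rule field_le_epsilon)
    fix e :: real assume "e > 0"
    then show "Inf ?A \<le> S + e" by (intro cInf_lower mem bdd_belowI[of _ 0]) auto
  qed
  ultimately show ?thesis by (simp add: hausdorff_dim_def)
qed

subsection \<open>Geometry of the cylinder intervals\<close>

definition word_map :: "(nat \<Rightarrow> real \<Rightarrow> real) \<Rightarrow> nat list \<Rightarrow> real \<Rightarrow> real" where
  "word_map T w = foldr (\<lambda>a f. T a \<circ> f) w id"

definition word_len :: "(nat \<Rightarrow> real \<Rightarrow> real) \<Rightarrow> nat list \<Rightarrow> real" where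
  "word_len T w = word_map T w 1 - word_map T w 0"

lemma word_map_Nil [simp]: "word_map T [] x = x" by (simp add: word_map_def)
lemma word_map_Cons [simp]: "word_map T (a # w) x = T a (word_map T w x)" by (simp add: word_map_def)
lemma word_map_append: "word_map T (u @ v) x = word_map T u (word_map T v x)"
  by (induction u) auto
lemma compose_word_eq: "compose_word T \<omega> n = word_map T (pre n \<omega>)"
  by (simp add: compose_word_def word_map_def pre_def foldr_map o_def)

locale interval_ifs =
  fixes m :: nat and T DT :: "nat \<Rightarrow> real \<Rightarrow> real"
  assumes m_pos: "m \<ge> 1"
    and maps: "\<And>i. i \<in> {1..m} \<Longrightarrow> T i ` {0..1} \<subseteq> {0..1}"
    and deriv: "\<And>i x. i \<in> {1..m} \<Longrightarrow> x \<in> {0..1} \<Longrightarrow>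
                  (T i has_real_derivative DT i x) (at x within {0..1})"
    and deriv_cont: "\<And>i. i \<in> {1..m} \<Longrightarrow> continuous_on {0..1} (DT i)"
    and deriv_pos: "\<And>i x. i \<in> {1..m} \<Longrightarrow> x \<in> {0..1} \<Longrightarrow> DT i x > 0"
    and disj: "\<And>i j. i \<in> {1..m} \<Longrightarrow> j \<in> {1..m} \<Longrightarrow> i \<noteq> j \<Longrightarrow>
                  T i ` {0<..<1} \<inter> T j ` {0<..<1} = {}"
    and contr: "\<forall>\<epsilon>>0. \<exists>N. \<forall>n\<ge>N. \<forall>\<omega>\<in>full_shift m.
                  diameter (compose_word T \<omega> n ` {0..1}) < \<epsilon>"
begin

lemma T_mvt:
  assumes "i \<in> {1..m}" "0 \<le> x" "x < y" "y \<le> 1"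
  shows "\<exists>z. x < z \<and> z < y \<and> T i y - T i x = DT i z * (y - x)"
proof -
  have "(T i has_derivative (\<lambda>h. DT i z * h)) (at z within {x..y})" if "x \<le> z" "z \<le> y" for z
    using deriv[OF assms(1), of z] that assms
    by (auto simp: has_field_derivative_def intro: has_derivative_subset)
  then have "\<exists>z\<in>{x<..<y}. T i y - T i x = DT i z * (y - x)"
    using assms(3) by (intro mvt_simple) auto
  then show ?thesis by auto
qed

lemma T_strict_mono: "i \<in> {1..m} \<Longrightarrow> 0 \<le> x \<Longrightarrow> x < y \<Longrightarrow> y \<le> 1 \<Longrightarrow> T i x < T i y"
  using T_mvt[of i x y] deriv_pos[of i] by (smt (verit, ccfv_SIG) atLeastAtMost_iff mult_pos_pos)

lemma T_range: "i \<in> {1..m} \<Longrightarrow> x \<in> {0..1} \<Longrightarrow> T i x \<in> {0..1}"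
  using maps by blast

lemma T_cont: "i \<in> {1..m} \<Longrightarrow> continuous_on {0..1} (T i)"
  using deriv by (intro DERIV_continuous_on) auto

lemma word_map_range: "set w \<subseteq> {1..m} \<Longrightarrow> x \<in> {0..1} \<Longrightarrow> word_map T w x \<in> {0..1}"
proof (induction w)
  case (Cons a w)
  then show ?case using T_range[of a "word_map T w x"] by simp
qed simp

lemma word_map_strict_mono:
  "set w \<subseteq> {1..m} \<Longrightarrow> 0 \<le> x \<Longrightarrow> x < y \<Longrightarrow> y \<le> 1 \<Longrightarrow> word_map T w x < word_map T w y"
proof (induction w)
  case (Cons a w)
  have "word_map T w x \<in> {0..1}" "word_map T w y \<in> {0..1}"
    using Cons.prems by (auto intro!: word_map_range simp del: atLeastAtMost_iff) auto
  then show ?case using T_strict_mono[of a "word_map T w x" "word_map T w y"] Cons by simp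
qed simp

lemma word_map_mono:
  "set w \<subseteq> {1..m} \<Longrightarrow> 0 \<le> x \<Longrightarrow> x \<le> y \<Longrightarrow> y \<le> 1 \<Longrightarrow> word_map T w x \<le> word_map T w y"
  using word_map_strict_mono[of w x y] by (cases "x = y") auto

lemma word_map_cont: "set w \<subseteq> {1..m} \<Longrightarrow> continuous_on {0..1} (word_map T w)"
proof (induction w)
  case Nil
  have "word_map T [] = (\<lambda>x. x)" by auto
  then show ?case by simp
next
  case (Cons a w)
  have "word_map T (a # w) = (\<lambda>x. T a (word_map T w x))" by auto
  moreover have "word_map T w ` {0..1} \<subseteq> {0..1}" using Cons.prems word_map_range[of w] by auto
  ultimately show ?case using Cons T_cont[of a] by (auto intro: continuous_on_compose2)
qed

lemma word_len_pos: "set w \<subseteq> {1..m} \<Longrightarrow> word_len T w > 0"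
  using word_map_strict_mono[of w 0 1] by (simp add: word_len_def)

lemma word_map_interior:
  assumes "set w \<subseteq> {1..m}" "0 < x" "x < 1" shows "0 < word_map T w x" "word_map T w x < 1"
  using word_map_strict_mono[OF assms(1), of 0 x] word_map_strict_mono[OF assms(1), of x 1]
    word_map_range[OF assms(1), of 0] word_map_range[OF assms(1), of 1] assms by auto

text \<open>Peel off first letters: points of (0,1) stay in (0,1), so equal images force equal first
  letters by disjointness, and the first map is injective by strict monotonicity.\<close>

lemma word_map_inj:
  assumes "length v = length w" "set v \<subseteq> {1..m}" "set w \<subseteq> {1..m}" "0 < x" "x < 1" "0 < y" "y < 1"
    and "word_map T v x = word_map T w y"
  shows "v = w"
  using assms
proof (induction v w rule: list_induct2)
  case (Cons a v b w)
  have v: "0 < word_map T v x" "word_map T v x < 1" using word_map_interior[of v x] Cons.prems by auto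
  have w: "0 < word_map T w y" "word_map T w y < 1" using word_map_interior[of w y] Cons.prems by auto
  have eq: "T a (word_map T v x) = T b (word_map T w y)" using Cons.prems by simp
  have ab: "a \<in> {1..m}" "b \<in> {1..m}" using Cons.prems by auto
  have "a = b"
  proof (rule ccontr)
    assume "a \<noteq> b"
    then have "T a ` {0<..<1} \<inter> T b ` {0<..<1} = {}" using disj ab by blast
    moreover have "T a (word_map T v x) \<in> T a ` {0<..<1}" "T b (word_map T w y) \<in> T b ` {0<..<1}"
      using v w by auto
    ultimately show False using eq by auto
  qed
  moreover have "word_map T v x = word_map T w y"
    using T_strict_mono[OF ab(1), of "word_map T v x" "word_map T w y"]
      T_strict_mono[OF ab(1), of "word_map T w y" "word_map T v x"] eq v w \<open>a = b\<close>
    by (cases "word_map T v x" "word_map T w y" rule: linorder_cases) auto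
  ultimately show ?case using Cons.IH Cons.prems by simp
qed simp

lemma word_map_ivt:
  assumes w: "set w \<subseteq> {1..m}" and t: "word_map T w 0 < t" "t < word_map T w 1"
  shows "\<exists>x. 0 < x \<and> x < 1 \<and> word_map T w x = t"
proof -
  have "\<exists>x\<ge>0. x \<le> 1 \<and> word_map T w x = t"
    using t by (intro IVT' word_map_cont[OF w]) auto
  then obtain x where x: "0 \<le> x" "x \<le> 1" "word_map T w x = t" by blast
  then have "x \<noteq> 0" "x \<noteq> 1" using t by auto
  then show ?thesis using x by (intro exI[of _ x]) auto
qed

text \<open>By the intermediate value theorem a common inner point has a preimage in (0,1) under
  both maps, and \<open>word_map_inj\<close> applies.\<close>

lemma word_intervals_disjoint:
  assumes "v \<in> words m n" "w \<in> words m n"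
    and "word_map T v 0 < t" "t < word_map T v 1" "word_map T w 0 < t" "t < word_map T w 1"
  shows "v = w"
proof -
  have vw: "set v \<subseteq> {1..m}" "set w \<subseteq> {1..m}" "length v = length w" using assms by (auto simp: words_def)
  obtain x where x: "0 < x" "x < 1" "word_map T v x = t" using word_map_ivt[OF vw(1) assms(3,4)] by blast
  obtain y where y: "0 < y" "y < 1" "word_map T w y = t" using word_map_ivt[OF vw(2) assms(5,6)] by blast
  show ?thesis by (rule word_map_inj[OF vw(3,1,2) x(1,2) y(1,2)]) (simp add: x y)
qed

lemma set_pre: "\<omega> \<in> full_shift m \<Longrightarrow> set (pre n \<omega>) \<subseteq> {1..m}"
  using pre_in_words[of \<omega> m n] by (simp add: words_def)

section \<open>The coding map and the logarithmic lengths of cylinders\<close>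

lemma word_len_uniform:
  assumes "e > 0" shows "\<exists>N. \<forall>n\<ge>N. \<forall>\<omega>\<in>full_shift m. word_len T (pre n \<omega>) < e"
proof -
  obtain N where N: "\<And>n \<omega>. n \<ge> N \<Longrightarrow> \<omega> \<in> full_shift m \<Longrightarrow> diameter (compose_word T \<omega> n ` {0..1}) < e"
    using contr assms by blast
  have "word_len T (pre n \<omega>) < e" if "n \<ge> N" "\<omega> \<in> full_shift m" for n \<omega>
  proof -
    have "word_map T (pre n \<omega>) ` {0..1} \<subseteq> {0..1}" using word_map_range[OF set_pre[OF that(2)]] by blast
    then have "bounded (word_map T (pre n \<omega>) ` {0..1})" by (rule bounded_subset[OF bounded_closed_interval])
    then have "dist (word_map T (pre n \<omega>) 1) (word_map T (pre n \<omega>) 0) \<le> diameter (word_map T (pre n \<omega>) ` {0..1})"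
      by (rule diameter_bounded_bound) auto
    then show ?thesis using N[OF that] by (simp add: word_len_def dist_real_def compose_word_eq)
  qed
  then show ?thesis by blast
qed

text \<open>Every later left endpoint is the image under the n-th word map of a point of [0,1]. The
  left endpoints therefore increase and stay below the right endpoint, which also shows that the
  limit defining \<open>coding\<close> exists.\<close>

lemma coding_bounds:
  assumes \<omega>: "\<omega> \<in> full_shift m"
  shows "word_map T (pre n \<omega>) 0 \<le> coding T \<omega>" "coding T \<omega> \<le> word_map T (pre n \<omega>) 1"
proof -
  let ?c = "\<lambda>n. word_map T (pre n \<omega>) 0"
  have split: "\<exists>x\<in>{0..1}. ?c (n + k) = word_map T (pre n \<omega>) x" for n k
  proof
    show "?c (n + k) = word_map T (pre n \<omega>) (word_map T (pre k (\<lambda>i. \<omega> (i + n))) 0)"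
      by (simp add: pre_add word_map_append)
    have "(\<lambda>i. \<omega> (i + n)) \<in> full_shift m" using full_shift_funpow[OF \<omega>, of n] by (simp add: shift_funpow)
    then show "word_map T (pre k (\<lambda>i. \<omega> (i + n))) 0 \<in> {0..1}" by (intro word_map_range set_pre) auto
  qed
  have bd: "?c n \<le> ?c k \<and> ?c k \<le> word_map T (pre n \<omega>) 1" if nk: "n \<le> k" for n k
  proof -
    obtain x where x: "x \<in> {0..1}" "?c k = word_map T (pre n \<omega>) x" using split[of n "k - n"] nk by auto
    then show ?thesis using word_map_mono[OF set_pre[OF \<omega>], of 0 x] word_map_mono[OF set_pre[OF \<omega>], of x 1] by auto
  qed
  have "incseq ?c" using bd by (auto simp: incseq_def)
  moreover have "?c n \<le> 1" for n using word_map_range[OF set_pre[OF \<omega>, of n], of 0] by simp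
  ultimately obtain L where L: "?c \<longlonglongrightarrow> L" using incseq_convergent[of ?c 1] by blast
  then have cL: "coding T \<omega> = L" unfolding coding_def compose_word_eq by (rule limI)
  show "?c n \<le> coding T \<omega>" unfolding cL by (rule LIMSEQ_le_const[OF L]) (use bd in blast)
  show "coding T \<omega> \<le> word_map T (pre n \<omega>) 1" unfolding cL by (rule LIMSEQ_le_const2[OF L]) (use bd in blast)
qed

lemma coding_range: "\<omega> \<in> full_shift m \<Longrightarrow> coding T \<omega> \<in> {0..1}"
  using coding_bounds[of \<omega> 0] by simp

lemma log_deriv_uniform:
  assumes "e > 0"
  shows "\<exists>d>0. \<forall>a\<in>{1..m}. \<forall>x\<in>{0..1}. \<forall>y\<in>{0..1}. \<bar>x - y\<bar> < d \<longrightarrow> \<bar>ln (DT a x) - ln (DT a y)\<bar> \<le> e"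
proof -
  have "\<exists>d>0. \<forall>x\<in>{0..1}. \<forall>y\<in>{0..1}. \<bar>x - y\<bar> < d \<longrightarrow> \<bar>ln (DT a x) - ln (DT a y)\<bar> \<le> e" if a: "a \<in> {1..m}" for a
  proof -
    have "continuous_on {0..1} (\<lambda>x. ln (DT a x))"
      using deriv_pos[OF a] by (intro continuous_on_ln deriv_cont a) force
    then have "uniformly_continuous_on {0..1} (\<lambda>x. ln (DT a x))"
      by (rule compact_uniformly_continuous) simp
    then obtain d where d: "d > 0"
      "\<And>x y. x \<in> {0..1} \<Longrightarrow> y \<in> {0..1} \<Longrightarrow> dist y x < d \<Longrightarrow> dist (ln (DT a y)) (ln (DT a x)) < e"
      unfolding uniformly_continuous_on_def using \<open>e > 0\<close> by meson
    have "\<bar>ln (DT a x) - ln (DT a y)\<bar> \<le> e" if "x \<in> {0..1}" "y \<in> {0..1}" "\<bar>x - y\<bar> < d" for x y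
      using d(2)[OF that(2,1)] that(3) by (simp add: dist_real_def)
    then show ?thesis using d(1) by blast
  qed
  then obtain d where d: "\<And>a. a \<in> {1..m} \<Longrightarrow> d a > 0"
    "\<And>a x y. a \<in> {1..m} \<Longrightarrow> x \<in> {0..1} \<Longrightarrow> y \<in> {0..1} \<Longrightarrow> \<bar>x - y\<bar> < d a \<Longrightarrow> \<bar>ln (DT a x) - ln (DT a y)\<bar> \<le> e"
    by metis
  define D where "D = Min (d ` {1..m})"
  have "D > 0" unfolding D_def using d(1) m_pos by (subst Min_gr_iff) auto
  moreover have "D \<le> d a" if "a \<in> {1..m}" for a unfolding D_def using that by (intro Min_le) auto
  ultimately show ?thesis using d(2) by (intro exI[of _ D]) (meson less_le_trans)
qed

lemma log_deriv_bounded: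
  obtains K where "K > 0" "\<And>a x. a \<in> {1..m} \<Longrightarrow> x \<in> {0..1} \<Longrightarrow> \<bar>ln (DT a x)\<bar> \<le> K"
proof -
  have "\<exists>K. \<forall>x\<in>{0..1}. \<bar>ln (DT a x)\<bar> \<le> K" if a: "a \<in> {1..m}" for a
  proof -
    have "continuous_on {0..1} (\<lambda>x. ln (DT a x))"
      using deriv_pos[OF a] by (intro continuous_on_ln deriv_cont a) force
    then have "bounded ((\<lambda>x. ln (DT a x)) ` {0..1})"
      by (intro compact_imp_bounded compact_continuous_image) auto
    then show ?thesis unfolding bounded_iff by auto
  qed
  then obtain K where K: "\<And>a x. a \<in> {1..m} \<Longrightarrow> x \<in> {0..1} \<Longrightarrow> \<bar>ln (DT a x)\<bar> \<le> K a" by metis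
  define L where "L = 1 + (\<Sum>a\<in>{1..m}. \<bar>K a\<bar>)"
  have "\<bar>ln (DT a x)\<bar> \<le> L" if "a \<in> {1..m}" "x \<in> {0..1}" for a x
  proof -
    have "\<bar>K a\<bar> \<le> (\<Sum>a\<in>{1..m}. \<bar>K a\<bar>)" using that(1) by (intro member_le_sum) auto
    then show ?thesis using K[OF that] unfolding L_def by linarith
  qed
  moreover have "L > 0" unfolding L_def by (simp add: add_pos_nonneg sum_nonneg)
  ultimately show ?thesis using that by blast
qed

text \<open>One symbol fixes the branch, and N more confine both codings to an interval shorter than
  the modulus of continuity of the logarithmic derivatives; hence the depth
  \<open>Suc N\<close>.\<close>

lemma cyl_cont_geom_pot: "cyl_cont m (geom_pot T DT)"
  unfolding cyl_cont_def
proof (intro allI impI)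
  fix e :: real assume "e > 0"
  then obtain d where d: "d > 0" "\<And>a x y. a \<in> {1..m} \<Longrightarrow> x \<in> {0..1} \<Longrightarrow> y \<in> {0..1} \<Longrightarrow> \<bar>x - y\<bar> < d \<Longrightarrow> \<bar>ln (DT a x) - ln (DT a y)\<bar> \<le> e"
    using log_deriv_uniform[OF \<open>e > 0\<close>] by metis
  obtain N where N: "\<And>\<omega>. \<omega> \<in> full_shift m \<Longrightarrow> word_len T (pre N \<omega>) < d"
    using word_len_uniform[OF d(1)] by blast
  have "\<bar>geom_pot T DT \<omega> - geom_pot T DT \<omega>'\<bar> \<le> e"
    if *: "\<omega> \<in> full_shift m" "\<omega>' \<in> full_shift m" "pre (Suc N) \<omega> = pre (Suc N) \<omega>'" for \<omega> \<omega>'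
  proof -
    have eq: "\<omega> 0 = \<omega>' 0" "pre N (shift \<omega>) = pre N (shift \<omega>')" using *(3) by (auto simp: pre_Suc_shift)
    have s: "shift \<omega> \<in> full_shift m" "shift \<omega>' \<in> full_shift m" using * full_shift_shift by auto
    have "\<bar>coding T (shift \<omega>) - coding T (shift \<omega>')\<bar> < d"
      using coding_bounds[OF s(1), of N] coding_bounds[OF s(2), of N] N[OF s(1)] eq(2)
      unfolding word_len_def by auto
    then show ?thesis using d(2)[OF full_shiftD[OF *(1), of 0] coding_range[OF s(1)] coding_range[OF s(2)]]
      by (simp add: geom_pot_def eq(1) abs_minus_commute)
  qed
  then show "\<exists>q. \<forall>\<omega>\<in>full_shift m. \<forall>\<omega>'\<in>full_shift m. pre q \<omega> = pre q \<omega>' \<longrightarrow> \<bar>geom_pot T DT \<omega> - geom_pot T DT \<omega>'\<bar> \<le> e"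
    by blast
qed

text \<open>Bounded distortion up to a subexponential factor; this is all that survives of the
  classical distortion estimates for merely \<open>C\<^sup>1\<close>, possibly parabolic maps.\<close>

lemma log_word_len_bsum:
  assumes "e > 0"
  shows "\<exists>N. \<forall>n\<ge>N. \<forall>\<omega>\<in>full_shift m. \<bar>- ln (word_len T (pre n \<omega>)) - bsum (geom_pot T DT) n \<omega>\<bar> \<le> real n * e"
proof -
  obtain K where K: "K > 0" "\<And>a x. a \<in> {1..m} \<Longrightarrow> x \<in> {0..1} \<Longrightarrow> \<bar>ln (DT a x)\<bar> \<le> K"
    using log_deriv_bounded by blast
  define r where "r = (\<lambda>n \<omega>. - ln (word_len T (pre n \<omega>)) - bsum (geom_pot T DT) n \<omega>)"
  \<comment> \<open>By the mean value theorem the ratio of consecutive lengths is a derivative at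
    some point of the cylinder interval of \<open>shift \<omega>\<close>. That interval also
    contains \<open>coding T (shift \<omega>)\<close>, where g evaluates the same
    derivative.\<close>
  have step: "\<exists>x\<in>{0..1}. \<bar>x - coding T (shift \<omega>)\<bar> \<le> word_len T (pre n (shift \<omega>)) \<and>
      r (Suc n) \<omega> - r n (shift \<omega>) = ln (DT (\<omega> 0) (coding T (shift \<omega>))) - ln (DT (\<omega> 0) x)"
    if \<omega>: "\<omega> \<in> full_shift m" for n \<omega>
  proof -
    have s: "shift \<omega> \<in> full_shift m" using \<omega> full_shift_shift by blast
    let ?w = "pre n (shift \<omega>)"
    have w: "set ?w \<subseteq> {1..m}" by (rule set_pre[OF s])
    have r01: "word_map T ?w 0 \<in> {0..1}" "word_map T ?w 1 \<in> {0..1}" using word_map_range[OF w] by auto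
    obtain z where z: "word_map T ?w 0 < z" "z < word_map T ?w 1"
      "T (\<omega> 0) (word_map T ?w 1) - T (\<omega> 0) (word_map T ?w 0) = DT (\<omega> 0) z * (word_map T ?w 1 - word_map T ?w 0)"
      using T_mvt[OF full_shiftD[OF \<omega>], of "word_map T ?w 0" "word_map T ?w 1"] word_len_pos[OF w] r01
      by (auto simp: word_len_def)
    have z01: "z \<in> {0..1}" using z r01 by auto
    have "word_len T (pre (Suc n) \<omega>) = DT (\<omega> 0) z * word_len T ?w"
      using z(3) by (simp add: word_len_def pre_Suc_shift)
    then have "ln (word_len T (pre (Suc n) \<omega>)) = ln (DT (\<omega> 0) z) + ln (word_len T ?w)"
      using deriv_pos[OF full_shiftD[OF \<omega>, of 0] z01] word_len_pos[OF w] by (simp add: ln_mult)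
    then have "r (Suc n) \<omega> - r n (shift \<omega>) = ln (DT (\<omega> 0) (coding T (shift \<omega>))) - ln (DT (\<omega> 0) z)"
      by (simp add: r_def bsum_Suc geom_pot_def)
    moreover have "\<bar>z - coding T (shift \<omega>)\<bar> \<le> word_len T ?w"
      using z coding_bounds[OF s, of n] by (auto simp: word_len_def)
    ultimately show ?thesis using z01 by blast
  qed
  have "\<exists>N. \<forall>n \<omega>. n \<ge> N \<longrightarrow> \<omega> \<in> full_shift m \<longrightarrow> \<bar>r n \<omega>\<bar> \<le> real n * e"
  proof (rule cesaro_uniform[where K = "2 * K"])
    show "r 0 \<omega> = 0" for \<omega> by (simp add: r_def word_len_def)
    show "2 * K \<ge> 0" using K by simp
    fix c :: real assume "c > 0"
    then obtain d where d: "d > 0" "\<And>a x y. a \<in> {1..m} \<Longrightarrow> x \<in> {0..1} \<Longrightarrow> y \<in> {0..1} \<Longrightarrow> \<bar>x - y\<bar> < d \<Longrightarrow> \<bar>ln (DT a x) - ln (DT a y)\<bar> \<le> c"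
      using log_deriv_uniform[OF \<open>c > 0\<close>] by metis
    obtain N where N: "\<And>n \<omega>. n \<ge> N \<Longrightarrow> \<omega> \<in> full_shift m \<Longrightarrow> word_len T (pre n \<omega>) < d"
      using word_len_uniform[OF d(1)] by blast
    show "\<exists>N. \<forall>n \<omega>. \<omega> \<in> full_shift m \<longrightarrow> (\<exists>\<omega>'. \<omega>' \<in> full_shift m \<and> \<bar>r (Suc n) \<omega> - r n \<omega>'\<bar> \<le> 2 * K \<and>
        (N \<le> n \<longrightarrow> \<bar>r (Suc n) \<omega> - r n \<omega>'\<bar> \<le> c))"
    proof (intro exI[of _ N] allI impI)
      fix n \<omega> assume \<omega>: "\<omega> \<in> full_shift m"
      have s: "shift \<omega> \<in> full_shift m" using \<omega> full_shift_shift by blast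
      obtain x where x: "x \<in> {0..1}" "\<bar>x - coding T (shift \<omega>)\<bar> \<le> word_len T (pre n (shift \<omega>))"
         "r (Suc n) \<omega> - r n (shift \<omega>) = ln (DT (\<omega> 0) (coding T (shift \<omega>))) - ln (DT (\<omega> 0) x)"
        using step[OF \<omega>] by blast
      note a = full_shiftD[OF \<omega>, of 0]
      have "\<bar>r (Suc n) \<omega> - r n (shift \<omega>)\<bar> \<le> 2 * K"
        using K(2)[OF a x(1)] K(2)[OF a coding_range[OF s]] unfolding x(3) by linarith
      moreover have "\<bar>r (Suc n) \<omega> - r n (shift \<omega>)\<bar> \<le> c" if "N \<le> n"
        using d(2)[OF a coding_range[OF s] x(1)] x(2) N[OF that s] unfolding x(3) by linarith
      ultimately show "\<exists>\<omega>'. \<omega>' \<in> full_shift m \<and> \<bar>r (Suc n) \<omega> - r n \<omega>'\<bar> \<le> 2 * K \<and>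
        (N \<le> n \<longrightarrow> \<bar>r (Suc n) \<omega> - r n \<omega>'\<bar> \<le> c)" using s by blast
    qed
  qed (rule \<open>e > 0\<close>)
  then show ?thesis unfolding r_def by blast
qed

text \<open>Five test points at spacing r/2, from a - r/2 to a + 3r/2, suffice: an interval of
  length at least r that meets [a, a + r] has one of them in its interior. Intervals of one
  generation have disjoint interiors, so no two share a test point. The outer two points serve
  intervals that only touch a or a + r.\<close>

lemma card_words_meeting:
  assumes W: "W \<subseteq> words m n" and r: "r > 0" and len: "\<And>w. w \<in> W \<Longrightarrow> word_len T w \<ge> r"
    and meet: "\<And>w. w \<in> W \<Longrightarrow> \<exists>t. a \<le> t \<and> t \<le> a + r \<and> word_map T w 0 \<le> t \<and> t \<le> word_map T w 1"
  shows "card W \<le> 5"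
proof -
  define c where "c = (\<lambda>k::nat. a + (real k - 1) * r / 2)"
  have ck: "c 0 = a - r/2" "c (Suc 0) = a" "c 2 = a + r/2" "c 3 = a + r" "c 4 = a + 3 * r / 2"
    by (auto simp: c_def)
  have "\<exists>k<5. word_map T w 0 < c k \<and> c k < word_map T w 1" if w: "w \<in> W" for w
  proof -
    obtain t where t: "a \<le> t" "t \<le> a + r" "word_map T w 0 \<le> t" "t \<le> word_map T w 1" using meet[OF w] by blast
    have l: "word_map T w 1 - word_map T w 0 \<ge> r" using len[OF w] by (simp add: word_len_def)
    consider "word_map T w 0 < a" "word_map T w 1 = a" | "word_map T w 0 < a" "a < word_map T w 1"
      | "word_map T w 0 \<ge> a" "word_map T w 1 \<le> a + r"
      | "word_map T w 0 = a + r" | "word_map T w 0 < a + r" "a + r < word_map T w 1"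
      using t by linarith
    then show ?thesis
    proof cases
      case 1 then show ?thesis using l r ck by (intro exI[of _ 0]) auto
    next
      case 2 then show ?thesis using l r ck by (intro exI[of _ 1]) auto
    next
      case 3 then show ?thesis using l r ck by (intro exI[of _ 2]) auto
    next
      case 4 then show ?thesis using l r ck by (intro exI[of _ 4]) auto
    next
      case 5 then show ?thesis using l r ck by (intro exI[of _ 3]) auto
    qed
  qed
  then obtain k where k: "\<And>w. w \<in> W \<Longrightarrow> k w < 5 \<and> word_map T w 0 < c (k w) \<and> c (k w) < word_map T w 1"
    by metis
  have "inj_on k W"
  proof (rule inj_onI)
    fix v w assume "v \<in> W" "w \<in> W" "k v = k w"
    then show "v = w" using word_intervals_disjoint[of v n w "c (k v)"] k[of v] k[of w] W by auto
  qed
  moreover have "k ` W \<subseteq> {..<5::nat}" using k by auto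
  ultimately have "card W \<le> card {..<5::nat}" by (intro card_inj_on_le[of k]) auto
  then show ?thesis by simp
qed

end

subsection \<open>Measures on the shift from consistent weights on words\<close>

text \<open>Half-open intervals laid end to end hit every point exactly once; a letter of weight 0
  receives an empty interval and is never selected.\<close>

lemma subinterval_unique:
  fixes p :: "nat \<Rightarrow> real"
  assumes p: "\<And>j. j \<in> {1..m} \<Longrightarrow> p j \<ge> 0"
  shows "x \<le> u \<Longrightarrow> u < x + (\<Sum>j\<in>{1..m}. p j) \<Longrightarrow>
    \<exists>!a. a \<in> {1..m} \<and> x + (\<Sum>j\<in>{1..<a}. p j) \<le> u \<and> u < x + (\<Sum>j\<in>{1..<a}. p j) + p a"
proof (rule ex_ex1I)
  assume u: "x \<le> u" "u < x + (\<Sum>j\<in>{1..m}. p j)"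
  define a where "a = (LEAST a. u < x + (\<Sum>j\<in>{1..a}. p j))"
  have a: "u < x + (\<Sum>j\<in>{1..a}. p j)" unfolding a_def by (rule LeastI[of _ m]) (use u in auto)
  have am: "a \<le> m" unfolding a_def by (rule Least_le) (use u in auto)
  have "a \<noteq> 0" using a u by (cases a) auto
  then obtain b where b: "a = Suc b" by (cases a) auto
  have "\<not> u < x + (\<Sum>j\<in>{1..b}. p j)" using not_less_Least[of b "\<lambda>a. u < x + (\<Sum>j\<in>{1..a}. p j)"] b unfolding a_def[symmetric] by simp
  moreover have "{1..b} = {1..<a}" using b by auto
  moreover have "(\<Sum>j\<in>{1..a}. p j) = (\<Sum>j\<in>{1..<a}. p j) + p a"
    using b by (simp add: atLeastLessThanSuc_atLeastAtMost)
  ultimately show "\<exists>a. a \<in> {1..m} \<and> x + (\<Sum>j\<in>{1..<a}. p j) \<le> u \<and> u < x + (\<Sum>j\<in>{1..<a}. p j) + p a"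
    using a am b by (intro exI[of _ a]) auto
next
  have less: "\<not> a < b" if a: "a \<in> {1..m} \<and> x + (\<Sum>j\<in>{1..<a}. p j) \<le> u \<and> u < x + (\<Sum>j\<in>{1..<a}. p j) + p a"
    and b: "b \<in> {1..m} \<and> x + (\<Sum>j\<in>{1..<b}. p j) \<le> u \<and> u < x + (\<Sum>j\<in>{1..<b}. p j) + p b" for a b
  proof
    assume "a < b"
    have "(\<Sum>j\<in>{1..<a}. p j) + p a = (\<Sum>j\<in>{1..<Suc a}. p j)" using a by simp
    also have "\<dots> \<le> (\<Sum>j\<in>{1..<b}. p j)" using \<open>a < b\<close> b p by (intro sum_mono2) auto
    finally show False using a b by linarith
  qed
  fix a b
  assume "a \<in> {1..m} \<and> x + (\<Sum>j\<in>{1..<a}. p j) \<le> u \<and> u < x + (\<Sum>j\<in>{1..<a}. p j) + p a"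
    "b \<in> {1..m} \<and> x + (\<Sum>j\<in>{1..<b}. p j) \<le> u \<and> u < x + (\<Sum>j\<in>{1..<b}. p j) + p b"
  then show "a = b" using less[of a b] less[of b a] by linarith
qed

text \<open>The words of length \<open>n\<close> in lexicographic order cut \<open>[0, 1)\<close> into intervals whose lengths are
  the prescribed weights; reading off the word sequence of a uniformly distributed point
  gives the measure.\<close>

locale word_weights =
  fixes m :: nat and M :: "nat list \<Rightarrow> real"
  assumes M_nonneg: "\<And>w. M w \<ge> 0" and M_Nil: "M [] = 1"
    and M_snoc: "\<And>n w. w \<in> words m n \<Longrightarrow> M w = (\<Sum>a\<in>{1..m}. M (w @ [a]))"
begin

text \<open>The weights of all smaller siblings along the prefixes of w. By consistency this is the
  total weight of the words of the same length that precede w lexicographically.\<close>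

definition left :: "nat list \<Rightarrow> real" where
  "left w = (\<Sum>i<length w. \<Sum>j\<in>{1..<w ! i}. M (take i w @ [j]))"

definition cell :: "nat list \<Rightarrow> real set" where
  "cell w = {left w..<left w + M w}"

definition next_letter :: "real \<Rightarrow> nat list \<Rightarrow> nat" where
  "next_letter u w = (THE a. a \<in> {1..m} \<and> u \<in> cell (w @ [a]))"

primrec word_at :: "real \<Rightarrow> nat \<Rightarrow> nat list" where
  "word_at u 0 = []"
| "word_at u (Suc n) = word_at u n @ [next_letter u (word_at u n)]"

definition seq_at :: "real \<Rightarrow> nat \<Rightarrow> nat" where
  "seq_at u n = next_letter u (word_at u n)"

lemma pre_seq_at: "pre n (seq_at u) = word_at u n"
  by (induction n) (auto simp: pre_Suc seq_at_def)

lemma left_snoc: "left (w @ [a]) = left w + (\<Sum>j\<in>{1..<a}. M (w @ [j]))"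
  by (simp add: left_def nth_append cong: sum.cong_simp)

lemma cell_Nil: "cell [] = {0..<1}"
  by (simp add: cell_def left_def M_Nil)

lemma next_letter_unique:
  assumes "w \<in> words m n" "u \<in> cell w" shows "\<exists>!a. a \<in> {1..m} \<and> u \<in> cell (w @ [a])"
  using subinterval_unique[of m "\<lambda>j. M (w @ [j])" "left w" u] assms M_nonneg M_snoc[OF assms(1)]
  by (simp add: cell_def left_snoc add.assoc)

lemma next_letter:
  assumes "w \<in> words m n" "u \<in> cell w"
  shows "next_letter u w \<in> {1..m}" "u \<in> cell (w @ [next_letter u w])"
  using theI'[OF next_letter_unique[OF assms]] by (auto simp: next_letter_def)

lemma cell_snoc_subset:
  assumes w: "w \<in> words m n" and a: "a \<in> {1..m}" shows "cell (w @ [a]) \<subseteq> cell w"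
proof -
  have "(\<Sum>j\<in>{1..<a}. M (w @ [j])) + M (w @ [a]) = (\<Sum>j\<in>{1..<Suc a}. M (w @ [j]))" using a by simp
  also have "\<dots> \<le> (\<Sum>j\<in>{1..m}. M (w @ [j]))" using a M_nonneg by (intro sum_mono2) auto
  finally have "(\<Sum>j\<in>{1..<a}. M (w @ [j])) + M (w @ [a]) \<le> M w" using M_snoc[OF w] by simp
  moreover have "(\<Sum>j\<in>{1..<a}. M (w @ [j])) \<ge> 0" using M_nonneg by (intro sum_nonneg)
  ultimately show ?thesis by (auto simp: cell_def left_snoc)
qed

lemma words_snocE:
  assumes "w \<in> words m (Suc n)" obtains v a where "w = v @ [a]" "v \<in> words m n" "a \<in> {1..m}"
  using assms unfolding words_Suc by auto

lemma cell_subset: "w \<in> words m n \<Longrightarrow> cell w \<subseteq> {0..<1}"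
proof (induction n arbitrary: w)
  case (Suc n)
  obtain v a where v: "w = v @ [a]" "v \<in> words m n" "a \<in> {1..m}" using Suc.prems by (rule words_snocE)
  then show ?case using cell_snoc_subset[OF v(2,3)] Suc.IH[OF v(2)] by auto
qed (simp add: cell_Nil)

lemma word_at: "u \<in> {0..<1} \<Longrightarrow> word_at u n \<in> words m n \<and> u \<in> cell (word_at u n)"
proof (induction n)
  case (Suc n)
  then have IH: "word_at u n \<in> words m n" "u \<in> cell (word_at u n)" by auto
  then show ?case using next_letter[OF IH] unfolding words_Suc by force
qed (simp add: cell_Nil)

lemma word_at_unique: "w \<in> words m n \<Longrightarrow> u \<in> cell w \<Longrightarrow> word_at u n = w"
proof (induction n arbitrary: w)
  case (Suc n)
  obtain v a where v: "w = v @ [a]" "v \<in> words m n" "a \<in> {1..m}" using Suc.prems(1) by (rule words_snocE)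
  have u: "u \<in> cell v" using cell_snoc_subset[OF v(2,3)] Suc.prems(2) v(1) by auto
  have "next_letter u v = a"
    unfolding next_letter_def by (rule the1_equality[OF next_letter_unique[OF v(2) u]]) (use v Suc.prems in auto)
  then show ?case using Suc.IH[OF v(2) u] v(1) by simp
qed simp

text \<open>Cells of one generation are disjoint and nested in those before, so the prefix read off
  from u is w exactly when u lies in the cell of w, an interval of length
  \<open>M w\<close>.\<close>

lemma seq_at_cylinder:
  assumes "w \<in> words m n" shows "{u \<in> {0..<1}. pre n (seq_at u) = w} = cell w"
  using word_at_unique[OF assms] word_at[of _ n] cell_subset[OF assms] by (auto simp: pre_seq_at)

lemma seq_at_full_shift: assumes "u \<in> {0..<1}" shows "seq_at u \<in> full_shift m"
  unfolding full_shift_def mem_Collect_eq seq_at_def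
  using next_letter(1) word_at[OF assms] by blast

definition weights_measure :: "(nat \<Rightarrow> nat) measure" where
  "weights_measure = distr (restrict_space lborel {0..<1}) (shift_space m) seq_at"

lemma measurable_seq_at: "seq_at \<in> measurable (restrict_space lborel {0..<1}) (shift_space m)"
proof (rule measurable_sigma_sets[OF sets_shift_space_cylinders])
  show "cylinders m \<subseteq> Pow (full_shift m)" by (auto simp: cylinders_def)
  show "seq_at \<in> space (restrict_space lborel {0..<1}) \<rightarrow> full_shift m"
    using seq_at_full_shift by (simp add: space_restrict_space)
  fix A assume "A \<in> cylinders m"
  then consider "A = {}" | n w where "w \<in> words m n" "A = {\<omega> \<in> full_shift m. pre n \<omega> = w}"
    unfolding cylinders_def by blast
  then show "seq_at -` A \<inter> space (restrict_space lborel {0..<1}) \<in> sets (restrict_space lborel {0..<1})"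
  proof cases
    case 2
    have "seq_at -` A \<inter> space (restrict_space lborel {0..<1}) = {u \<in> {0..<1}. pre n (seq_at u) = w}"
      using 2 seq_at_full_shift by (auto simp: space_restrict_space)
    also have "\<dots> = cell w" by (rule seq_at_cylinder[OF 2(1)])
    finally show ?thesis using cell_subset[OF 2(1)] by (simp add: sets_restrict_space_iff) (simp add: cell_def)
  qed simp
qed

lemma prob_space_weights_measure: "prob_space weights_measure"
proof -
  have "prob_space (restrict_space lborel {0..<1::real})"
    by (rule prob_spaceI) (simp add: space_restrict_space emeasure_restrict_space)
  then show ?thesis unfolding weights_measure_def by (rule prob_space.prob_space_distr[OF _ measurable_seq_at])
qed

lemma weights_measure_cylinder:
  assumes w: "w \<in> words m n"
  shows "measure weights_measure {\<omega> \<in> full_shift m. pre n \<omega> = w} = M w"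
proof -
  have A: "{\<omega> \<in> full_shift m. pre n \<omega> = w} \<in> sets (shift_space m)" using cylinder_sets[of m n "{w}"] by simp
  have "seq_at -` {\<omega> \<in> full_shift m. pre n \<omega> = w} \<inter> space (restrict_space lborel {0..<1})
      = {u \<in> {0..<1}. pre n (seq_at u) = w}"
    using seq_at_full_shift by (auto simp: space_restrict_space)
  also have "\<dots> = cell w" by (rule seq_at_cylinder[OF w])
  finally have "measure weights_measure {\<omega> \<in> full_shift m. pre n \<omega> = w} = measure (restrict_space lborel {0..<1}) (cell w)"
    unfolding weights_measure_def by (simp add: measure_distr[OF measurable_seq_at A])
  also have "\<dots> = measure lborel (cell w)"
    using cell_subset[OF w] by (intro measure_restrict_space) auto
  also have "\<dots> = M w" using M_nonneg[of w] by (simp add: cell_def)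
  finally show ?thesis .
qed

end

subsection \<open>Limits of empirical measures and their entropy\<close>

text \<open>The right-hand side is the tangent at a to the concave function -t ln t. Summation with
  a equal to the mean yields Jensen's inequality.\<close>

lemma ent_fun_tangent:
  assumes "a > 0" "t \<ge> 0" shows "ent_fun t \<le> a - t - t * ln a"
proof (cases "t > 0")
  case True
  have "t * ln (a / t) \<le> t * (a / t - 1)" using True assms by (intro mult_left_mono ln_le_minus_one) auto
  then show ?thesis using True assms by (simp add: ent_fun_pos ln_div algebra_simps)
qed (use assms in \<open>simp add: ent_fun_def\<close>)

lemma ent_fun_jensen:
  assumes t: "\<And>i. i < n \<Longrightarrow> t i \<ge> 0" and n: "n > 0"
  shows "(\<Sum>i<n. ent_fun (t i)) \<le> real n * ent_fun ((\<Sum>i<n. t i) / real n)"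
proof (cases "(\<Sum>i<n. t i) > 0")
  case True
  define a where "a = (\<Sum>i<n. t i) / real n"
  have a: "a > 0" "(\<Sum>i<n. t i) = real n * a" using True n by (auto simp: a_def)
  have "(\<Sum>i<n. ent_fun (t i)) \<le> (\<Sum>i<n. a - t i - t i * ln a)"
    using a t by (intro sum_mono ent_fun_tangent) auto
  also have "\<dots> = real n * a - (\<Sum>i<n. t i) - (\<Sum>i<n. t i) * ln a"
    by (simp add: sum_subtractf sum_distrib_right)
  also have "\<dots> = real n * ent_fun a" using a by (simp add: ent_fun_pos)
  finally show ?thesis by (simp add: a_def)
next
  case False
  then have "t i = 0" if "i < n" for i
    using sum_nonneg_eq_0_iff[of "{..<n}" t] t that sum_nonneg[of "{..<n}" t] by force
  then show ?thesis by simp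
qed

text \<open>Only x = 0 needs an argument, where the function is squeezed between 0 and 2
  sqrt(t).\<close>

lemma ent_fun_tendsto:
  assumes "(X \<longlongrightarrow> x) F" "\<And>j. X j \<ge> 0" "F \<noteq> bot"
  shows "((\<lambda>j. ent_fun (X j)) \<longlongrightarrow> ent_fun x) F"
proof -
  have x: "x \<ge> 0" using assms by (intro tendsto_lowerbound[OF assms(1)]) auto
  show ?thesis
  proof (cases "x > 0")
    case True
    then have "eventually (\<lambda>j. X j > 0) F" using assms(1) by (rule order_tendstoD(1)[rotated])
    then have "eventually (\<lambda>j. - X j * ln (X j) = ent_fun (X j)) F"
      by eventually_elim (simp add: ent_fun_pos)
    moreover have "((\<lambda>j. - X j * ln (X j)) \<longlongrightarrow> - x * ln x) F"
      using True by (intro tendsto_intros assms(1)) auto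
    ultimately show ?thesis using True by (simp add: ent_fun_pos tendsto_cong)
  next
    case False
    then have x0: "x = 0" using x by simp
    have "((\<lambda>j. 2 * sqrt (X j)) \<longlongrightarrow> 2 * sqrt 0) F"
      using assms(1) unfolding x0 by (intro tendsto_intros)
    then have up: "((\<lambda>j. 2 * sqrt (X j)) \<longlongrightarrow> 0) F" by simp
    have "eventually (\<lambda>j. X j < 1) F" using assms(1) x0 by (intro order_tendstoD(2)[OF assms(1)]) auto
    then have "eventually (\<lambda>j. 0 \<le> ent_fun (X j)) F" by eventually_elim (simp add: ent_fun_nonneg)
    moreover have "eventually (\<lambda>j. ent_fun (X j) \<le> 2 * sqrt (X j)) F"
      using assms(2) ent_fun_le_sqrt by (intro always_eventually) blast
    ultimately show ?thesis unfolding x0 ent_fun_0 by (intro tendsto_sandwich[OF _ _ tendsto_const up])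
  qed
qed

lemma sum_swap_weighted:
  fixes f :: "'a \<Rightarrow> 'b \<Rightarrow> 'c \<Rightarrow> real"
  shows "(\<Sum>v\<in>V. \<Sum>\<omega>\<in>W. p \<omega> * (\<Sum>i\<in>I. f \<omega> i v)) = (\<Sum>\<omega>\<in>W. p \<omega> * (\<Sum>i\<in>I. \<Sum>v\<in>V. f \<omega> i v))"
proof -
  have "(\<Sum>v\<in>V. \<Sum>\<omega>\<in>W. p \<omega> * (\<Sum>i\<in>I. f \<omega> i v)) = (\<Sum>\<omega>\<in>W. p \<omega> * (\<Sum>v\<in>V. \<Sum>i\<in>I. f \<omega> i v))"
    by (subst sum.swap) (simp add: sum_distrib_left)
  also have "\<dots> = (\<Sum>\<omega>\<in>W. p \<omega> * (\<Sum>i\<in>I. \<Sum>v\<in>V. f \<omega> i v))"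
    by (intro sum.cong refl arg_cong2[where f = "(*)"] sum.swap)
  finally show ?thesis .
qed

text \<open>The measure behind this locale distributes the weight p \<omega> evenly over the first n
  orbit points of \<omega>. It is never formed as a measure: \<open>freq\<close> gives its values on
  cylinders and \<open>avg\<close> its integrals.\<close>

locale weighted_orbits =
  fixes m :: nat and W :: "(nat \<Rightarrow> nat) set" and p :: "(nat \<Rightarrow> nat) \<Rightarrow> real" and n :: nat
  assumes m_ge_1: "m \<ge> 1" and W: "finite W" "W \<subseteq> full_shift m"
    and p: "\<And>\<omega>. \<omega> \<in> W \<Longrightarrow> p \<omega> \<ge> 0" "(\<Sum>\<omega>\<in>W. p \<omega>) = 1"
    and n: "n > 0"
begin

definition freq :: "nat list \<Rightarrow> real" where
  "freq v = (\<Sum>\<omega>\<in>W. p \<omega> * (\<Sum>i<n. of_bool (pre (length v) ((shift ^^ i) \<omega>) = v))) / real n"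

definition avg :: "((nat \<Rightarrow> nat) \<Rightarrow> real) \<Rightarrow> real" where
  "avg F = (\<Sum>\<omega>\<in>W. p \<omega> * birkhoff_avg F n \<omega>)"

lemma freq_nonneg: "freq v \<ge> 0"
  unfolding freq_def using p by (intro divide_nonneg_nonneg sum_nonneg mult_nonneg_nonneg) auto

lemma freq_Nil: "freq [] = 1"
  using p n by (simp add: freq_def sum_distrib_right[symmetric])

lemma sum_of_bool_snoc:
  assumes "\<omega> \<in> full_shift m"
  shows "(\<Sum>a\<in>{1..m}. of_bool (pre (Suc k) \<omega> = v @ [a])) = (of_bool (pre k \<omega> = v) :: real)"
proof -
  have "(\<Sum>a\<in>{1..m}. of_bool (pre (Suc k) \<omega> = v @ [a])) = (\<Sum>a\<in>{1..m}. if a = \<omega> k then of_bool (pre k \<omega> = v) else (0::real))"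
    by (intro sum.cong) (auto simp: pre_Suc)
  also have "\<dots> = of_bool (pre k \<omega> = v)" using full_shiftD[OF assms, of k] by (subst sum.delta) auto
  finally show ?thesis .
qed

lemma sum_of_bool_Cons:
  assumes "\<omega> \<in> full_shift m"
  shows "(\<Sum>a\<in>{1..m}. of_bool (pre (Suc k) \<omega> = a # v)) = (of_bool (pre k (shift \<omega>) = v) :: real)"
proof -
  have "(\<Sum>a\<in>{1..m}. of_bool (pre (Suc k) \<omega> = a # v)) = (\<Sum>a\<in>{1..m}. if a = \<omega> 0 then of_bool (pre k (shift \<omega>) = v) else (0::real))"
    by (intro sum.cong) (auto simp: pre_Suc_shift)
  also have "\<dots> = of_bool (pre k (shift \<omega>) = v)" using full_shiftD[OF assms, of 0] by (subst sum.delta) auto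
  finally show ?thesis .
qed

lemma freq_snoc: "freq v = (\<Sum>a\<in>{1..m}. freq (v @ [a]))"
proof -
  have "(\<Sum>a\<in>{1..m}. freq (v @ [a]))
     = (\<Sum>\<omega>\<in>W. p \<omega> * (\<Sum>i<n. \<Sum>a\<in>{1..m}. of_bool (pre (Suc (length v)) ((shift ^^ i) \<omega>) = v @ [a]))) / real n"
    unfolding freq_def sum_divide_distrib[symmetric]
    by (simp only: sum_swap_weighted length_append_singleton length_Cons)
  also have "\<dots> = freq v"
    unfolding freq_def using W full_shift_funpow
    by (intro arg_cong2[where f = "(/)"] sum.cong arg_cong2[where f = "(*)"] refl sum_of_bool_snoc) auto
  finally show ?thesis by simp
qed

text \<open>Summing over the letter put in front of v moves the orbit index by one, so the
  difference telescopes to the first and last terms. This defect of invariance disappears as n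
  grows.\<close>

lemma freq_Cons: "\<bar>freq v - (\<Sum>a\<in>{1..m}. freq (a # v))\<bar> \<le> 1 / real n"
proof -
  let ?c = "\<lambda>\<omega> i. of_bool (pre (length v) ((shift ^^ i) \<omega>) = v) :: real"
  have "(\<Sum>a\<in>{1..m}. freq (a # v))
     = (\<Sum>\<omega>\<in>W. p \<omega> * (\<Sum>i<n. \<Sum>a\<in>{1..m}. of_bool (pre (Suc (length v)) ((shift ^^ i) \<omega>) = a # v))) / real n"
    unfolding freq_def sum_divide_distrib[symmetric]
    by (simp only: sum_swap_weighted length_append_singleton length_Cons)
  also have "\<dots> = (\<Sum>\<omega>\<in>W. p \<omega> * (\<Sum>i<n. ?c \<omega> (Suc i))) / real n"
  proof (intro arg_cong2[where f = "(/)"] sum.cong arg_cong2[where f = "(*)"] refl)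
    fix \<omega> i assume "\<omega> \<in> W"
    then show "(\<Sum>a\<in>{1..m}. of_bool (pre (Suc (length v)) ((shift ^^ i) \<omega>) = a # v)) = ?c \<omega> (Suc i)"
      using sum_of_bool_Cons[OF full_shift_funpow[of \<omega> m i], of "length v" v] W by auto
  qed
  finally have "freq v - (\<Sum>a\<in>{1..m}. freq (a # v)) = (\<Sum>\<omega>\<in>W. p \<omega> * (\<Sum>i<n. ?c \<omega> i - ?c \<omega> (Suc i))) / real n"
    by (simp add: freq_def sum_subtractf right_diff_distrib diff_divide_distrib)
  also have "\<dots> = (\<Sum>\<omega>\<in>W. p \<omega> * (?c \<omega> 0 - ?c \<omega> n)) / real n"
    by (intro arg_cong2[where f = "(/)"] sum.cong arg_cong2[where f = "(*)"] refl sum_lessThan_telescope')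
  finally have "\<bar>freq v - (\<Sum>a\<in>{1..m}. freq (a # v))\<bar> = \<bar>\<Sum>\<omega>\<in>W. p \<omega> * (?c \<omega> 0 - ?c \<omega> n)\<bar> / real n" by simp
  also have "\<dots> \<le> (\<Sum>\<omega>\<in>W. \<bar>p \<omega> * (?c \<omega> 0 - ?c \<omega> n)\<bar>) / real n"
    by (intro divide_right_mono sum_abs) auto
  also have "\<dots> \<le> (\<Sum>\<omega>\<in>W. p \<omega>) / real n"
  proof (intro divide_right_mono sum_mono)
    fix \<omega> assume "\<omega> \<in> W"
    have "\<bar>?c \<omega> 0 - ?c \<omega> n\<bar> \<le> 1" by auto
    then show "\<bar>p \<omega> * (?c \<omega> 0 - ?c \<omega> n)\<bar> \<le> p \<omega>"
      using p(1)[OF \<open>\<omega> \<in> W\<close>] by (simp add: abs_mult mult_left_le del: of_bool_eq)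
  qed simp
  finally show ?thesis using p by simp
qed

lemma freq_le_1: "freq v \<le> 1"
proof -
  have "freq v \<le> (\<Sum>\<omega>\<in>W. p \<omega> * real n) / real n"
    unfolding freq_def
  proof (intro divide_right_mono sum_mono mult_left_mono p)
    fix \<omega>
    have "(\<Sum>i<n. of_bool (pre (length v) ((shift ^^ i) \<omega>) = v)) \<le> (\<Sum>i<n. 1::real)" by (intro sum_mono) auto
    then show "(\<Sum>i<n. of_bool (pre (length v) ((shift ^^ i) \<omega>) = v)) \<le> real n" by simp
  qed auto
  also have "\<dots> = 1" using n p by (simp add: sum_distrib_right[symmetric])
  finally show ?thesis .
qed

text \<open>F is replaced by its value at one point of each cylinder of length q.
  \<open>integral_cyl\<close> compares the integral with the same sum for the measure, so
  convergence of \<open>freq\<close> turns into convergence of averages.\<close>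

lemma avg_cyl:
  assumes q: "\<And>\<omega> \<omega>'. \<omega> \<in> full_shift m \<Longrightarrow> \<omega>' \<in> full_shift m \<Longrightarrow> pre q \<omega> = pre q \<omega>' \<Longrightarrow> \<bar>F \<omega> - F \<omega>'\<bar> \<le> e"
  shows "\<bar>avg F - (\<Sum>v\<in>words m q. freq v * F (ext v))\<bar> \<le> e"
proof -
  have one: "(\<Sum>v\<in>words m q. of_bool (pre (length v) \<omega> = v) * F (ext v)) = F (ext (pre q \<omega>))"
    if "\<omega> \<in> full_shift m" for \<omega>
  proof -
    have "(\<Sum>v\<in>words m q. of_bool (pre (length v) \<omega> = v) * F (ext v))
        = (\<Sum>v\<in>words m q. if v = pre q \<omega> then F (ext (pre q \<omega>)) else 0)"
      by (intro sum.cong) (auto simp: words_def)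
    also have "\<dots> = F (ext (pre q \<omega>))" using pre_in_words[OF that] finite_words by (subst sum.delta) auto
    finally show ?thesis .
  qed
  have "(\<Sum>v\<in>words m q. freq v * F (ext v))
     = (\<Sum>\<omega>\<in>W. p \<omega> * (\<Sum>i<n. \<Sum>v\<in>words m q. of_bool (pre (length v) ((shift ^^ i) \<omega>) = v) * F (ext v))) / real n"
  proof -
    have "(\<Sum>v\<in>words m q. freq v * F (ext v))
       = (\<Sum>v\<in>words m q. \<Sum>\<omega>\<in>W. p \<omega> * (\<Sum>i<n. of_bool (pre (length v) ((shift ^^ i) \<omega>) = v) * F (ext v))) / real n"
      unfolding freq_def times_divide_eq_left sum_divide_distrib[symmetric]
      by (simp only: sum_distrib_right sum_distrib_left mult.assoc)
    then show ?thesis by (simp only: sum_swap_weighted)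
  qed
  also have "\<dots> = (\<Sum>\<omega>\<in>W. p \<omega> * (\<Sum>i<n. F (ext (pre q ((shift ^^ i) \<omega>))))) / real n"
    using W full_shift_funpow by (intro arg_cong2[where f = "(/)"] sum.cong arg_cong2[where f = "(*)"] refl one) auto
  finally have sum_eq: "(\<Sum>v\<in>words m q. freq v * F (ext v))
     = (\<Sum>\<omega>\<in>W. p \<omega> * (\<Sum>i<n. F (ext (pre q ((shift ^^ i) \<omega>))))) / real n" .
  have avg_eq: "avg F = (\<Sum>\<omega>\<in>W. p \<omega> * (\<Sum>i<n. F ((shift ^^ i) \<omega>))) / real n"
    by (simp add: avg_def birkhoff_avg_def sum_divide_distrib[symmetric])
  have "avg F - (\<Sum>v\<in>words m q. freq v * F (ext v))
     = (\<Sum>\<omega>\<in>W. p \<omega> * (\<Sum>i<n. F ((shift ^^ i) \<omega>) - F (ext (pre q ((shift ^^ i) \<omega>))))) / real n"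
    unfolding avg_eq sum_eq by (simp add: sum_subtractf right_diff_distrib diff_divide_distrib)
  then have "\<bar>avg F - (\<Sum>v\<in>words m q. freq v * F (ext v))\<bar>
     = \<bar>\<Sum>\<omega>\<in>W. p \<omega> * (\<Sum>i<n. F ((shift ^^ i) \<omega>) - F (ext (pre q ((shift ^^ i) \<omega>))))\<bar> / real n" by simp
  also have "\<dots> \<le> (\<Sum>\<omega>\<in>W. p \<omega> * (real n * e)) / real n"
  proof (intro divide_right_mono order_trans[OF sum_abs] sum_mono)
    fix \<omega> assume w: "\<omega> \<in> W"
    have "\<bar>\<Sum>i<n. F ((shift ^^ i) \<omega>) - F (ext (pre q ((shift ^^ i) \<omega>)))\<bar> \<le> (\<Sum>i<n. e)"
    proof (intro order_trans[OF sum_abs] sum_mono)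
      fix i
      have "(shift ^^ i) \<omega> \<in> full_shift m" using w W full_shift_funpow by blast
      then show "\<bar>F ((shift ^^ i) \<omega>) - F (ext (pre q ((shift ^^ i) \<omega>)))\<bar> \<le> e"
        by (intro q ext_full_shift[OF pre_in_words m_ge_1]) (auto simp: pre_ext)
    qed
    then show "\<bar>p \<omega> * (\<Sum>i<n. F ((shift ^^ i) \<omega>) - F (ext (pre q ((shift ^^ i) \<omega>))))\<bar> \<le> p \<omega> * (real n * e)"
      using p(1)[OF w] by (simp add: abs_mult mult_left_mono)
  qed simp
  also have "\<dots> = e" using p n by (simp add: sum_distrib_right[symmetric])
  finally show ?thesis .
qed

text \<open>Misiurewicz's argument: cover \<open>[0, n)\<close> by windows of length \<open>q\<close> starting at each residue
  class modulo \<open>q\<close> and average; windows that overshoot \<open>n\<close> only increase the entropy.\<close>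

lemma entropy_le_windows:
  assumes inj: "inj_on (pre n) W"
  shows "real q * (\<Sum>\<omega>\<in>W. ent_fun (p \<omega>)) \<le> real n * (\<Sum>v\<in>words m q. ent_fun (freq v)) + (real q)\<^sup>2 * ln (real m)"
proof -
  \<comment> \<open>The entropy inequalities are applied on the finite probability space W, where
    every function is simple.\<close>
  define \<nu> where "\<nu> = point_measure W p"
  have sp: "space \<nu> = W" by (simp add: \<nu>_def space_point_measure)
  have meas: "measure \<nu> A = (\<Sum>\<omega>\<in>A. p \<omega>)" if "A \<subseteq> W" for A
    using that W p unfolding \<nu>_def by (subst measure_point_measure_finite_if) auto
  interpret prob_space \<nu>
  proof (rule prob_spaceI)
    have "emeasure \<nu> W = ennreal (\<Sum>\<omega>\<in>W. p \<omega>)"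
      unfolding \<nu>_def using W p by (subst emeasure_point_measure_finite) auto
    then show "emeasure \<nu> (space \<nu>) = 1" using p(2) by (simp add: sp)
  qed
  have sf: "simple_function \<nu> X" for X :: "(nat \<Rightarrow> nat) \<Rightarrow> 'c"
    unfolding \<nu>_def simple_function_point_measure using W by auto
  \<comment> \<open>\<open>H a\<close> is the entropy of the symbols at positions a to n - 1, and
    \<open>h i\<close> that of the window of length q at i. Truncated subtraction makes
    \<open>H a\<close> vanish for a \<ge> n, which ends the recursion without special treatment of
    the last window.\<close>
  define H where "H a = rv_ent \<nu> (\<lambda>\<omega>. pre (n - a) ((shift ^^ a) \<omega>))" for a
  define h where "h i = rv_ent \<nu> (\<lambda>\<omega>. pre q ((shift ^^ i) \<omega>))" for i
  have rec: "H a \<le> h a + H (a + q)" for a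
    unfolding H_def h_def
  proof (rule rv_ent_le_Pair[OF sf sf sf])
    fix x y :: "nat \<Rightarrow> nat"
    assume 1: "pre q ((shift ^^ a) x) = pre q ((shift ^^ a) y)"
      and 2: "pre (n - (a + q)) ((shift ^^ (a + q)) x) = pre (n - (a + q)) ((shift ^^ (a + q)) y)"
    have "x (k + a) = y (k + a)" if "k < n - a" for k
    proof (cases "k < q")
      case True
      then show ?thesis using 1 by (simp add: pre_eq_iff shift_funpow)
    next
      case False
      then have "k - q < n - (a + q)" using that by auto
      then have "x (k - q + (a + q)) = y (k - q + (a + q))" using 2 by (simp only: pre_eq_iff shift_funpow)
      then show ?thesis using False by (simp add: algebra_simps)
    qed
    then show "pre (n - a) ((shift ^^ a) x) = pre (n - a) ((shift ^^ a) y)"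
      by (simp add: pre_eq_iff shift_funpow)
  qed
  have big: "H a = 0" if "a \<ge> n" for a
    using that prob_space not_empty by (simp add: H_def rv_ent_def image_constant_conv sp ent_fun_pos)
  have start: "H 0 \<le> H a + real a * ln (real m)" for a
  proof -
    have "H 0 \<le> rv_ent \<nu> (pre a) + H a"
      unfolding H_def
    proof (rule rv_ent_le_Pair[OF sf sf sf])
      fix x y :: "nat \<Rightarrow> nat"
      assume 1: "pre a x = pre a y" and 2: "pre (n - a) ((shift ^^ a) x) = pre (n - a) ((shift ^^ a) y)"
      have "x k = y k" if "k < n" for k
      proof (cases "k < a")
        case True
        then show ?thesis using 1 by (simp add: pre_eq_iff)
      next
        case False
        then have "k - a < n - a" using that by auto
        then have "x (k - a + a) = y (k - a + a)" using 2 by (simp only: pre_eq_iff shift_funpow)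
        then show ?thesis using False by simp
      qed
      then show "pre (n - 0) ((shift ^^ 0) x) = pre (n - 0) ((shift ^^ 0) y)" by (simp add: pre_eq_iff)
    qed
    moreover have "rv_ent \<nu> (pre a) \<le> ln (real (card (words m a)))"
      using W by (intro rv_ent_le_ln_card[OF sf] finite_words) (auto simp: sp intro: pre_in_words)
    moreover have "ln (real (card (words m a))) = real a * ln (real m)"
      using m_ge_1 by (simp add: card_words ln_realpow)
    ultimately show ?thesis by linarith
  qed
  \<comment> \<open>Summing the recursion over all a < n treats all residue classes at once: the
    terms \<open>H (a + q)\<close> cancel everything except the first q values.\<close>
  have tele: "(\<Sum>a<q. H a) \<le> (\<Sum>i<n. h i)"
  proof -
    have "(\<Sum>a<n + q. H a) = (\<Sum>a<q. H a) + (\<Sum>a<n. H (a + q))"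
      using sum.nat_group[of H q] by (simp add: lessThan_atLeast0 sum.atLeastLessThan_concat[of 0 q "n + q" H, symmetric] sum.shift_bounds_nat_ivl[of H 0 q n, simplified])
    moreover have "(\<Sum>a<n + q. H a) = (\<Sum>a<n. H a)"
      by (rule sum.mono_neutral_right) (auto simp: big)
    moreover have "(\<Sum>a<n. H a) \<le> (\<Sum>a<n. h a) + (\<Sum>a<n. H (a + q))"
      unfolding sum.distrib[symmetric] by (intro sum_mono rec)
    ultimately show ?thesis by linarith
  qed
  have "H 0 = (\<Sum>\<omega>\<in>W. ent_fun (p \<omega>))"
  proof -
    have "H 0 = (\<Sum>x\<in>pre n ` W. ent_fun (measure \<nu> (pre n -` {x} \<inter> W)))"
      by (simp add: H_def rv_ent_def sp)
    also have "\<dots> = (\<Sum>\<omega>\<in>W. ent_fun (measure \<nu> (pre n -` {pre n \<omega>} \<inter> W)))"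
      by (simp add: sum.reindex[OF inj])
    also have "\<dots> = (\<Sum>\<omega>\<in>W. ent_fun (p \<omega>))"
    proof (intro sum.cong refl arg_cong[where f = ent_fun])
      fix \<omega> assume w: "\<omega> \<in> W"
      have "pre n -` {pre n \<omega>} \<inter> W = {\<omega>}" using inj_onD[OF inj _ _ w] w by auto
      then show "measure \<nu> (pre n -` {pre n \<omega>} \<inter> W) = p \<omega>" using meas[of "{\<omega>}"] w by simp
    qed
    finally show ?thesis .
  qed
  then have "real q * (\<Sum>\<omega>\<in>W. ent_fun (p \<omega>)) = (\<Sum>a<q. H 0)" by simp
  also have "\<dots> \<le> (\<Sum>a<q. H a + real q * ln (real m))"
  proof (rule sum_mono)
    fix a assume "a \<in> {..<q}"
    then have "real a * ln (real m) \<le> real q * ln (real m)" using m_ge_1 by (intro mult_right_mono) auto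
    then show "H 0 \<le> H a + real q * ln (real m)" using start[of a] by linarith
  qed
  also have "\<dots> = (\<Sum>a<q. H a) + (real q)\<^sup>2 * ln (real m)" by (simp add: sum.distrib power2_eq_square)
  also have "(\<Sum>a<q. H a) \<le> (\<Sum>i<n. h i)" by (rule tele)
  also have "(\<Sum>i<n. h i) \<le> real n * (\<Sum>v\<in>words m q. ent_fun (freq v))"
  proof -
    define t where "t v i = (\<Sum>\<omega>\<in>W. p \<omega> * of_bool (pre (length v) ((shift ^^ i) \<omega>) = v))" for v i
    have "h i = (\<Sum>v\<in>words m q. ent_fun (t v i))" for i
    proof -
      have "h i = (\<Sum>v\<in>words m q. ent_fun (measure \<nu> ((\<lambda>\<omega>. pre q ((shift ^^ i) \<omega>)) -` {v} \<inter> space \<nu>)))"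
        unfolding h_def using W full_shift_funpow
        by (intro rv_ent_superset finite_words) (auto simp: sp intro!: pre_in_words)
      also have "\<dots> = (\<Sum>v\<in>words m q. ent_fun (t v i))"
      proof (intro sum.cong refl arg_cong[where f = ent_fun])
        fix v assume v: "v \<in> words m q"
        have "measure \<nu> ((\<lambda>\<omega>. pre q ((shift ^^ i) \<omega>)) -` {v} \<inter> space \<nu>) = (\<Sum>\<omega>\<in>{\<omega> \<in> W. pre q ((shift ^^ i) \<omega>) = v}. p \<omega>)"
          by (subst meas) (auto simp: sp intro!: sum.cong)
        also have "\<dots> = (\<Sum>\<omega>\<in>W. p \<omega> * of_bool (pre q ((shift ^^ i) \<omega>) = v))"
          using W(1) by (intro sum.mono_neutral_cong_left) auto
        finally show "measure \<nu> ((\<lambda>\<omega>. pre q ((shift ^^ i) \<omega>)) -` {v} \<inter> space \<nu>) = t v i"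
          using v by (simp add: t_def words_def)
      qed
      finally show ?thesis .
    qed
    then have "(\<Sum>i<n. h i) = (\<Sum>v\<in>words m q. \<Sum>i<n. ent_fun (t v i))" by (simp add: sum.swap[of _ "{..<n}"])
    \<comment> \<open>\<open>freq v\<close> is the time average of \<open>t v i\<close>, so
      concavity bounds the average entropy of a window by the entropy of the averaged
      distribution.\<close>
    also have "\<dots> \<le> (\<Sum>v\<in>words m q. real n * ent_fun ((\<Sum>i<n. t v i) / real n))"
      using p n by (intro sum_mono ent_fun_jensen) (auto simp: t_def intro!: sum_nonneg)
    also have "\<dots> = (\<Sum>v\<in>words m q. real n * ent_fun (freq v))"
    proof -
      have "(\<Sum>i<n. t v i) = (\<Sum>\<omega>\<in>W. p \<omega> * (\<Sum>i<n. of_bool (pre (length v) ((shift ^^ i) \<omega>) = v)))" for v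
        unfolding t_def sum_distrib_left by (rule sum.swap)
      then show ?thesis unfolding freq_def by (simp only:)
    qed
    finally show ?thesis by (simp add: sum_distrib_left)
  qed
  finally show ?thesis by simp
qed

end

section \<open>Weak limits of empirical measures, by compactness of a countable product of
  intervals\<close>

lemma bounded_functions_convergent_subsequence:
  fixes X :: "nat \<Rightarrow> 'i::countable \<Rightarrow> real"
  assumes "\<And>j i. X j i \<in> {0..1}"
  obtains r l where "strict_mono r" "\<And>i. (\<lambda>j. X (r j) i) \<longlonglongrightarrow> l i"
proof -
  have "seq_compact (PiE UNIV (\<lambda>_::'i. {0..1::real}))"
    by (intro compact_imp_seq_compact compact_PiE_UNIV) auto
  then obtain l r where lr: "strict_mono r" "(X \<circ> r) \<longlonglongrightarrow> l"
    using assms unfolding seq_compact_def by (metis PiE_UNIV_domain UNIV_I Pi_I)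
  have "(\<lambda>j. X (r j) i) \<longlonglongrightarrow> l i" for i
    using continuous_on_tendsto_compose[OF continuous_on_product_coordinates[of i] lr(2)] by (simp add: o_def)
  then show ?thesis using that lr(1) by blast
qed

context shift_invariant
begin

lemma cylinder_sets_mu: "{\<omega> \<in> full_shift m. pre q \<omega> = v} \<in> sets \<mu>"
  using cylinder_sets[of m q "{v}"] by simp

lemma rv_ent_pre: "rv_ent \<mu> (pre q) = (\<Sum>v\<in>words m q. ent_fun (prob {\<omega> \<in> full_shift m. pre q \<omega> = v}))"
proof -
  have eq: "pre q -` {v} \<inter> space \<mu> = {\<omega> \<in> full_shift m. pre q \<omega> = v}" for v by auto
  have "rv_ent \<mu> (pre q) = (\<Sum>v\<in>words m q. ent_fun (prob (pre q -` {v} \<inter> space \<mu>)))"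
    by (intro rv_ent_superset finite_words) (auto intro: pre_in_words)
  then show ?thesis unfolding eq .
qed

lemma integrable_cyl_cont:
  assumes "cyl_cont m F" shows "integrable \<mu> F"
proof -
  obtain K where K: "\<And>\<omega>. \<omega> \<in> full_shift m \<Longrightarrow> \<bar>F \<omega>\<bar> \<le> K" using cyl_cont_bounded[OF assms m_ge_1] by blast
  have "F \<in> borel_measurable \<mu>"
    using cyl_cont_measurable[OF assms m_ge_1] by (simp add: measurable_cong_sets[OF sets_mu refl])
  then show ?thesis using K by (intro integrable_const_bound[of _ K]) auto
qed

lemma integral_cyl:
  assumes F: "cyl_cont m F"
    and q: "\<And>\<omega> \<omega>'. \<omega> \<in> full_shift m \<Longrightarrow> \<omega>' \<in> full_shift m \<Longrightarrow> pre q \<omega> = pre q \<omega>' \<Longrightarrow> \<bar>F \<omega> - F \<omega>'\<bar> \<le> e"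
  shows "\<bar>integral\<^sup>L \<mu> F - (\<Sum>v\<in>words m q. prob {\<omega> \<in> full_shift m. pre q \<omega> = v} * F (ext v))\<bar> \<le> e"
proof -
  let ?C = "\<lambda>v. {\<omega> \<in> full_shift m. pre q \<omega> = v}"
  define G where "G \<omega> = (\<Sum>v\<in>words m q. indicator (?C v) \<omega> * F (ext v))" for \<omega>
  have int: "integrable \<mu> (\<lambda>\<omega>. indicator (?C v) \<omega> * F (ext v))" for v
    using cylinder_sets_mu[of q v] by (intro integrable_mult_left integrable_real_indicator) (auto simp: emeasure_eq_measure)
  have IG: "integral\<^sup>L \<mu> G = (\<Sum>v\<in>words m q. prob (?C v) * F (ext v))"
  proof -
    have "integral\<^sup>L \<mu> G = (\<Sum>v\<in>words m q. integral\<^sup>L \<mu> (\<lambda>\<omega>. indicator (?C v) \<omega> * F (ext v)))"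
      unfolding G_def by (rule Bochner_Integration.integral_sum) (rule int)
    also have "\<dots> = (\<Sum>v\<in>words m q. prob (?C v) * F (ext v))"
    proof (intro sum.cong refl)
      fix v
      have "?C v \<inter> space \<mu> = ?C v" by auto
      then show "integral\<^sup>L \<mu> (\<lambda>\<omega>. indicator (?C v) \<omega> * F (ext v)) = prob (?C v) * F (ext v)"
        by (simp del: space_mu)
    qed
    finally show ?thesis .
  qed
  have close: "\<bar>F \<omega> - G \<omega>\<bar> \<le> e" if "\<omega> \<in> full_shift m" for \<omega>
  proof -
    have w: "pre q \<omega> \<in> words m q" by (rule pre_in_words[OF that])
    have "G \<omega> = (\<Sum>v\<in>words m q. if v = pre q \<omega> then F (ext (pre q \<omega>)) else 0)"
      unfolding G_def using that by (intro sum.cong) auto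
    also have "\<dots> = F (ext (pre q \<omega>))" using w finite_words by (subst sum.delta) auto
    finally show ?thesis using q[OF that ext_full_shift[OF w m_ge_1]] by (simp add: pre_ext)
  qed
  have intG: "integrable \<mu> G" unfolding G_def by (intro Bochner_Integration.integrable_sum int)
  have "\<bar>integral\<^sup>L \<mu> F - integral\<^sup>L \<mu> G\<bar> = \<bar>integral\<^sup>L \<mu> (\<lambda>\<omega>. F \<omega> - G \<omega>)\<bar>"
    by (simp add: Bochner_Integration.integral_diff[OF integrable_cyl_cont[OF F] intG])
  also have "\<dots> \<le> integral\<^sup>L \<mu> (\<lambda>\<omega>. \<bar>F \<omega> - G \<omega>\<bar>)" by (rule integral_abs_bound)
  also have "\<dots> \<le> integral\<^sup>L \<mu> (\<lambda>\<omega>. e)"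
    using close integrable_cyl_cont[OF F] intG by (intro integral_mono) auto
  also have "\<dots> = e" by (simp add: prob_space[simplified])
  finally show ?thesis by (simp add: IG)
qed

end

text \<open>Limits of \<open>freq\<close> are consistent under appending a letter, hence come from a
  measure. They are also consistent under prepending one, because the defect 1 / n j tends to 0, and
  this is invariance on cylinders.\<close>

lemma limit_invariant_measure:
  fixes W :: "nat \<Rightarrow> (nat \<Rightarrow> nat) set" and p :: "nat \<Rightarrow> (nat \<Rightarrow> nat) \<Rightarrow> real" and n :: "nat \<Rightarrow> nat"
  assumes wo: "\<And>j. weighted_orbits m (W j) (p j) (n j)" and n: "\<And>j. n j > j"
  obtains r \<mu> where "strict_mono r" "\<mu> \<in> invariant_measures m"
    "\<And>v k. v \<in> words m k \<Longrightarrow> (\<lambda>j. weighted_orbits.freq (W (r j)) (p (r j)) (n (r j)) v)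
       \<longlonglongrightarrow> measure \<mu> {\<omega> \<in> full_shift m. pre k \<omega> = v}"
proof -
  define X where "X j = weighted_orbits.freq (W j) (p j) (n j)" for j
  have "X j v \<in> {0..1}" for j v
    using weighted_orbits.freq_nonneg[OF wo] weighted_orbits.freq_le_1[OF wo] by (simp add: X_def)
  then obtain r l where r: "strict_mono r" and lim: "\<And>v. (\<lambda>j. X (r j) v) \<longlonglongrightarrow> l v"
    using bounded_functions_convergent_subsequence[of X] by blast
  have Cons: "l v = (\<Sum>a\<in>{1..m}. l (a # v))" for v
  proof -
    have "(\<lambda>j. X (r j) v - (\<Sum>a\<in>{1..m}. X (r j) (a # v))) \<longlonglongrightarrow> l v - (\<Sum>a\<in>{1..m}. l (a # v))"
      by (intro tendsto_diff tendsto_sum lim)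
    moreover have "(\<lambda>j. X (r j) v - (\<Sum>a\<in>{1..m}. X (r j) (a # v))) \<longlonglongrightarrow> 0"
    proof (rule Lim_null_comparison[OF _ LIMSEQ_inverse_real_of_nat], rule always_eventually, rule allI)
      fix j
      have "Suc j \<le> n (r j)" using n[of "r j"] seq_suble[OF r, of j] by linarith
      then have "1 / real (n (r j)) \<le> inverse (real (Suc j))"
        unfolding inverse_eq_divide by (intro divide_left_mono) auto
      then show "norm (X (r j) v - (\<Sum>a\<in>{1..m}. X (r j) (a # v))) \<le> inverse (real (Suc j))"
        using weighted_orbits.freq_Cons[OF wo[of "r j"], of v] by (simp add: X_def)
    qed
    ultimately have "l v - (\<Sum>a\<in>{1..m}. l (a # v)) = 0" by (rule LIMSEQ_unique)
    then show ?thesis by simp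
  qed
  interpret word_weights m l
  proof
    show "l v \<ge> 0" for v
      using weighted_orbits.freq_nonneg[OF wo] by (intro LIMSEQ_le_const[OF lim]) (simp add: X_def)
    show "l [] = 1"
      using LIMSEQ_unique[OF lim[of "[]"]] weighted_orbits.freq_Nil[OF wo] by (simp add: X_def)
    show "l v = (\<Sum>a\<in>{1..m}. l (v @ [a]))" for k v
    proof -
      have "(\<lambda>j. X (r j) v) \<longlonglongrightarrow> (\<Sum>a\<in>{1..m}. l (v @ [a]))"
        using weighted_orbits.freq_snoc[OF wo, of _ v] unfolding X_def[symmetric] by (simp add: tendsto_sum lim)
      then show ?thesis by (rule LIMSEQ_unique[OF lim])
    qed
  qed
  define \<mu> where "\<mu> = weights_measure"
  interpret prob_space \<mu> unfolding \<mu>_def by (rule prob_space_weights_measure)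
  have sets: "sets \<mu> = sets (shift_space m)" by (simp add: \<mu>_def weights_measure_def)
  have space: "space \<mu> = full_shift m" using sets_eq_imp_space_eq[OF sets] by simp
  have ms: "shift \<in> measurable \<mu> \<mu>"
    using measurable_shift by (simp add: measurable_cong_sets[OF sets sets])
  have cs: "{\<omega> \<in> full_shift m. pre k \<omega> = w} \<in> sets \<mu>" for k w
    using cylinder_sets[of m k "{w}"] by (simp add: sets)
  have cyl: "prob {\<omega> \<in> full_shift m. pre k \<omega> = v} = l v" if "v \<in> words m k" for v k
    unfolding \<mu>_def using that by (rule weights_measure_cylinder)
  have "distr \<mu> \<mu> shift = \<mu>"
  proof (rule measure_eqI_cylinders[of _ m])
    show "prob_space (distr \<mu> \<mu> shift)" using ms by (rule prob_space_distr)
    fix k w assume w: "w \<in> words m k"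
    have "measure (distr \<mu> \<mu> shift) {\<omega> \<in> full_shift m. pre k \<omega> = w}
       = prob (shift -` {\<omega> \<in> full_shift m. pre k \<omega> = w} \<inter> space \<mu>)"
      by (rule measure_distr[OF ms cs])
    also have "shift -` {\<omega> \<in> full_shift m. pre k \<omega> = w} \<inter> space \<mu>
       = (\<Union>a\<in>{1..m}. {\<omega> \<in> full_shift m. pre (Suc k) \<omega> = a # w})"
      using full_shiftD[of _ m 0] full_shift_shift by (auto simp: space pre_Suc_shift)
    also have "prob \<dots> = (\<Sum>a\<in>{1..m}. prob {\<omega> \<in> full_shift m. pre (Suc k) \<omega> = a # w})"
      using cs by (intro finite_measure_finite_Union) (auto simp: disjoint_family_on_def)
    also have "\<dots> = (\<Sum>a\<in>{1..m}. l (a # w))"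
      using w by (intro sum.cong refl cyl) (auto simp: words_def)
    also have "\<dots> = prob {\<omega> \<in> full_shift m. pre k \<omega> = w}" by (simp only: cyl[OF w] Cons[of w, symmetric])
    finally show "emeasure (distr \<mu> \<mu> shift) {\<omega> \<in> full_shift m. pre k \<omega> = w} = emeasure \<mu> {\<omega> \<in> full_shift m. pre k \<omega> = w}"
      by (simp add: emeasure_eq_measure finite_measure.emeasure_eq_measure[OF finite_measure_distr[OF ms]])
  qed (simp_all add: sets)
  then have "emeasure \<mu> (shift -` A \<inter> space \<mu>) = emeasure \<mu> A" if "A \<in> sets \<mu>" for A
    using emeasure_distr[OF ms that] by simp
  then have "\<mu> \<in> invariant_measures m"
    using prob_space_axioms sets by (simp add: invariant_measures_def)
  moreover have "(\<lambda>j. weighted_orbits.freq (W (r j)) (p (r j)) (n (r j)) v)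
       \<longlonglongrightarrow> measure \<mu> {\<omega> \<in> full_shift m. pre k \<omega> = v}" if "v \<in> words m k" for v k
    using lim[of v] by (simp add: cyl[OF that] X_def)
  ultimately show ?thesis using that r by blast
qed

text \<open>In the entropy clause \<open>b j\<close> is a lower bound for the entropy per symbol of
  the weights. At fixed q the window estimate involves finitely many frequencies and passes to the
  limit in j, giving c \<le> H_q / q; q is arbitrary only afterwards.\<close>

lemma limit_measure_avg_entropy:
  fixes W :: "nat \<Rightarrow> (nat \<Rightarrow> nat) set" and p :: "nat \<Rightarrow> (nat \<Rightarrow> nat) \<Rightarrow> real" and n :: "nat \<Rightarrow> nat"
  assumes wo: "\<And>j. weighted_orbits m (W j) (p j) (n j)" and n: "\<And>j. n j > j"
    and inj: "\<And>j. inj_on (pre (n j)) (W j)"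
  obtains r \<mu> where "strict_mono r" "\<mu> \<in> invariant_measures m"
    "\<And>F. cyl_cont m F \<Longrightarrow> (\<lambda>j. weighted_orbits.avg (W (r j)) (p (r j)) (n (r j)) F) \<longlonglongrightarrow> integral\<^sup>L \<mu> F"
    "\<And>b c. (\<And>j. real (n j) * b j \<le> (\<Sum>\<omega>\<in>W j. ent_fun (p j \<omega>))) \<Longrightarrow> (\<lambda>j. b (r j)) \<longlonglongrightarrow> c \<Longrightarrow> c \<le> ks_entropy \<mu> shift"
proof -
  obtain r \<mu> where r: "strict_mono r" and \<mu>: "\<mu> \<in> invariant_measures m"
    and lim: "\<And>v k. v \<in> words m k \<Longrightarrow> (\<lambda>j. weighted_orbits.freq (W (r j)) (p (r j)) (n (r j)) v)
       \<longlonglongrightarrow> measure \<mu> {\<omega> \<in> full_shift m. pre k \<omega> = v}"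
    using limit_invariant_measure[OF wo n] by blast
  have m: "m \<ge> 1" using weighted_orbits.m_ge_1[OF wo[of 0]] .
  interpret shift_invariant \<mu> m using \<mu> m by (rule shift_invariantI)
  have nr: "n (r j) > j" for j using n[of "r j"] seq_suble[OF r, of j] by linarith
  have "(\<lambda>j. weighted_orbits.avg (W (r j)) (p (r j)) (n (r j)) F) \<longlonglongrightarrow> integral\<^sup>L \<mu> F" if F: "cyl_cont m F" for F
  proof (rule LIMSEQ_I)
    fix e :: real assume "e > 0"
    then obtain q where q: "\<And>\<omega> \<omega>'. \<omega> \<in> full_shift m \<Longrightarrow> \<omega>' \<in> full_shift m \<Longrightarrow> pre q \<omega> = pre q \<omega>' \<Longrightarrow> \<bar>F \<omega> - F \<omega>'\<bar> \<le> e/3"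
      using cyl_contD[OF F, of "e/3"] by auto
    have "(\<lambda>j. \<Sum>v\<in>words m q. weighted_orbits.freq (W (r j)) (p (r j)) (n (r j)) v * F (ext v))
        \<longlonglongrightarrow> (\<Sum>v\<in>words m q. prob {\<omega> \<in> full_shift m. pre q \<omega> = v} * F (ext v))"
      by (rule tendsto_sum, rule tendsto_mult_right, rule lim)
    from LIMSEQ_D[OF this, of "e/3"] obtain N where N: "\<And>j. j \<ge> N \<Longrightarrow> \<bar>(\<Sum>v\<in>words m q. weighted_orbits.freq (W (r j)) (p (r j)) (n (r j)) v * F (ext v)) -
       (\<Sum>v\<in>words m q. prob {\<omega> \<in> full_shift m. pre q \<omega> = v} * F (ext v))\<bar> < e/3"
      using \<open>e > 0\<close> unfolding real_norm_def by auto
    have "\<bar>weighted_orbits.avg (W (r j)) (p (r j)) (n (r j)) F - integral\<^sup>L \<mu> F\<bar> < e" if "j \<ge> N" for j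
    proof -
      have "\<bar>weighted_orbits.avg (W (r j)) (p (r j)) (n (r j)) F
          - (\<Sum>v\<in>words m q. weighted_orbits.freq (W (r j)) (p (r j)) (n (r j)) v * F (ext v))\<bar> \<le> e/3"
        by (rule weighted_orbits.avg_cyl[OF wo[of "r j"]]) (rule q)
      moreover have "\<bar>integral\<^sup>L \<mu> F - (\<Sum>v\<in>words m q. prob {\<omega> \<in> full_shift m. pre q \<omega> = v} * F (ext v))\<bar> \<le> e/3"
        by (rule integral_cyl[OF F]) (rule q)
      ultimately show ?thesis using N[OF that] by linarith
    qed
    then show "\<exists>N. \<forall>j\<ge>N. norm (weighted_orbits.avg (W (r j)) (p (r j)) (n (r j)) F - integral\<^sup>L \<mu> F) < e"
      unfolding real_norm_def by blast
  qed
  moreover have "c \<le> ks_entropy \<mu> shift"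
    if b: "\<And>j. real (n j) * b j \<le> (\<Sum>\<omega>\<in>W j. ent_fun (p j \<omega>))" and bc: "(\<lambda>j. b (r j)) \<longlonglongrightarrow> c" for b c
  proof (rule ks_entropy_ge)
    fix q :: nat assume q: "q \<ge> 1"
    let ?S = "\<lambda>j. \<Sum>v\<in>words m q. ent_fun (weighted_orbits.freq (W (r j)) (p (r j)) (n (r j)) v)"
    have "(\<lambda>j. ?S j / real q) \<longlonglongrightarrow> rv_ent \<mu> (pre q) / real q"
      unfolding rv_ent_pre using q
      by (intro tendsto_divide tendsto_const tendsto_sum ent_fun_tendsto weighted_orbits.freq_nonneg[OF wo])
        (auto intro: lim)
    moreover have "(\<lambda>j. real q * ln (real m) * inverse (real (Suc j))) \<longlonglongrightarrow> real q * ln (real m) * 0"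
      by (intro tendsto_mult tendsto_const LIMSEQ_inverse_real_of_nat)
    ultimately have "(\<lambda>j. ?S j / real q + real q * ln (real m) * inverse (real (Suc j))) \<longlonglongrightarrow> rv_ent \<mu> (pre q) / real q + real q * ln (real m) * 0"
      by (rule tendsto_add)
    then have up: "(\<lambda>j. ?S j / real q + real q * ln (real m) * inverse (real (Suc j))) \<longlonglongrightarrow> rv_ent \<mu> (pre q) / real q" by simp
    have "b (r j) \<le> ?S j / real q + real q * ln (real m) * inverse (real (Suc j))" for j
    proof -
      define N where "N = real (n (r j))"
      have N: "N \<ge> real (Suc j)" using nr[of j] by (simp add: N_def)
      then have N0: "N > 0" by linarith
      have "real q * (N * b (r j)) \<le> real q * (\<Sum>\<omega>\<in>W (r j). ent_fun (p (r j) \<omega>))"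
        unfolding N_def by (intro mult_left_mono b) auto
      also have "\<dots> \<le> N * ?S j + (real q)\<^sup>2 * ln (real m)"
        unfolding N_def by (rule weighted_orbits.entropy_le_windows[OF wo inj])
      finally have "b (r j) \<le> ?S j / real q + real q * ln (real m) / N"
        using N0 q by (simp add: field_simps power2_eq_square)
      also have "real q * ln (real m) / N \<le> real q * ln (real m) * inverse (real (Suc j))"
        using N N0 m unfolding divide_inverse by (intro mult_left_mono le_imp_inverse_le) auto
      finally show ?thesis by simp
    qed
    then show "c \<le> rv_ent \<mu> (pre q) / real q" by (intro LIMSEQ_le[OF bc up]) auto
  qed
  ultimately show ?thesis using that[OF r \<mu>] by blast
qed

subsection \<open>The upper bound\<close>

context interval_ifs
begin

abbreviation g :: "(nat \<Rightarrow> nat) \<Rightarrow> real" where "g \<equiv> geom_pot T DT"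

lemma coding_in_interval:
  assumes "\<omega> \<in> full_shift m" "pre n \<omega> = w"
  shows "coding T \<omega> \<in> {word_map T w 0..word_map T w 1}"
  using coding_bounds[OF assms(1), of n] assms(2) by simp

text \<open>If the partition sum stayed below exp(-n e) for all large n, the cylinder intervals of a
  single generation would cover the coded set at arbitrarily small cost, making it null.\<close>

lemma large_partition_sum:
  assumes "s > 0" "e > 0"
    and E: "E \<subseteq> full_shift m"
    and non_null: "hausdorff_measure s (coding T ` E) \<noteq> 0"
  shows "\<exists>n W. n > j \<and> n \<ge> N \<and> finite W \<and> W \<subseteq> E \<and> inj_on (pre n) W \<and>
    (\<forall>\<omega>\<in>W. \<bar>- ln (word_len T (pre n \<omega>)) - bsum g n \<omega>\<bar> \<le> real n * e) \<and>
    (\<Sum>\<omega>\<in>W. word_len T (pre n \<omega>) powr s) \<ge> exp (- real n * e)"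
proof (rule ccontr)
  assume contra: "\<not> ?thesis"
  have "hausdorff_measure s (coding T ` E) = 0"
  proof (rule hausdorff_null_finite_cover[where 'i = "nat \<Rightarrow> nat"])
    fix d c :: real assume dc: "d > 0" "c > 0"
    obtain N1 where N1: "\<And>n \<omega>. n \<ge> N1 \<Longrightarrow> \<omega> \<in> full_shift m \<Longrightarrow> word_len T (pre n \<omega>) < d"
      using word_len_uniform[OF dc(1)] by blast
    obtain N2 where N2: "\<And>n \<omega>. n \<ge> N2 \<Longrightarrow> \<omega> \<in> full_shift m \<Longrightarrow> \<bar>- ln (word_len T (pre n \<omega>)) - bsum g n \<omega>\<bar> \<le> real n * e"
      using log_word_len_bsum[OF \<open>e > 0\<close>] by blast
    obtain N3 :: nat where N3: "real N3 > - ln c / e" using reals_Archimedean2 by blast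
    define n where "n = N + N1 + N2 + N3 + Suc j"
    have n: "n > j" "n \<ge> N" "n \<ge> N1" "n \<ge> N2" by (auto simp: n_def)
    have "real n > - ln c / e" using N3 by (simp add: n_def)
    then have "- real n * e < ln c" using \<open>e > 0\<close> by (simp add: field_simps)
    then have small: "exp (- real n * e) < c" using dc by (metis exp_less_mono exp_ln)
    \<comment> \<open>One point of E for each word of length n that occurs in E. Representatives
      taken from E inherit its bounds on Birkhoff averages.\<close>
    define W where "W = inv_into E (pre n) ` (pre n ` E)"
    have "pre n ` E \<subseteq> words m n" using E pre_in_words by blast
    then have finW: "finite W" unfolding W_def using finite_words finite_subset by blast
    have WE: "W \<subseteq> E" unfolding W_def by (auto intro: inv_into_into)
    have injW: "inj_on (pre n) W"
    proof (rule inj_onI)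
      fix x y assume "x \<in> W" "y \<in> W" and eq: "pre n x = pre n y"
      then obtain u v where u: "u \<in> pre n ` E" "x = inv_into E (pre n) u" and v: "v \<in> pre n ` E" "y = inv_into E (pre n) v"
        unfolding W_def by blast
      then have "u = v" using eq f_inv_into_f[OF u(1)] f_inv_into_f[OF v(1)] by simp
      then show "x = y" using u v by simp
    qed
    have "(\<Sum>\<omega>\<in>W. word_len T (pre n \<omega>) powr s) < exp (- real n * e)"
    proof (rule ccontr)
      assume "\<not> ?thesis"
      moreover have "\<forall>\<omega>\<in>W. \<bar>- ln (word_len T (pre n \<omega>)) - bsum g n \<omega>\<bar> \<le> real n * e"
        using N2[OF n(4)] WE E by blast
      ultimately show False using contra n finW WE injW by (meson not_less)
    qed
    moreover define V where "V \<omega> = {word_map T (pre n \<omega>) 0..word_map T (pre n \<omega>) 1}" for \<omega>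
    have diam: "diameter (V \<omega>) = word_len T (pre n \<omega>)" if "\<omega> \<in> W" for \<omega>
    proof -
      have "word_len T (pre n \<omega>) > 0" using that WE E by (intro word_len_pos set_pre) blast
      then show ?thesis by (simp add: V_def word_len_def diameter_closed_interval)
    qed
    moreover have "coding T ` E \<subseteq> (\<Union>\<omega>\<in>W. V \<omega>)"
    proof
      fix x assume "x \<in> coding T ` E"
      then obtain \<omega> where \<omega>: "\<omega> \<in> E" "x = coding T \<omega>" by blast
      define \<omega>' where "\<omega>' = inv_into E (pre n) (pre n \<omega>)"
      have "pre n \<omega>' = pre n \<omega>" "\<omega>' \<in> W" using \<omega>(1) by (auto simp: \<omega>'_def W_def f_inv_into_f)
      then have "x \<in> V \<omega>'" using coding_in_interval[of \<omega> n "pre n \<omega>'"] \<omega> E by (auto simp: V_def)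
      then show "x \<in> (\<Union>\<omega>\<in>W. V \<omega>)" using \<open>\<omega>' \<in> W\<close> by blast
    qed
    moreover have "bounded (V \<omega>)" for \<omega> by (simp add: V_def)
    moreover have "word_len T (pre n \<omega>) \<le> d" if "\<omega> \<in> W" for \<omega>
      using N1[OF n(3)] that WE E by (intro less_imp_le) blast
    ultimately show "\<exists>(I :: (nat \<Rightarrow> nat) set) V. finite I \<and> coding T ` E \<subseteq> (\<Union>i\<in>I. V i) \<and>
      (\<forall>i\<in>I. bounded (V i) \<and> diameter (V i) \<le> d) \<and> (\<Sum>i\<in>I. diameter (V i) powr s) \<le> c"
      using finW small by (intro exI[of _ W] exI[of _ V]) simp
  qed
  then show False using non_null by simp
qed

text \<open>For weights D^s / Z the entropy equals s times the mean of - ln D, plus ln Z. Replacing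
  - ln D by the Birkhoff sum of g loses n s e, and ln Z \<ge> - n e loses n e; together these are
  the term (s + 1) e.\<close>

lemma entropy_gibbs_weights:
  assumes W: "finite W" "W \<subseteq> full_shift m" "W \<noteq> {}" and "n > 0" "s > 0"
    and dist: "\<And>\<omega>. \<omega> \<in> W \<Longrightarrow> \<bar>- ln (word_len T (pre n \<omega>)) - bsum g n \<omega>\<bar> \<le> real n * e"
    and Z: "Z = (\<Sum>\<omega>\<in>W. word_len T (pre n \<omega>) powr s)" "Z \<ge> exp (- real n * e)"
    and p_eq: "p = (\<lambda>\<omega>. word_len T (pre n \<omega>) powr s / Z)"
  shows "weighted_orbits m W p n"
    and "real n * (s * weighted_orbits.avg W p n g - (s + 1) * e) \<le> (\<Sum>\<omega>\<in>W. ent_fun (p \<omega>))"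
proof -
  have D: "word_len T (pre n \<omega>) > 0" if "\<omega> \<in> W" for \<omega> using that W by (intro word_len_pos set_pre) blast
  have Z0: "Z > 0" using Z(2) exp_gt_zero[of "- real n * e"] by linarith
  have pp: "p \<omega> > 0" if "\<omega> \<in> W" for \<omega> using D[OF that] Z0 by (simp add: p_eq)
  have sum1: "(\<Sum>\<omega>\<in>W. p \<omega>) = 1" using Z0 Z(1) by (simp add: p_eq sum_divide_distrib[symmetric])
  show wo: "weighted_orbits m W p n"
    using m_pos W pp sum1 \<open>n > 0\<close> by unfold_locales (auto intro: less_imp_le)
  interpret weighted_orbits m W p n by fact
  have lnZ: "ln Z \<ge> - real n * e" using Z(2) Z0 by (subst ln_ge_iff) auto
  have "real n * (s * avg g) = (\<Sum>\<omega>\<in>W. p \<omega> * (s * bsum g n \<omega>))"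
    using \<open>n > 0\<close> by (simp add: avg_def birkhoff_avg_bsum sum_distrib_left mult_ac)
  also have "\<dots> \<le> (\<Sum>\<omega>\<in>W. ent_fun (p \<omega>) + p \<omega> * (s * (real n * e) - ln Z))"
  proof (rule sum_mono)
    fix \<omega> assume w: "\<omega> \<in> W"
    have "ln (p \<omega>) = s * ln (word_len T (pre n \<omega>)) - ln Z"
      using D[OF w] Z0 by (simp add: p_eq ln_div ln_powr)
    then have "- ln (p \<omega>) = s * (- ln (word_len T (pre n \<omega>))) + ln Z" by simp
    moreover have "ent_fun (p \<omega>) = p \<omega> * (- ln (p \<omega>))" using pp[OF w] by (simp add: ent_fun_pos)
    ultimately have "ent_fun (p \<omega>) = p \<omega> * (s * (- ln (word_len T (pre n \<omega>))) + ln Z)" by (simp only:)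
    moreover have "s * bsum g n \<omega> \<le> s * (- ln (word_len T (pre n \<omega>)) + real n * e)"
      using dist[OF w] \<open>s > 0\<close> by (intro mult_left_mono) auto
    then have "p \<omega> * (s * bsum g n \<omega>) \<le> p \<omega> * (s * (- ln (word_len T (pre n \<omega>)) + real n * e))"
      by (rule mult_left_mono) (use pp[OF w] in simp)
    ultimately show "p \<omega> * (s * bsum g n \<omega>) \<le> ent_fun (p \<omega>) + p \<omega> * (s * (real n * e) - ln Z)"
      by (simp add: algebra_simps)
  qed
  also have "\<dots> = (\<Sum>\<omega>\<in>W. ent_fun (p \<omega>)) + (s * (real n * e) - ln Z)"
    by (simp add: sum.distrib sum_distrib_right[symmetric] sum1)
  finally show "real n * (s * avg g - (s + 1) * e) \<le> (\<Sum>\<omega>\<in>W. ent_fun (p \<omega>))"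
    using lnZ by (simp add: algebra_simps)
qed

text \<open>The constants d and K are uniform over F, so all the orbit averages of g, and with them
  the limit exponent, are at least d. The limit measure then contradicts the strict inequality in
  \<open>hyp\<close>.\<close>

lemma birkhoff_level_null:
  assumes f: "cyl_cont m f" and s: "s > 0" and "d > 0"
    and hyp: "\<And>\<mu>. \<mu> \<in> invariant_measures m \<Longrightarrow> integral\<^sup>L \<mu> f = \<alpha> \<Longrightarrow> integral\<^sup>L \<mu> g > 0 \<Longrightarrow>
       ks_entropy \<mu> shift / integral\<^sup>L \<mu> g < s"
    and F: "F \<subseteq> full_shift m" "\<And>\<omega>. \<omega> \<in> F \<Longrightarrow> (\<lambda>n. birkhoff_avg f n \<omega>) \<longlonglongrightarrow> \<alpha>"
       "\<And>\<omega> n. \<omega> \<in> F \<Longrightarrow> n \<ge> K \<Longrightarrow> birkhoff_avg g n \<omega> \<ge> d"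
  shows "hausdorff_measure s (coding T ` F) = 0"
proof (rule ccontr)
  assume non_null: "hausdorff_measure s (coding T ` F) \<noteq> 0"
  \<comment> \<open>The speed of convergence of the averages of f depends on the point. For each
    tolerance F is a countable union of sets with a common starting time, and one of them must be
    non-null.\<close>
  have ex: "\<exists>N. hausdorff_measure s (coding T ` {\<omega> \<in> F. \<forall>n\<ge>N. \<bar>birkhoff_avg f n \<omega> - \<alpha>\<bar> \<le> e}) \<noteq> 0" if e_pos: "e > 0" for e
  proof (rule ccontr)
    assume "\<not> ?thesis"
    then have "hausdorff_measure s (\<Union>N. coding T ` {\<omega> \<in> F. \<forall>n\<ge>N. \<bar>birkhoff_avg f n \<omega> - \<alpha>\<bar> \<le> e}) = 0"
      by (intro hausdorff_null_UN) blast
    moreover have "coding T ` F \<subseteq> (\<Union>N. coding T ` {\<omega> \<in> F. \<forall>n\<ge>N. \<bar>birkhoff_avg f n \<omega> - \<alpha>\<bar> \<le> e})"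
    proof
      fix x assume "x \<in> coding T ` F"
      then obtain \<omega> where \<omega>: "\<omega> \<in> F" "x = coding T \<omega>" by blast
      obtain N where "\<forall>n\<ge>N. norm (birkhoff_avg f n \<omega> - \<alpha>) < e" using LIMSEQ_D[OF F(2)[OF \<omega>(1)] e_pos] by blast
      then have "\<forall>n\<ge>N. \<bar>birkhoff_avg f n \<omega> - \<alpha>\<bar> \<le> e" unfolding real_norm_def by (simp add: less_imp_le)
      then show "x \<in> (\<Union>N. coding T ` {\<omega> \<in> F. \<forall>n\<ge>N. \<bar>birkhoff_avg f n \<omega> - \<alpha>\<bar> \<le> e})" using \<omega> by blast
    qed
    ultimately show False using non_null hausdorff_null_mono by blast
  qed
  define e where "e j = inverse (real (Suc j))" for j
  have e: "e j > 0" for j by (simp add: e_def)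
  define Q where "Q j n W \<longleftrightarrow> n > j \<and> finite W \<and> W \<subseteq> full_shift m \<and> inj_on (pre n) W \<and>
      (\<forall>\<omega>\<in>W. \<bar>birkhoff_avg f n \<omega> - \<alpha>\<bar> \<le> e j \<and> birkhoff_avg g n \<omega> \<ge> d) \<and>
      (\<forall>\<omega>\<in>W. \<bar>- ln (word_len T (pre n \<omega>)) - bsum g n \<omega>\<bar> \<le> real n * e j) \<and>
      (\<Sum>\<omega>\<in>W. word_len T (pre n \<omega>) powr s) \<ge> exp (- real n * e j)" for j n W
  have "\<forall>j. \<exists>nW. Q j (fst nW) (snd nW)"
  proof
    fix j
    obtain N where N: "hausdorff_measure s (coding T ` {\<omega> \<in> F. \<forall>n\<ge>N. \<bar>birkhoff_avg f n \<omega> - \<alpha>\<bar> \<le> e j}) \<noteq> 0"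
      using ex[OF e] by blast
    have sub: "{\<omega> \<in> F. \<forall>n\<ge>N. \<bar>birkhoff_avg f n \<omega> - \<alpha>\<bar> \<le> e j} \<subseteq> full_shift m" using F(1) by auto
    from large_partition_sum[OF s e[of j] sub N, where j = j and N = "N + K"]
    obtain n W where nW: "n > j" "n \<ge> N + K" "finite W" "W \<subseteq> {\<omega> \<in> F. \<forall>n\<ge>N. \<bar>birkhoff_avg f n \<omega> - \<alpha>\<bar> \<le> e j}" "inj_on (pre n) W"
      "\<forall>\<omega>\<in>W. \<bar>- ln (word_len T (pre n \<omega>)) - bsum g n \<omega>\<bar> \<le> real n * e j"
      "(\<Sum>\<omega>\<in>W. word_len T (pre n \<omega>) powr s) \<ge> exp (- real n * e j)"
      by (elim exE conjE)
    have "\<forall>\<omega>\<in>W. \<bar>birkhoff_avg f n \<omega> - \<alpha>\<bar> \<le> e j \<and> birkhoff_avg g n \<omega> \<ge> d"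
      using nW(2,4) F(3)[of _ n] by auto
    then have "Q j n W" using nW F(1) unfolding Q_def by blast
    then show "\<exists>nW. Q j (fst nW) (snd nW)" by (intro exI[of _ "(n, W)"]) simp
  qed
  from choice[OF this] obtain nW where nW: "\<forall>j. Q j (fst (nW j)) (snd (nW j))" by (elim exE)
  define n W where "n j = fst (nW j)" and "W j = snd (nW j)" for j
  have Q: "Q j (n j) (W j)" for j using nW by (simp add: n_def W_def)
  define Z where "Z j = (\<Sum>\<omega>\<in>W j. word_len T (pre (n j) \<omega>) powr s)" for j
  define p where "p j = (\<lambda>\<omega>. word_len T (pre (n j) \<omega>) powr s / Z j)" for j
  have n: "n j > j" and inj: "inj_on (pre (n j)) (W j)" for j using Q[of j] by (auto simp: Q_def)
  have Zj: "Z j \<ge> exp (- real (n j) * e j)" for j using Q[of j] by (simp add: Q_def Z_def)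
  have ne: "W j \<noteq> {}" for j
  proof
    assume "W j = {}"
    then show False using Zj[of j] exp_gt_zero[of "- real (n j) * e j"] by (simp add: Z_def)
  qed
  have gw: "weighted_orbits m (W j) (p j) (n j)"
    "real (n j) * (s * weighted_orbits.avg (W j) (p j) (n j) g - (s + 1) * e j) \<le> (\<Sum>\<omega>\<in>W j. ent_fun (p j \<omega>))" for j
    using entropy_gibbs_weights[of "W j" "n j" s "e j" "Z j" "p j"] Q[of j] ne[of j] s n[of j] Zj[of j]
    by (simp_all add: Q_def Z_def p_def)
  obtain r \<mu> where r: "strict_mono r" and \<mu>: "\<mu> \<in> invariant_measures m"
    and avg: "\<And>F. cyl_cont m F \<Longrightarrow> (\<lambda>j. weighted_orbits.avg (W (r j)) (p (r j)) (n (r j)) F) \<longlonglongrightarrow> integral\<^sup>L \<mu> F"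
    and ent: "\<And>b c. (\<And>j. real (n j) * b j \<le> (\<Sum>\<omega>\<in>W j. ent_fun (p j \<omega>))) \<Longrightarrow> (\<lambda>j. b (r j)) \<longlonglongrightarrow> c \<Longrightarrow> c \<le> ks_entropy \<mu> shift"
  proof (rule limit_measure_avg_entropy[OF gw(1) n inj], goal_cases)
    case (1 r \<mu>)
    show ?case by (rule 1(1)[OF 1(2-5)])
  qed
  have e_lim: "(\<lambda>j. e (r j)) \<longlonglongrightarrow> 0"
    using LIMSEQ_subseq_LIMSEQ[OF LIMSEQ_inverse_real_of_nat r] by (simp add: e_def o_def)
  have f_close: "\<bar>weighted_orbits.avg (W j) (p j) (n j) f - \<alpha>\<bar> \<le> e j" for j
  proof -
    interpret weighted_orbits m "W j" "p j" "n j" by (rule gw)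
    have "avg f - \<alpha> = (\<Sum>\<omega>\<in>W j. p j \<omega> * (birkhoff_avg f (n j) \<omega> - \<alpha>))"
      using p(2) by (simp add: avg_def right_diff_distrib sum_subtractf sum_distrib_right[symmetric])
    then have "\<bar>avg f - \<alpha>\<bar> \<le> (\<Sum>\<omega>\<in>W j. \<bar>p j \<omega> * (birkhoff_avg f (n j) \<omega> - \<alpha>)\<bar>)" by simp
    also have "\<dots> \<le> (\<Sum>\<omega>\<in>W j. p j \<omega> * e j)"
      using Q[of j] p(1) by (intro sum_mono) (auto simp: Q_def abs_mult intro!: mult_left_mono)
    also have "\<dots> = e j" using p(2) by (simp add: sum_distrib_right[symmetric])
    finally show ?thesis .
  qed
  have "(\<lambda>j. weighted_orbits.avg (W (r j)) (p (r j)) (n (r j)) f - \<alpha>) \<longlonglongrightarrow> 0"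
    by (rule Lim_null_comparison[OF _ e_lim]) (simp add: f_close)
  then have int_f: "integral\<^sup>L \<mu> f = \<alpha>" by (rule LIMSEQ_unique[OF avg[OF f] LIM_zero_cancel])
  have g_ge: "weighted_orbits.avg (W j) (p j) (n j) g \<ge> d" for j
  proof -
    interpret weighted_orbits m "W j" "p j" "n j" by (rule gw)
    have "d = (\<Sum>\<omega>\<in>W j. p j \<omega> * d)" using p(2) by (simp add: sum_distrib_right[symmetric])
    also have "\<dots> \<le> avg g"
      unfolding avg_def using Q[of j] p(1) by (intro sum_mono mult_left_mono) (auto simp: Q_def)
    finally show ?thesis .
  qed
  have "integral\<^sup>L \<mu> g \<ge> d" using g_ge by (intro LIMSEQ_le_const[OF avg[OF cyl_cont_geom_pot]]) blast
  then have int_g: "integral\<^sup>L \<mu> g > 0" using \<open>d > 0\<close> by linarith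
  have "(\<lambda>j. s * weighted_orbits.avg (W (r j)) (p (r j)) (n (r j)) g - (s + 1) * e (r j)) \<longlonglongrightarrow> s * integral\<^sup>L \<mu> g - (s + 1) * 0"
    by (intro tendsto_diff tendsto_mult tendsto_const avg[OF cyl_cont_geom_pot] e_lim)
  then have "s * integral\<^sup>L \<mu> g - (s + 1) * 0 \<le> ks_entropy \<mu> shift"
    by (rule ent[of "\<lambda>j. s * weighted_orbits.avg (W j) (p j) (n j) g - (s + 1) * e j", OF gw(2)])
  then have "s \<le> ks_entropy \<mu> shift / integral\<^sup>L \<mu> g" using int_g by (simp add: field_simps)
  then show False using hyp[OF \<mu> int_f int_g] by linarith
qed

theorem upper_bound:
  assumes f: "cyl_cont m f" and s: "s > 0"
    and hyp: "\<And>\<mu>. \<mu> \<in> invariant_measures m \<Longrightarrow> integral\<^sup>L \<mu> f = \<alpha> \<Longrightarrow> integral\<^sup>L \<mu> g > 0 \<Longrightarrow>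
       ks_entropy \<mu> shift / integral\<^sup>L \<mu> g < s"
  shows "hausdorff_measure s (coding T `
            ({\<omega> \<in> full_shift m. (\<lambda>n. birkhoff_avg f n \<omega>) \<longlonglongrightarrow> \<alpha>} \<inter>
             {\<omega> \<in> full_shift m. Liminf sequentially (\<lambda>n. ereal (birkhoff_avg g n \<omega>)) > 0})) = 0"
    (is "hausdorff_measure s (coding T ` ?E) = 0")
proof -
  \<comment> \<open>The index k is at once the starting time and, as 1 / (k + 1), the lower bound
    for the averages of g.\<close>
  define F where "F k = {\<omega> \<in> full_shift m. (\<lambda>n. birkhoff_avg f n \<omega>) \<longlonglongrightarrow> \<alpha> \<and>
     (\<forall>n\<ge>k. birkhoff_avg g n \<omega> \<ge> inverse (real (Suc k)))}" for k
  have null: "hausdorff_measure s (coding T ` F k) = 0" for k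
    by (rule birkhoff_level_null[OF f s, where d = "inverse (real (Suc k))" and \<alpha> = \<alpha> and K = k])
      (auto simp: F_def intro: hyp)
  have sub: "?E \<subseteq> (\<Union>k. F k)"
  proof
    fix \<omega> assume \<omega>: "\<omega> \<in> ?E"
    then obtain d where d: "0 < ereal d" "ereal d < Liminf sequentially (\<lambda>n. ereal (birkhoff_avg g n \<omega>))"
      using ereal_dense2 by blast
    from less_LiminfD[OF d(2)] obtain N where N: "\<And>n. n \<ge> N \<Longrightarrow> d < birkhoff_avg g n \<omega>"
      by (auto simp: eventually_sequentially)
    obtain k where k: "inverse (real (Suc k)) < d" using reals_Archimedean d(1) by auto
    have "inverse (real (Suc (N + k))) \<le> inverse (real (Suc k))" by (intro le_imp_inverse_le) auto
    then have "birkhoff_avg g n \<omega> \<ge> inverse (real (Suc (N + k)))" if "n \<ge> N + k" for n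
      using N[of n] that k by linarith
    then have "\<omega> \<in> F (N + k)" using \<omega> by (simp add: F_def)
    then show "\<omega> \<in> (\<Union>k. F k)" by blast
  qed
  have "hausdorff_measure s (\<Union>k. coding T ` F k) = 0" by (rule hausdorff_null_UN) (rule null)
  moreover have "coding T ` ?E \<subseteq> (\<Union>k. coding T ` F k)" using sub by blast
  ultimately show ?thesis by (rule hausdorff_null_mono)
qed

end

subsection \<open>Concatenated blocks and a law of large numbers\<close>

text \<open>The position J (J + 1) / 2 at which block J starts; that block has length J + 1.\<close>

definition len :: "nat \<Rightarrow> nat" where "len J = (\<Sum>j<J. Suc j)"

definition blk :: "nat \<Rightarrow> nat" where "blk i = (LEAST J. i < len (Suc J))"

definition cat :: "(nat \<Rightarrow> nat \<Rightarrow> 'a) \<Rightarrow> nat \<Rightarrow> 'a" where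
  "cat \<Omega> i = \<Omega> (blk i) (i - len (blk i))"

lemma len_0 [simp]: "len 0 = 0" by (simp add: len_def)
lemma len_Suc: "len (Suc J) = len J + Suc J" by (simp add: len_def)
lemma len_mono: "J \<le> K \<Longrightarrow> len J \<le> len K" unfolding len_def by (rule sum_mono2) auto
lemma len_ge: "J \<le> len J" by (induction J) (auto simp: len_Suc)

lemma len_real: "real (len J) = real J * (real J + 1) / 2"
  by (induction J) (auto simp: len_Suc field_simps)

lemma blk_bounds: "len (blk i) \<le> i" "i < len (Suc (blk i))"
proof -
  have ex: "i < len (Suc i)" using len_ge[of "Suc i"] by linarith
  show "i < len (Suc (blk i))" unfolding blk_def by (rule LeastI[of _ i]) (rule ex)
  show "len (blk i) \<le> i"
  proof (cases "blk i")
    case (Suc K)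
    then have "\<not> i < len (Suc K)" using not_less_Least[of K "\<lambda>J. i < len (Suc J)"] unfolding blk_def by auto
    then show ?thesis using Suc by simp
  qed simp
qed

lemma blk_eqI: "len J \<le> i \<Longrightarrow> i < len (Suc J) \<Longrightarrow> blk i = J"
  using blk_bounds[of i] len_mono[of "Suc J" "blk i"] len_mono[of "Suc (blk i)" J]
  by (cases "blk i" J rule: linorder_cases) auto

lemma cat_block: "k \<le> J \<Longrightarrow> cat \<Omega> (len J + k) = \<Omega> J k"
  using blk_eqI[of J "len J + k"] by (simp add: cat_def len_Suc)

lemma blk_at_top: "filterlim blk at_top sequentially"
  unfolding filterlim_at_top eventually_sequentially
proof (intro allI exI[of _ "len _"] impI)
  fix Z n assume "len Z \<le> n"
  then show "Z \<le> blk n"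
    using blk_bounds(2)[of n] len_mono[of "Suc (blk n)" Z] by (meson not_less_eq_eq not_le order_trans)
qed

lemma Suc_over_len: "(\<lambda>J. real (Suc J) / real (len J)) \<longlonglongrightarrow> 0"
proof -
  have "(\<lambda>J. 2 / real J) \<longlonglongrightarrow> 0" by (rule lim_const_over_n)
  moreover have "eventually (\<lambda>J. 2 / real J = real (Suc J) / real (len J)) sequentially"
    using eventually_gt_at_top[of 0]
  proof eventually_elim
    case (elim J)
    then have "real J + 1 > 0" by simp
    then show ?case using elim by (simp add: len_real divide_simps)
  qed
  ultimately show ?thesis by (rule Lim_transform_eventually)
qed

lemma weighted_sum_bound:
  fixes c :: "nat \<Rightarrow> real"
  assumes "\<And>j. \<bar>c j\<bar> \<le> real (Suc j) * K" "\<And>j. j \<ge> N \<Longrightarrow> \<bar>c j\<bar> \<le> real (Suc j) * e" "e \<ge> 0" "K \<ge> 0"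
  shows "\<bar>\<Sum>j<J. c j\<bar> \<le> real (len N) * K + real (len J) * e"
proof -
  have "\<bar>\<Sum>j<J. c j\<bar> \<le> real (len (min J N)) * K + real (len J) * e"
  proof (induction J)
    case (Suc J)
    have "\<bar>\<Sum>j<Suc J. c j\<bar> \<le> \<bar>\<Sum>j<J. c j\<bar> + \<bar>c J\<bar>" by simp
    also have "\<dots> \<le> real (len (min (Suc J) N)) * K + real (len (Suc J)) * e"
    proof (cases "J \<ge> N")
      case True
      then show ?thesis using Suc assms(2)[of J] by (simp add: len_Suc algebra_simps min_absorb2)
    next
      case False
      have "real (Suc J) * e \<ge> 0" using assms(3) by simp
      then show ?thesis using False Suc assms(1)[of J] by (simp add: len_Suc algebra_simps min_absorb1)
    qed
    finally show ?case .
  qed simp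
  moreover have "real (len (min J N)) * K \<le> real (len N) * K"
    using assms(4) by (intro mult_right_mono) (auto intro: len_mono)
  ultimately show ?thesis by linarith
qed

text \<open>A Cesaro mean in which block j has weight j + 1. It disposes of errors that are small
  relative to the length of a block.\<close>

lemma weighted_sum_tendsto_0:
  fixes c :: "nat \<Rightarrow> real"
  assumes K: "\<And>j. \<bar>c j\<bar> \<le> real (Suc j) * K" "K \<ge> 0"
    and small: "\<And>e. e > 0 \<Longrightarrow> \<exists>N. \<forall>j\<ge>N. \<bar>c j\<bar> \<le> real (Suc j) * e"
  shows "(\<lambda>J. (\<Sum>j<J. c j) / real (len J)) \<longlonglongrightarrow> 0"
proof (rule LIMSEQ_I)
  fix e :: real assume e: "e > 0"
  obtain N where N: "\<And>j. j \<ge> N \<Longrightarrow> \<bar>c j\<bar> \<le> real (Suc j) * (e/3)" using small[of "e/3"] e by auto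
  obtain M :: nat where M: "real M > real (len N) * K / (e/3)" using reals_Archimedean2 by blast
  have "norm ((\<Sum>j<J. c j) / real (len J) - 0) < e" if J: "J \<ge> Suc M" for J
  proof -
    have lJ: "real (len J) > real (len N) * K / (e/3)" "real (len J) > 0" using len_ge[of J] M J by auto
    have "\<bar>\<Sum>j<J. c j\<bar> \<le> real (len N) * K + real (len J) * (e/3)"
      using weighted_sum_bound[of c K N "e/3" J, OF K(1) N] e K(2) by simp
    also have "real (len N) * K < real (len J) * (e/3)" using lJ e by (simp add: field_simps)
    finally have "\<bar>\<Sum>j<J. c j\<bar> < real (len J) * e" using e lJ by (simp add: field_simps)
    then show ?thesis using lJ by (simp add: abs_divide field_simps)
  qed
  then show "\<exists>no. \<forall>J\<ge>no. norm ((\<Sum>j<J. c j) / real (len J) - 0) < e" by blast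
qed

section \<open>A law of large numbers for independent blocks\<close>

lemma indep_vars_coordinates:
  assumes "prob_space \<mu>"
  shows "prob_space.indep_vars (PiM UNIV (\<lambda>_::nat. \<mu>)) (\<lambda>_. \<mu>) (\<lambda>j \<Omega>. \<Omega> j) UNIV"
proof -
  interpret P: prob_space "PiM UNIV (\<lambda>_::nat. \<mu>)" by (rule prob_space_PiM) (rule assms)
  have c: "distr (PiM UNIV (\<lambda>_::nat. \<mu>)) \<mu> (\<lambda>\<Omega>. \<Omega> j) = \<mu>" for j
    by (rule distr_PiM_component[of UNIV "\<lambda>_. \<mu>"]) (auto simp: assms)
  have "distr (PiM UNIV (\<lambda>_::nat. \<mu>)) (PiM UNIV (\<lambda>_. \<mu>)) (\<lambda>x. x) = PiM UNIV (\<lambda>_. \<mu>)"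
    by (rule distr_id2) simp
  then have "distr (PiM UNIV (\<lambda>_::nat. \<mu>)) (PiM UNIV (\<lambda>_. \<mu>)) (\<lambda>x. \<lambda>i\<in>UNIV. x i)
      = PiM UNIV (\<lambda>j. distr (PiM UNIV (\<lambda>_::nat. \<mu>)) \<mu> (\<lambda>\<Omega>. \<Omega> j))"
    by (simp add: c restrict_UNIV)
  then show ?thesis by (subst P.indep_vars_iff_distr_eq_PiM) auto
qed

text \<open>The squared ranges sum to at most 4 C^2 J^3, while the deviation e \<open>len J\<close>
  is at least e J^2 / 2. Hoeffding's exponent is then at least e^2 J / (8 C^2), linear in J although
  the summands grow.\<close>

lemma hoeffding_blocks:
  fixes Y :: "nat \<Rightarrow> 'a \<Rightarrow> real"
  assumes \<mu>: "prob_space \<mu>" and Y: "\<And>j. Y j \<in> borel_measurable \<mu>"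
    and C: "C > 0" "\<And>j x. x \<in> space \<mu> \<Longrightarrow> \<bar>Y j x\<bar> \<le> C * real (Suc j)" and e: "e > 0"
  shows "measure (PiM UNIV (\<lambda>_. \<mu>)) {\<Omega> \<in> space (PiM UNIV (\<lambda>_. \<mu>)).
      \<bar>(\<Sum>j<J. Y j (\<Omega> j)) - (\<Sum>j<J. integral\<^sup>L \<mu> (Y j))\<bar> \<ge> e * real (len J)}
      \<le> 2 * exp (- (e\<^sup>2 / (8 * C\<^sup>2))) ^ J"
proof (cases "J = 0")
  case True
  interpret P: prob_space "PiM UNIV (\<lambda>_::nat. \<mu>)" by (rule prob_space_PiM) (rule \<mu>)
  show ?thesis using True P.prob_le_1 by (intro order_trans[OF P.prob_le_1]) simp
next
  case False
  let ?P = "PiM UNIV (\<lambda>_::nat. \<mu>)"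
  interpret P: prob_space ?P by (rule prob_space_PiM) (rule \<mu>)
  have c: "distr ?P \<mu> (\<lambda>\<Omega>. \<Omega> j) = \<mu>" for j
    by (rule distr_PiM_component[of UNIV "\<lambda>_. \<mu>"]) (auto simp: \<mu>)
  have E: "P.expectation (\<lambda>\<Omega>. Y j (\<Omega> j)) = integral\<^sup>L \<mu> (Y j)" for j
    using integral_distr[of "\<lambda>\<Omega>. \<Omega> j" ?P \<mu> "Y j"] Y[of j] by (simp add: c)
  have "P.indep_vars (\<lambda>_. borel) (\<lambda>j \<Omega>. Y j (\<Omega> j)) UNIV"
    using Y by (intro P.indep_vars_compose2[OF indep_vars_coordinates[OF \<mu>]]) auto
  then have ind: "P.indep_vars (\<lambda>_. borel) (\<lambda>j \<Omega>. Y j (\<Omega> j)) {..<J}"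
    by (rule P.indep_vars_subset) auto
  interpret H: Hoeffding_ineq ?P "{..<J}" "\<lambda>j \<Omega>. Y j (\<Omega> j)" "\<lambda>j. - (C * real (Suc j))" "\<lambda>j. C * real (Suc j)"
     "\<Sum>j<J. P.expectation (\<lambda>\<Omega>. Y j (\<Omega> j))"
  proof unfold_locales
    fix j
    have "\<Omega> j \<in> space \<mu>" if "\<Omega> \<in> space ?P" for \<Omega> using that by (auto simp: space_PiM)
    then show "AE \<Omega> in ?P. Y j (\<Omega> j) \<in> {- (C * real (Suc j))..C * real (Suc j)}"
      using C(2) by (intro AE_I2) (simp add: abs_le_iff minus_le_iff)
  qed (use ind in auto)
  define S where "S = (\<Sum>j<J. (C * real (Suc j) - - (C * real (Suc j)))\<^sup>2)"
  have "S = (\<Sum>j<J. 4 * C\<^sup>2 * (real (Suc j))\<^sup>2)" unfolding S_def by (simp add: power2_eq_square algebra_simps)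
  also have "\<dots> \<le> (\<Sum>j<J. 4 * C\<^sup>2 * (real J)\<^sup>2)"
    using C by (intro sum_mono mult_left_mono power_mono) auto
  finally have S_le: "S \<le> 4 * C\<^sup>2 * (real J) ^ 3" by (simp add: power2_eq_square power3_eq_cube algebra_simps)
  have S_pos: "S > 0" unfolding S_def using False C by (intro sum_pos) auto
  have lJ: "real (len J) \<ge> (real J)\<^sup>2 / 2" by (simp add: len_real power2_eq_square algebra_simps)
  have "e\<^sup>2 / (8 * C\<^sup>2) * real J \<le> 2 * (e * real (len J))\<^sup>2 / S"
  proof -
    have "e\<^sup>2 / (8 * C\<^sup>2) * real J = 2 * (e * ((real J)\<^sup>2 / 2))\<^sup>2 / (4 * C\<^sup>2 * (real J) ^ 3)"
      using False C by (simp add: divide_simps power2_eq_square power3_eq_cube)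
    also have "\<dots> \<le> 2 * (e * real (len J))\<^sup>2 / (4 * C\<^sup>2 * (real J) ^ 3)"
      using lJ e by (intro divide_right_mono mult_left_mono power_mono) auto
    also have "\<dots> \<le> 2 * (e * real (len J))\<^sup>2 / S"
      using S_le S_pos by (intro divide_left_mono) (auto intro: mult_pos_pos)
    finally show ?thesis .
  qed
  then have "exp (-2 * (e * real (len J))\<^sup>2 / S) \<le> exp (- (e\<^sup>2 / (8 * C\<^sup>2)) * real J)" by simp
  also have "\<dots> = exp (- (e\<^sup>2 / (8 * C\<^sup>2))) ^ J" by (simp add: exp_of_nat_mult[symmetric] mult.commute)
  finally have "exp (-2 * (e * real (len J))\<^sup>2 / S) \<le> exp (- (e\<^sup>2 / (8 * C\<^sup>2))) ^ J" .
  moreover have "P.prob {\<Omega> \<in> space ?P. \<bar>(\<Sum>j<J. Y j (\<Omega> j)) - (\<Sum>j<J. P.expectation (\<lambda>\<Omega>. Y j (\<Omega> j)))\<bar> \<ge> e * real (len J)}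
      \<le> 2 * exp (-2 * (e * real (len J))\<^sup>2 / S)"
    unfolding S_def by (rule H.Hoeffding_ineq_abs_ge) (use e S_pos in \<open>auto simp: S_def\<close>)
  ultimately show ?thesis unfolding E by linarith
qed

text \<open>The exceptional probabilities are geometric in J, and e runs through 1 / (k + 1).
  Summands of linear growth cover both the block sums of a bounded function and the information of a
  block.\<close>

lemma block_slln:
  fixes Y :: "nat \<Rightarrow> 'a \<Rightarrow> real"
  assumes \<mu>: "prob_space \<mu>" and Y: "\<And>j. Y j \<in> borel_measurable \<mu>"
    and C: "C > 0" "\<And>j x. x \<in> space \<mu> \<Longrightarrow> \<bar>Y j x\<bar> \<le> C * real (Suc j)"
  shows "AE \<Omega> in PiM UNIV (\<lambda>_. \<mu>).
    (\<lambda>J. ((\<Sum>j<J. Y j (\<Omega> j)) - (\<Sum>j<J. integral\<^sup>L \<mu> (Y j))) / real (len J)) \<longlonglongrightarrow> 0"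
proof -
  let ?P = "PiM UNIV (\<lambda>_::nat. \<mu>)"
  interpret P: prob_space ?P by (rule prob_space_PiM) (rule \<mu>)
  note Y [measurable]
  define A where "A e J = {\<Omega> \<in> space ?P. \<bar>(\<Sum>j<J. Y j (\<Omega> j)) - (\<Sum>j<J. integral\<^sup>L \<mu> (Y j))\<bar> \<ge> e * real (len J)}" for e J
  have "AE \<Omega> in ?P. eventually (\<lambda>J. \<Omega> \<in> space ?P - A e J) sequentially" if e: "e > 0" for e
  proof (rule borel_cantelli_AE1)
    show "A e J \<in> sets ?P" for J unfolding A_def by measurable
    show "emeasure ?P (A e J) < \<infinity>" for J by (simp add: P.emeasure_eq_measure)
    show "summable (\<lambda>J. P.prob (A e J))"
    proof (rule summable_comparison_test)
      show "\<exists>N. \<forall>J\<ge>N. norm (P.prob (A e J)) \<le> 2 * exp (- (e\<^sup>2 / (8 * C\<^sup>2))) ^ J"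
        unfolding A_def using hoeffding_blocks[OF \<mu> Y C e] by simp
      show "summable (\<lambda>J. 2 * exp (- (e\<^sup>2 / (8 * C\<^sup>2))) ^ J)"
        using e C by (intro summable_mult summable_geometric) simp
    qed
  qed
  then have "AE \<Omega> in ?P. \<forall>k. eventually (\<lambda>J. \<Omega> \<in> space ?P - A (inverse (real (Suc k))) J) sequentially"
    by (subst AE_all_countable) simp
  then show ?thesis
  proof eventually_elim
    case (elim \<Omega>)
    show ?case
    proof (rule LIMSEQ_I)
      fix e :: real assume "e > 0"
      then obtain k where k: "inverse (real (Suc k)) < e" using reals_Archimedean by blast
      obtain N where N: "\<And>J. J \<ge> N \<Longrightarrow> \<Omega> \<in> space ?P - A (inverse (real (Suc k))) J"
        using elim unfolding eventually_sequentially by blast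
      have "norm (((\<Sum>j<J. Y j (\<Omega> j)) - (\<Sum>j<J. integral\<^sup>L \<mu> (Y j))) / real (len J) - 0) < e" if J: "J \<ge> Suc N" for J
      proof -
        have lJ: "real (len J) > 0" using len_ge[of J] J by auto
        have "\<bar>(\<Sum>j<J. Y j (\<Omega> j)) - (\<Sum>j<J. integral\<^sup>L \<mu> (Y j))\<bar> < inverse (real (Suc k)) * real (len J)"
          using N[of J] J unfolding A_def by auto
        also have "\<dots> < e * real (len J)" using k lJ by (intro mult_strict_right_mono)
        finally show ?thesis using lJ by (simp add: abs_divide divide_simps)
      qed
      then show "\<exists>no. \<forall>J\<ge>no. norm (((\<Sum>j<J. Y j (\<Omega> j)) - (\<Sum>j<J. integral\<^sup>L \<mu> (Y j))) / real (len J) - 0) < e" by blast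
    qed
  qed
qed

lemma pre_block: "pre (Suc J) ((shift ^^ len J) (cat \<Omega>)) = pre (Suc J) (\<Omega> J)"
  using cat_block[of _ J \<Omega>] by (simp add: pre_eq_iff shift_funpow add.commute)

lemma pre_len_cat_eq_iff:
  fixes \<Omega> \<Omega>' :: "nat \<Rightarrow> nat \<Rightarrow> nat"
  shows "pre (len J) (cat \<Omega>) = pre (len J) (cat \<Omega>') \<longleftrightarrow> (\<forall>j<J. pre (Suc j) (\<Omega> j) = pre (Suc j) (\<Omega>' j))"
proof (induction J)
  case (Suc J)
  have split: "pre (len (Suc J)) (cat Z) = pre (len J) (cat Z) @ pre (Suc J) (Z J)" for Z :: "nat \<Rightarrow> nat \<Rightarrow> nat"
    using pre_block[of J Z] unfolding len_Suc pre_add by (simp add: shift_funpow)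
  show ?case using Suc unfolding split by (auto simp: less_Suc_eq)
qed simp

lemma bsum_cat: "bsum F (len J) (cat \<Omega>) = (\<Sum>j<J. bsum F (Suc j) ((shift ^^ len j) (cat \<Omega>)))"
  by (induction J) (auto simp: len_Suc bsum_add simp del: add_Suc_right)

lemma cat_full_shift: "(\<And>j. \<Omega> j \<in> full_shift m) \<Longrightarrow> cat \<Omega> \<in> full_shift m"
  by (simp add: full_shift_def cat_def)

lemma bsum_abs_le:
  assumes "\<And>\<omega>. \<omega> \<in> full_shift m \<Longrightarrow> \<bar>F \<omega>\<bar> \<le> K" "\<omega> \<in> full_shift m"
  shows "\<bar>bsum F n \<omega>\<bar> \<le> real n * K"
proof -
  have "\<bar>bsum F n \<omega>\<bar> \<le> (\<Sum>i<n. K)"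
    unfolding bsum_def using assms full_shift_funpow by (intro order_trans[OF sum_abs] sum_mono) blast
  then show ?thesis by simp
qed

context shift_invariant
begin

lemma measurable_bsum:
  assumes "cyl_cont m F" shows "bsum F n \<in> borel_measurable \<mu>"
proof -
  have "F \<in> borel_measurable \<mu>"
    using cyl_cont_measurable[OF assms m_ge_1] by (simp add: measurable_cong_sets[OF sets_mu refl])
  then show ?thesis unfolding bsum_def
    by (intro borel_measurable_sum measurable_compose[OF measurable_mu_shift])
qed

lemma integral_bsum:
  assumes F: "cyl_cont m F" shows "integral\<^sup>L \<mu> (bsum F n) = real n * integral\<^sup>L \<mu> F"
proof -
  have Fm: "F \<in> borel_measurable \<mu>"
    using cyl_cont_measurable[OF F m_ge_1] by (simp add: measurable_cong_sets[OF sets_mu refl])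
  obtain K where K: "\<And>\<omega>. \<omega> \<in> full_shift m \<Longrightarrow> \<bar>F \<omega>\<bar> \<le> K" using cyl_cont_bounded[OF F m_ge_1] by blast
  have "integrable \<mu> (\<lambda>\<omega>. F ((shift ^^ i) \<omega>))" for i
    using K full_shift_funpow
    by (intro integrable_const_bound[of _ K] measurable_compose[OF measurable_mu_shift Fm]) auto
  then have "integral\<^sup>L \<mu> (bsum F n) = (\<Sum>i<n. integral\<^sup>L \<mu> (\<lambda>\<omega>. F ((shift ^^ i) \<omega>)))"
    unfolding bsum_def by (intro Bochner_Integration.integral_sum) auto
  then show ?thesis by (simp add: integral_shift[OF Fm])
qed

text \<open>By invariance the expected block sums add up to exactly \<open>len J\<close> times the
  integral, so the law of large numbers leaves only the error made at the ends of blocks.\<close>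

lemma cat_avg_blocks:
  assumes F: "cyl_cont m F"
  shows "AE \<Omega> in PiM UNIV (\<lambda>_. \<mu>). (\<lambda>J. bsum F (len J) (cat \<Omega>) / real (len J)) \<longlonglongrightarrow> integral\<^sup>L \<mu> F"
proof -
  obtain K where K: "K > 0" "\<And>\<omega>. \<omega> \<in> full_shift m \<Longrightarrow> \<bar>F \<omega>\<bar> \<le> K" using cyl_cont_bounded[OF F m_ge_1] by blast
  have bd: "\<bar>bsum F n \<omega>\<bar> \<le> real n * K" if "\<omega> \<in> full_shift m" for n \<omega>
    by (rule bsum_abs_le[OF K(2) that])
  have "AE \<Omega> in PiM UNIV (\<lambda>_. \<mu>). (\<lambda>J. ((\<Sum>j<J. bsum F (Suc j) (\<Omega> j)) - (\<Sum>j<J. integral\<^sup>L \<mu> (bsum F (Suc j)))) / real (len J)) \<longlonglongrightarrow> 0"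
  proof (rule block_slln[OF prob_space_axioms measurable_bsum[OF F] K(1)])
    show "\<bar>bsum F (Suc j) x\<bar> \<le> K * real (Suc j)" if "x \<in> space \<mu>" for j x
      using bd[of x "Suc j"] that by (simp only: space_mu mult.commute)
  qed
  moreover have "AE \<Omega> in PiM UNIV (\<lambda>_::nat. \<mu>). \<Omega> \<in> space (PiM UNIV (\<lambda>_::nat. \<mu>))" by (rule AE_space)
  ultimately show ?thesis
  proof eventually_elim
    case (elim \<Omega>)
    have \<Omega>: "\<Omega> j \<in> full_shift m" for j using elim(2) by (auto simp: space_PiM)
    \<comment> \<open>Inside block j the concatenation agrees with \<open>\<Omega> j\<close> for j +
      1 symbols and no further, so the two sums of length j + 1 differ by o(j).\<close>
    define c where "c j = bsum F (Suc j) ((shift ^^ len j) (cat \<Omega>)) - bsum F (Suc j) (\<Omega> j)" for j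
    have sh: "(shift ^^ len j) (cat \<Omega>) \<in> full_shift m" for j
      by (intro full_shift_funpow cat_full_shift \<Omega>)
    have "(\<lambda>J. (\<Sum>j<J. c j) / real (len J)) \<longlonglongrightarrow> 0"
    proof (rule weighted_sum_tendsto_0[of _ "2 * K"])
      show "\<bar>c j\<bar> \<le> real (Suc j) * (2 * K)" for j
        using bd[OF sh, of "Suc j" j] bd[OF \<Omega>, of "Suc j" j] unfolding c_def by (simp add: algebra_simps)
      fix e :: real assume "e > 0"
      then obtain N where N: "\<And>n \<omega> \<omega>'. n \<ge> N \<Longrightarrow> \<omega> \<in> full_shift m \<Longrightarrow> \<omega>' \<in> full_shift m \<Longrightarrow> pre n \<omega> = pre n \<omega>' \<Longrightarrow>
         \<bar>bsum F n \<omega> - bsum F n \<omega>'\<bar> \<le> real n * e" using bsum_variation[OF F m_ge_1] by metis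
      have "\<bar>c j\<bar> \<le> real (Suc j) * e" if "j \<ge> N" for j
        unfolding c_def by (rule N[OF _ sh \<Omega> pre_block]) (use that in simp)
      then show "\<exists>N. \<forall>j\<ge>N. \<bar>c j\<bar> \<le> real (Suc j) * e" by blast
    qed (use K in simp)
    then have "(\<lambda>J. (\<Sum>j<J. c j) / real (len J) +
        ((\<Sum>j<J. bsum F (Suc j) (\<Omega> j)) - (\<Sum>j<J. integral\<^sup>L \<mu> (bsum F (Suc j)))) / real (len J) + integral\<^sup>L \<mu> F) \<longlonglongrightarrow> 0 + 0 + integral\<^sup>L \<mu> F"
      using elim(1) by (intro tendsto_add tendsto_const)
    moreover have "eventually (\<lambda>J. (\<Sum>j<J. c j) / real (len J) +
        ((\<Sum>j<J. bsum F (Suc j) (\<Omega> j)) - (\<Sum>j<J. integral\<^sup>L \<mu> (bsum F (Suc j)))) / real (len J) + integral\<^sup>L \<mu> F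
        = bsum F (len J) (cat \<Omega>) / real (len J)) sequentially"
      using eventually_gt_at_top[of 0]
    proof eventually_elim
      case (elim J)
      then have "real (len J) \<noteq> 0" using len_ge[of J] by auto
      moreover have "(\<Sum>j<J. integral\<^sup>L \<mu> (bsum F (Suc j))) = real (len J) * integral\<^sup>L \<mu> F"
        unfolding integral_bsum[OF F] len_def of_nat_sum by (rule sum_distrib_right[symmetric])
      moreover have "(\<Sum>j<J. c j) = bsum F (len J) (cat \<Omega>) - (\<Sum>j<J. bsum F (Suc j) (\<Omega> j))"
        unfolding c_def bsum_cat by (rule sum_subtractf)
      ultimately show ?case by (simp add: field_simps)
    qed
    ultimately show ?case using Lim_transform_eventually by fastforce
  qed
qed

text \<open>A time n exceeds the last block end \<open>len J\<close> by at most J, and these symbols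
  contribute o(\<open>len J\<close>).\<close>

lemma bsum_over_n_interpolate:
  assumes K: "\<And>\<omega>. \<omega> \<in> full_shift m \<Longrightarrow> \<bar>F \<omega>\<bar> \<le> K" "K \<ge> 0" and \<omega>: "\<omega> \<in> full_shift m"
    and lim: "(\<lambda>J. bsum F (len J) \<omega> / real (len J)) \<longlonglongrightarrow> a"
  shows "(\<lambda>n. birkhoff_avg F n \<omega>) \<longlonglongrightarrow> a"
proof -
  \<comment> \<open>The error at the last block end plus the largest possible contribution of an
    incomplete block, both per symbol.\<close>
  define u where "u J = \<bar>bsum F (len J) \<omega> / real (len J) - a\<bar> + (K + \<bar>a\<bar>) * (real (Suc J) / real (len J))" for J
  have "u \<longlonglongrightarrow> \<bar>a - a\<bar> + (K + \<bar>a\<bar>) * 0"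
    unfolding u_def by (intro tendsto_add tendsto_rabs tendsto_diff tendsto_mult tendsto_const lim Suc_over_len)
  then have "(\<lambda>n. u (blk n)) \<longlonglongrightarrow> 0" using filterlim_compose[OF _ blk_at_top] by auto
  moreover have "eventually (\<lambda>n. norm (birkhoff_avg F n \<omega> - a) \<le> u (blk n)) sequentially"
    using eventually_ge_at_top[of 1]
  proof eventually_elim
    case (elim n)
    define J where "J = blk n"
    have J: "len J \<le> n" "n < len J + Suc J" using blk_bounds[of n] by (auto simp: J_def len_Suc)
    have "J \<noteq> 0" using J elim by (cases J) auto
    then have lJ: "real (len J) > 0" using len_ge[of J] by auto
    obtain k where k: "n = len J + k" "k < Suc J" using J by (metis add_less_cancel_left le_Suc_ex)
    have "bsum F n \<omega> - real n * a = (bsum F (len J) \<omega> - real (len J) * a) + (bsum F k ((shift ^^ len J) \<omega>) - real k * a)"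
      unfolding k(1) bsum_add by (simp add: algebra_simps)
    moreover have "\<bar>bsum F k ((shift ^^ len J) \<omega>)\<bar> \<le> real k * K"
      by (rule bsum_abs_le[OF K(1) full_shift_funpow[OF \<omega>]])
    moreover have "\<bar>real k * a\<bar> = real k * \<bar>a\<bar>" by (simp add: abs_mult)
    ultimately have "\<bar>bsum F n \<omega> - real n * a\<bar> \<le> \<bar>bsum F (len J) \<omega> - real (len J) * a\<bar> + real k * (K + \<bar>a\<bar>)"
      by (simp add: algebra_simps)
    also have "real k * (K + \<bar>a\<bar>) \<le> real (Suc J) * (K + \<bar>a\<bar>)" using k K(2) by (intro mult_right_mono) auto
    also have "\<bar>bsum F (len J) \<omega> - real (len J) * a\<bar> + real (Suc J) * (K + \<bar>a\<bar>) = real (len J) * u J"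
    proof -
      have "real (len J) * \<bar>bsum F (len J) \<omega> / real (len J) - a\<bar> = \<bar>real (len J) * (bsum F (len J) \<omega> / real (len J) - a)\<bar>"
        by (simp add: abs_mult)
      also have "real (len J) * (bsum F (len J) \<omega> / real (len J) - a) = bsum F (len J) \<omega> - real (len J) * a"
        using lJ by (simp add: field_simps)
      finally have "real (len J) * \<bar>bsum F (len J) \<omega> / real (len J) - a\<bar> = \<bar>bsum F (len J) \<omega> - real (len J) * a\<bar>" .
      moreover have "real (len J) * ((K + \<bar>a\<bar>) * (real (Suc J) / real (len J))) = real (Suc J) * (K + \<bar>a\<bar>)"
        using lJ by simp
      ultimately show ?thesis unfolding u_def distrib_left[of "real (len J)"] by linarith
    qed
    also have "real (len J) * u J \<le> real n * u J"
      using J(1) K(2) unfolding u_def by (intro mult_right_mono add_nonneg_nonneg mult_nonneg_nonneg) auto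
    finally have "\<bar>bsum F n \<omega> - real n * a\<bar> \<le> real n * u J" by simp
    moreover have "birkhoff_avg F n \<omega> - a = (bsum F n \<omega> - real n * a) / real n"
      using elim by (simp add: birkhoff_avg_bsum field_simps)
    ultimately show ?case using elim by (simp add: J_def abs_divide divide_le_eq mult.commute)
  qed
  ultimately have "(\<lambda>n. birkhoff_avg F n \<omega> - a) \<longlonglongrightarrow> 0" by (rule Lim_null_comparison[rotated])
  then show ?thesis by (rule LIM_zero_cancel)
qed

lemma cat_avg:
  assumes F: "cyl_cont m F"
  shows "AE \<Omega> in PiM UNIV (\<lambda>_. \<mu>). (\<lambda>n. birkhoff_avg F n (cat \<Omega>)) \<longlonglongrightarrow> integral\<^sup>L \<mu> F"
proof -
  obtain K where K: "K > 0" "\<And>\<omega>. \<omega> \<in> full_shift m \<Longrightarrow> \<bar>F \<omega>\<bar> \<le> K" using cyl_cont_bounded[OF F m_ge_1] by blast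
  have "AE \<Omega> in PiM UNIV (\<lambda>_::nat. \<mu>). \<Omega> \<in> space (PiM UNIV (\<lambda>_::nat. \<mu>))" by (rule AE_space)
  with cat_avg_blocks[OF F] show ?thesis
  proof eventually_elim
    case (elim \<Omega>)
    have "cat \<Omega> \<in> full_shift m" using elim(2) by (intro cat_full_shift) (auto simp: space_PiM)
    then show ?case using K by (intro bsum_over_n_interpolate[OF K(2) _ _ elim(1)]) auto
  qed
qed

end

subsection \<open>The lower bound\<close>

context shift_invariant
begin

text \<open>The summand \<open>1 / m ^ n\<close> keeps the information function bounded by a multiple of \<open>n\<close>, as
  Hoeffding's inequality requires, and lowers its mean by at most 1.\<close>

definition info :: "nat \<Rightarrow> (nat \<Rightarrow> nat) \<Rightarrow> real" where
  "info n x = - ln (prob {\<omega> \<in> full_shift m. pre n \<omega> = pre n x} + 1 / real m ^ n)"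

lemma cyl_cont_info: "cyl_cont m (info n)"
  unfolding cyl_cont_def by (intro allI impI exI[of _ n]) (simp add: info_def)

lemma info_bound:
  assumes "n \<ge> 1" shows "\<bar>info n x\<bar> \<le> (1 + ln (real m)) * real n"
proof -
  define p where "p = prob {\<omega> \<in> full_shift m. pre n \<omega> = pre n x}"
  have p: "0 \<le> p" "p \<le> 1" by (simp_all add: p_def)
  have mn: "real m ^ n \<ge> 1" using m_ge_1 by (intro one_le_power) auto
  then have mn0: "1 / real m ^ n > 0" "1 / real m ^ n \<le> 1" using order_less_le_trans[OF zero_less_one mn] by simp_all
  have pe: "p + 1 / real m ^ n \<le> 2" "p + 1 / real m ^ n > 0" using p mn0 by linarith+
  have "ln (p + 1 / real m ^ n) \<le> ln 2" using pe by simp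
  also have "ln 2 \<le> (1::real)" using ln_le_minus_one[of 2] by simp
  finally have 1: "- info n x \<le> 1" by (simp add: info_def p_def)
  have "ln (1 / real m ^ n) \<le> ln (p + 1 / real m ^ n)" using p mn0 pe by (subst ln_le_cancel_iff) linarith+
  moreover have "ln (1 / real m ^ n) = - (real n * ln (real m))"
    using m_ge_1 by (simp add: ln_div ln_realpow)
  ultimately have 2: "info n x \<le> real n * ln (real m)" by (simp add: info_def p_def)
  have "ln (real m) \<ge> 0" using m_ge_1 by simp
  then have 3: "real n * ln (real m) \<ge> 0" by simp
  have 4: "(1 + ln (real m)) * real n = real n + real n * ln (real m)" by (simp add: algebra_simps)
  have "real n \<ge> 1" using assms by simp
  then show ?thesis unfolding 4 abs_le_iff using 1 2 3 by linarith
qed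

text \<open>With \<eta> = 1 / m^n, replacing -p ln p by -p ln(p + \<eta>) costs p ln(1 + \<eta>/p)
  \<le> \<eta> for each word, and there are m^n words.\<close>

lemma integral_info: "integral\<^sup>L \<mu> (info n) \<ge> rv_ent \<mu> (pre n) - 1"
proof -
  define p where "p v = prob {\<omega> \<in> full_shift m. pre n \<omega> = v}" for v
  define \<eta> where "\<eta> = 1 / real m ^ n"
  have \<eta>: "\<eta> > 0" using m_ge_1 by (simp add: \<eta>_def)
  have "\<bar>integral\<^sup>L \<mu> (info n) - (\<Sum>v\<in>words m n. p v * info n (ext v))\<bar> \<le> 0"
    unfolding p_def by (rule integral_cyl[OF cyl_cont_info]) (simp add: info_def)
  then have "integral\<^sup>L \<mu> (info n) = (\<Sum>v\<in>words m n. p v * info n (ext v))" by simp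
  also have "\<dots> = (\<Sum>v\<in>words m n. p v * - ln (p v + \<eta>))"
    by (intro sum.cong refl) (simp add: info_def p_def \<eta>_def pre_ext words_def)
  also have "\<dots> \<ge> (\<Sum>v\<in>words m n. ent_fun (p v) - \<eta>)"
  proof (rule sum_mono)
    fix v
    show "ent_fun (p v) - \<eta> \<le> p v * - ln (p v + \<eta>)"
    proof (cases "p v > 0")
      case True
      have "ln ((p v + \<eta>) / p v) \<le> (p v + \<eta>) / p v - 1"
        using True \<eta> by (intro ln_le_minus_one) auto
      also have "\<dots> = \<eta> / p v" using True by (simp add: field_simps)
      finally have m1: "p v * ln ((p v + \<eta>) / p v) \<le> p v * (\<eta> / p v)" using True by (intro mult_left_mono) auto
      have m2: "ln ((p v + \<eta>) / p v) = ln (p v + \<eta>) - ln (p v)" using True \<eta> by (simp add: ln_div)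
      have "p v * (ln (p v + \<eta>) - ln (p v)) \<le> p v * (\<eta> / p v)" using m1 unfolding m2 .
      then show ?thesis using True by (simp add: ent_fun_pos algebra_simps)
    next
      case False
      then have "p v = 0" using measure_nonneg[of \<mu>] by (simp add: p_def not_less measure_le_0_iff)
      then show ?thesis using \<eta> by simp
    qed
  qed
  moreover have "(\<Sum>v\<in>words m n. ent_fun (p v) - \<eta>) = rv_ent \<mu> (pre n) - 1"
    using m_ge_1 by (simp add: sum_subtractf rv_ent_pre p_def card_words \<eta>_def)
  ultimately show ?thesis by simp
qed

text \<open>The entropy of the shift bounds the mean information of each block from below up to a
  loss of 1, so J blocks have mean at least h \<open>len J\<close> - J, and J is negligible against
  \<open>len J\<close>.\<close>

lemma info_blocks:
  assumes a: "a < ks_entropy \<mu> shift"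
  shows "AE \<Omega> in PiM UNIV (\<lambda>_. \<mu>). eventually (\<lambda>J. a * real (len J) \<le> (\<Sum>j<J. info (Suc j) (\<Omega> j))) sequentially"
proof -
  define h where "h = ks_entropy \<mu> shift"
  have meas: "info n \<in> borel_measurable \<mu>" for n
    using cyl_cont_measurable[OF cyl_cont_info m_ge_1] by (simp add: measurable_cong_sets[OF sets_mu refl])
  have C: "1 + ln (real m) > 0" using m_ge_1 by (simp add: add_pos_nonneg)
  have low: "(\<Sum>j<J. integral\<^sup>L \<mu> (info (Suc j))) \<ge> h * real (len J) - real J" for J
  proof -
    have "(\<Sum>j<J. h * real (Suc j) - 1) \<le> (\<Sum>j<J. integral\<^sup>L \<mu> (info (Suc j)))"
    proof (rule sum_mono)
      fix j
      have "h \<le> rv_ent \<mu> (pre (Suc j)) / real (Suc j)" unfolding h_def by (rule ks_entropy_le) simp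
      then have "h * real (Suc j) \<le> rv_ent \<mu> (pre (Suc j))" by (simp add: pos_le_divide_eq del: of_nat_Suc)
      then show "h * real (Suc j) - 1 \<le> integral\<^sup>L \<mu> (info (Suc j))" using integral_info[of "Suc j"] by linarith
    qed
    moreover have "(\<Sum>j<J. h * real (Suc j) - 1) = h * real (len J) - real J"
      unfolding len_def of_nat_sum sum_distrib_left by (simp add: sum_subtractf)
    ultimately show ?thesis by linarith
  qed
  have "AE \<Omega> in PiM UNIV (\<lambda>_. \<mu>). (\<lambda>J. ((\<Sum>j<J. info (Suc j) (\<Omega> j)) - (\<Sum>j<J. integral\<^sup>L \<mu> (info (Suc j)))) / real (len J)) \<longlonglongrightarrow> 0"
    by (rule block_slln[OF prob_space_axioms meas C]) (rule info_bound, simp)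
  then show ?thesis
  proof eventually_elim
    case (elim \<Omega>)
    \<comment> \<open>Half of the gap h - a absorbs the fluctuation, the other half the loss
      J.\<close>
    define d where "d = (h - a) / 2"
    have d: "d > 0" using a by (simp add: d_def h_def)
    have "eventually (\<lambda>J. ((\<Sum>j<J. info (Suc j) (\<Omega> j)) - (\<Sum>j<J. integral\<^sup>L \<mu> (info (Suc j)))) / real (len J) > - d) sequentially"
      using d by (intro order_tendstoD(1)[OF elim]) simp
    moreover have "eventually (\<lambda>J. real (Suc J) / real (len J) < d) sequentially"
      by (rule order_tendstoD(2)[OF Suc_over_len d])
    ultimately show ?case using eventually_gt_at_top[of 0]
    proof eventually_elim
      case (elim J)
      have lJ: "real (len J) > 0" using len_ge[of J] elim(3) by auto
      have "- d * real (len J) < (\<Sum>j<J. info (Suc j) (\<Omega> j)) - (\<Sum>j<J. integral\<^sup>L \<mu> (info (Suc j)))"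
        using elim(1) lJ by (simp add: pos_less_divide_eq)
      moreover have "real J \<le> d * real (len J)" using elim(2) lJ by (simp add: pos_divide_less_eq)
      moreover have "a * real (len J) = h * real (len J) - d * real (len J) - d * real (len J)"
        by (simp add: d_def field_simps)
      ultimately show ?case using low[of J] by linarith
    qed
  qed
qed

text \<open>Fixing the first J blocks is a product event, and each factor is at most
  \<open>prob\<close> plus 1 / m^(j+1), which is exp(-\<open>info\<close>).\<close>

lemma cat_cylinder_mass:
  assumes \<Omega>0: "\<Omega>0 \<in> space (PiM UNIV (\<lambda>_::nat. \<mu>))"
  shows "measure (PiM UNIV (\<lambda>_. \<mu>)) {\<Omega> \<in> space (PiM UNIV (\<lambda>_. \<mu>)). pre (len J) (cat \<Omega>) = pre (len J) (cat \<Omega>0)}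
     \<le> exp (- (\<Sum>j<J. info (Suc j) (\<Omega>0 j)))"
proof -
  let ?P = "PiM UNIV (\<lambda>_::nat. \<mu>)"
  let ?C = "\<lambda>j. {\<omega> \<in> full_shift m. pre (Suc j) \<omega> = pre (Suc j) (\<Omega>0 j)}"
  interpret PP: product_prob_space "\<lambda>_::nat. \<mu>" UNIV
    by unfold_locales
  have "{\<Omega> \<in> space ?P. pre (len J) (cat \<Omega>) = pre (len J) (cat \<Omega>0)} = {\<Omega> \<in> space ?P. \<forall>j\<in>{..<J}. \<Omega> j \<in> ?C j}"
    unfolding pre_len_cat_eq_iff by (auto simp: space_PiM)
  then have "emeasure ?P {\<Omega> \<in> space ?P. pre (len J) (cat \<Omega>) = pre (len J) (cat \<Omega>0)} = (\<Prod>j<J. emeasure \<mu> (?C j))"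
    using PP.emeasure_PiM_Collect[of "{..<J}" ?C] cylinder_sets_mu by simp
  also have "\<dots> = ennreal (\<Prod>j<J. prob (?C j))" by (simp add: emeasure_eq_measure prod_ennreal)
  finally have "measure ?P {\<Omega> \<in> space ?P. pre (len J) (cat \<Omega>) = pre (len J) (cat \<Omega>0)} = (\<Prod>j<J. prob (?C j))"
    by (simp add: measure_def prod_nonneg)
  also have "\<dots> \<le> (\<Prod>j<J. exp (- info (Suc j) (\<Omega>0 j)))"
  proof (rule prod_mono)
    fix j
    have "1 / real m ^ Suc j > 0" using m_ge_1 by simp
    then have "prob (?C j) + 1 / real m ^ Suc j > 0" using measure_nonneg[of \<mu> "?C j"] by linarith
    then have "exp (- info (Suc j) (\<Omega>0 j)) = prob (?C j) + 1 / real m ^ Suc j" by (simp add: info_def)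
    then show "0 \<le> prob (?C j) \<and> prob (?C j) \<le> exp (- info (Suc j) (\<Omega>0 j))"
      using \<open>1 / real m ^ Suc j > 0\<close> by simp
  qed
  also have "\<dots> = exp (- (\<Sum>j<J. info (Suc j) (\<Omega>0 j)))" by (simp add: exp_sum sum_negf[symmetric])
  finally show ?thesis .
qed

lemma measurable_pre_cat: "(\<lambda>\<Omega>. pre n (cat \<Omega>)) \<in> measurable (PiM UNIV (\<lambda>_::nat. \<mu>)) (count_space UNIV)"
proof -
  have c: "(\<lambda>\<Omega>. \<Omega> j k) \<in> measurable (PiM UNIV (\<lambda>_::nat. \<mu>)) (count_space {1..m})" for j k
  proof -
    have "(\<lambda>\<omega>. \<omega> k) \<in> measurable \<mu> (count_space {1..m})"
      unfolding measurable_cong_sets[OF sets_mu refl] shift_space_def by measurable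
    then show ?thesis by (rule measurable_compose[OF measurable_component_singleton[OF UNIV_I]])
  qed
  have "cat \<in> measurable (PiM UNIV (\<lambda>_::nat. \<mu>)) (shift_space m)"
    unfolding shift_space_def cat_def[abs_def]
    by (rule measurable_PiM_single'[OF c]) (auto simp: space_PiM full_shift_def PiE_def Pi_def)
  then show ?thesis by (rule measurable_compose) (rule measurable_pre)
qed

end

section \<open>From block statistics to Hausdorff measure\<close>

context interval_ifs
begin

text \<open>The least J with exp(-b \<open>len (Suc J)\<close>) < r works: minimality gives the
  upper estimate, and the assumed bound on r rules out J < N.\<close>

lemma interval_scale:
  assumes b: "b > 0" and r: "0 < r" "r \<le> exp (- b * real (len N))"
  shows "\<exists>J\<ge>N. exp (- b * real (len (Suc J))) < r \<and> r \<le> exp (- b * real (len J))"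
proof -
  define Bad where "Bad = (\<lambda>J. exp (- b * real (len (Suc J))) < r)"
  obtain M :: nat where M: "real M > - ln r / b" using reals_Archimedean2 by blast
  have "real (len (Suc M)) > - ln r / b" using M len_ge[of "Suc M"] by linarith
  then have "- b * real (len (Suc M)) < ln r" using b by (simp add: field_simps)
  then have "Bad M" unfolding Bad_def using r by (metis exp_less_mono exp_ln)
  then have B: "Bad (LEAST J. Bad J)" by (rule LeastI)
  define J where "J = (LEAST J. Bad J)"
  have BJ: "exp (- b * real (len (Suc J))) < r" using B unfolding J_def[symmetric] by (simp only: Bad_def)
  have le: "r \<le> exp (- b * real (len J))"
  proof (cases J)
    case 0
    have "exp (- b * real (len N)) \<le> 1" using b by simp
    then have "r \<le> 1" using r(2) by linarith
    then show ?thesis by (simp add: 0)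
  next
    case (Suc K)
    then have "\<not> Bad K" using not_less_Least[of K Bad] by (simp add: J_def)
    then show ?thesis using Suc by (simp add: Bad_def)
  qed
  show ?thesis
  proof (cases "J \<ge> N")
    case True
    then show ?thesis using BJ le by blast
  next
    case False
    then have "len (Suc J) \<le> len N" by (intro len_mono) auto
    then have "exp (- b * real (len N)) \<le> exp (- b * real (len (Suc J)))" using b by simp
    then show ?thesis using BJ r by linarith
  qed
qed

text \<open>Cylinders of generation \<open>len J\<close> of points in G have length at least r, so U
  meets at most five of them, each of mass at most exp(-a \<open>len J\<close>). The hypothesis
  \<open>scale\<close> turns this into r^s although r is only known to exceed the scale of the next
  generation.\<close>

lemma mass_of_small_set:
  assumes \<mu>: "shift_invariant \<mu> m" and a: "a > 0" and b: "b > 0" and s: "s > 0"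
    and scale: "s * b * real (len (Suc J)) \<le> a * real (len J)"
    and G: "G \<subseteq> space (PiM UNIV (\<lambda>_::nat. \<mu>))"
      "\<And>\<Omega>. \<Omega> \<in> G \<Longrightarrow> a * real (len J) \<le> (\<Sum>j<J. shift_invariant.info \<mu> m (Suc j) (\<Omega> j))"
      "\<And>\<Omega>. \<Omega> \<in> G \<Longrightarrow> exp (- b * real (len J)) \<le> word_len T (pre (len J) (cat \<Omega>))"
    and U: "bounded U" "diameter U \<le> r" "0 < r"
    and r: "exp (- b * real (len (Suc J))) < r" "r \<le> exp (- b * real (len J))"
  shows "\<exists>B\<in>sets (PiM UNIV (\<lambda>_::nat. \<mu>)). {\<Omega> \<in> G. coding T (cat \<Omega>) \<in> U} \<subseteq> B \<and>
     measure (PiM UNIV (\<lambda>_. \<mu>)) B \<le> 5 * r powr s"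
proof -
  interpret shift_invariant \<mu> m by fact
  let ?P = "PiM UNIV (\<lambda>_::nat. \<mu>)"
  interpret P: prob_space ?P by (rule prob_space_PiM) (rule prob_space_axioms)
  define G' where "G' = {\<Omega> \<in> G. coding T (cat \<Omega>) \<in> U}"
  define W where "W = (\<lambda>\<Omega>. pre (len J) (cat \<Omega>)) ` G'"
  have fs: "cat \<Omega> \<in> full_shift m" if "\<Omega> \<in> space ?P" for \<Omega>
    using that by (intro cat_full_shift) (auto simp: space_PiM)
  have Wsub: "W \<subseteq> words m (len J)"
    unfolding W_def G'_def using G(1) fs pre_in_words by blast
  then have finW: "finite W" using finite_words finite_subset by blast
  have cardW: "card W \<le> 5"
  proof (cases "G' = {}")
    case False
    then obtain \<Omega>1 where "\<Omega>1 \<in> G'" by blast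
    then have Une: "U \<noteq> {}" by (auto simp: G'_def)
    have bb: "bdd_below U" using U(1) by (rule bounded_imp_bdd_below)
    have near: "Inf U \<le> t \<and> t \<le> Inf U + r" if "t \<in> U" for t
    proof
      show "Inf U \<le> t" using that bb by (rule cInf_lower)
      have "t - r \<le> u" if "u \<in> U" for u
        using diameter_bounded_bound[OF U(1) \<open>t \<in> U\<close> that] U(2) by (simp add: dist_real_def)
      then have "t - r \<le> Inf U" by (intro cInf_greatest Une)
      then show "t \<le> Inf U + r" by simp
    qed
    show ?thesis
    proof (rule card_words_meeting[OF Wsub U(3), where a = "Inf U"])
      fix w assume "w \<in> W"
      then obtain \<Omega> where \<Omega>: "\<Omega> \<in> G" "coding T (cat \<Omega>) \<in> U" "w = pre (len J) (cat \<Omega>)"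
        by (auto simp: W_def G'_def)
      show "r \<le> word_len T w" using G(3)[OF \<Omega>(1)] r(2) \<Omega>(3) by simp
      have "cat \<Omega> \<in> full_shift m" using \<Omega>(1) G(1) fs by blast
      then show "\<exists>t. Inf U \<le> t \<and> t \<le> Inf U + r \<and> word_map T w 0 \<le> t \<and> t \<le> word_map T w 1"
        using near[OF \<Omega>(2)] coding_bounds[of "cat \<Omega>" "len J"] \<Omega>(3) by blast
    qed
  qed (simp add: W_def)
  define B where "B w = {\<Omega> \<in> space ?P. pre (len J) (cat \<Omega>) = w}" for w
  have Bs: "B w \<in> sets ?P" for w
    using measurable_sets[OF measurable_pre_cat[of "len J"], of "{w}"]
    by (simp add: B_def vimage_def Int_def conj_commute)
  have mB: "P.prob (B w) \<le> exp (- a * real (len J))" if w: "w \<in> W" for w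
  proof -
    obtain \<Omega> where \<Omega>: "\<Omega> \<in> G" "w = pre (len J) (cat \<Omega>)" using w by (auto simp: W_def G'_def)
    have "P.prob (B w) \<le> exp (- (\<Sum>j<J. info (Suc j) (\<Omega> j)))"
      unfolding B_def \<Omega>(2) by (rule cat_cylinder_mass) (use \<Omega>(1) G(1) in blast)
    also have "\<dots> \<le> exp (- a * real (len J))" using G(2)[OF \<Omega>(1)] by simp
    finally show ?thesis .
  qed
  have "P.prob (\<Union>w\<in>W. B w) \<le> (\<Sum>w\<in>W. P.prob (B w))"
    using finW Bs by (intro measure_UNION_le) auto
  also have "\<dots> \<le> (\<Sum>w\<in>W. exp (- a * real (len J)))" by (intro sum_mono mB)
  also have "\<dots> = real (card W) * exp (- a * real (len J))" by simp
  also have "\<dots> \<le> 5 * exp (- a * real (len J))" using cardW by (intro mult_right_mono) auto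
  also have "exp (- a * real (len J)) \<le> exp (- (s * b * real (len (Suc J))))" using scale by simp
  also have "\<dots> = exp (- b * real (len (Suc J))) powr s" by (simp add: powr_def mult_ac)
  also have "\<dots> \<le> r powr s" using r s by (intro powr_mono2) auto
  finally have "P.prob (\<Union>w\<in>W. B w) \<le> 5 * r powr s" by simp
  moreover have "(\<Union>w\<in>W. B w) \<in> sets ?P" using finW Bs by auto
  moreover have "{\<Omega> \<in> G. coding T (cat \<Omega>) \<in> U} \<subseteq> (\<Union>w\<in>W. B w)"
    using G(1) by (auto simp: W_def G'_def B_def)
  ultimately show ?thesis by blast
qed

theorem lower_bound:
  assumes f: "cyl_cont m f" and inv: "\<mu> \<in> invariant_measures m" and int_f: "integral\<^sup>L \<mu> f = \<alpha>"
    and int_g: "integral\<^sup>L \<mu> g > 0" and s: "s > 0"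
    and null: "hausdorff_measure s (coding T `
            ({\<omega> \<in> full_shift m. (\<lambda>n. birkhoff_avg f n \<omega>) \<longlonglongrightarrow> \<alpha>} \<inter>
             {\<omega> \<in> full_shift m. Liminf sequentially (\<lambda>n. ereal (birkhoff_avg g n \<omega>)) > 0})) = 0"
    (is "hausdorff_measure s (coding T ` ?E) = 0")
  shows "ks_entropy \<mu> shift / integral\<^sup>L \<mu> g \<le> s"
proof (rule ccontr)
  assume contra: "\<not> ?thesis"
  define h l where "h = ks_entropy \<mu> shift" and "l = integral\<^sup>L \<mu> g"
  have sl: "s * l < h" using contra int_g by (simp add: h_def l_def not_le pos_less_divide_eq)
  have l: "l > 0" using int_g by (simp add: l_def)
  \<comment> \<open>This choice gives a - s b = (h - s l) / 2, so raising the exponent and lowering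
    the entropy by e uses up half of the gap.\<close>
  define e where "e = (h - s * l) / (2 * (s + 1))"
  have e: "e > 0" using sl s by (simp add: e_def)
  define a b where "a = h - e" and "b = l + e"
  have "e * (2 * (s + 1)) = h - s * l" using s by (simp add: e_def)
  moreover have "e * (s + 1) > 0" using e s by simp
  ultimately have sb: "s * b < a" by (simp add: a_def b_def algebra_simps)
  have b: "b > 0" using l e by (simp add: b_def)
  then have a: "a > 0" using sb s by (smt (verit) mult_pos_pos)
  interpret shift_invariant \<mu> m by (rule shift_invariantI[OF inv m_pos])
  let ?P = "PiM UNIV (\<lambda>_::nat. \<mu>)"
  interpret P: prob_space ?P by (rule prob_space_PiM) (rule prob_space_axioms)
  define A where "A J \<Omega> \<longleftrightarrow> a * real (len J) \<le> (\<Sum>j<J. info (Suc j) (\<Omega> j)) \<and>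
     exp (- b * real (len J)) \<le> word_len T (pre (len J) (cat \<Omega>))" for J \<Omega>
  have Am: "{\<Omega> \<in> space ?P. A J \<Omega>} \<in> sets ?P" for J
  proof -
    have [measurable]: "info n \<in> borel_measurable \<mu>" for n
      using cyl_cont_measurable[OF cyl_cont_info m_ge_1] by (simp add: measurable_cong_sets[OF sets_mu refl])
    have [measurable]: "(\<lambda>\<Omega>. word_len T (pre (len J) (cat \<Omega>))) \<in> borel_measurable ?P"
      by (rule measurable_compose[OF measurable_pre_cat]) simp
    show ?thesis unfolding A_def by measurable
  qed
  have "AE \<Omega> in ?P. cat \<Omega> \<in> ?E \<and> eventually (\<lambda>J. A J \<Omega>) sequentially"
  proof -
    have "a < ks_entropy \<mu> shift" using e by (simp add: a_def h_def)
    note info_blocks[OF this]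
    moreover have "AE \<Omega> in ?P. \<Omega> \<in> space ?P" by (rule AE_space)
    moreover note cat_avg[OF f] cat_avg[OF cyl_cont_geom_pot] cat_avg_blocks[OF cyl_cont_geom_pot]
    ultimately show ?thesis
    proof eventually_elim
      case (elim \<Omega>)
      have fs: "cat \<Omega> \<in> full_shift m" using elim(2) by (intro cat_full_shift) (auto simp: space_PiM)
      have "(\<lambda>n. ereal (birkhoff_avg g n (cat \<Omega>))) \<longlonglongrightarrow> ereal l" using elim(4) by (simp add: l_def)
      then have "Liminf sequentially (\<lambda>n. ereal (birkhoff_avg g n (cat \<Omega>))) = ereal l"
        by (rule lim_imp_Liminf[rotated]) simp
      then have E: "cat \<Omega> \<in> ?E" using fs elim(3) l by (simp add: int_f)
      \<comment> \<open>Half of e is for the distortion, the other half for the convergence of the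
        averages of g.\<close>
      obtain N where N: "\<And>n \<omega>. n \<ge> N \<Longrightarrow> \<omega> \<in> full_shift m \<Longrightarrow> \<bar>- ln (word_len T (pre n \<omega>)) - bsum g n \<omega>\<bar> \<le> real n * (e/2)"
        using log_word_len_bsum[of "e/2"] e by auto
      have "eventually (\<lambda>J. bsum g (len J) (cat \<Omega>) / real (len J) < l + e/2) sequentially"
        using elim(5) e by (intro order_tendstoD(2)) (auto simp: l_def)
      then have "eventually (\<lambda>J. exp (- b * real (len J)) \<le> word_len T (pre (len J) (cat \<Omega>))) sequentially"
        using eventually_ge_at_top[of "Suc N"]
      proof eventually_elim
        case (elim J)
        have lJ: "real (len J) > 0" "len J \<ge> N" using len_ge[of J] elim(2) by auto
        have "bsum g (len J) (cat \<Omega>) < (l + e/2) * real (len J)" using elim(1) lJ by (simp add: pos_divide_less_eq)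
        moreover have "- ln (word_len T (pre (len J) (cat \<Omega>))) - bsum g (len J) (cat \<Omega>) \<le> real (len J) * (e/2)"
          using N[OF lJ(2) fs] by linarith
        ultimately have "- b * real (len J) \<le> ln (word_len T (pre (len J) (cat \<Omega>)))"
          by (simp add: b_def algebra_simps)
        then have "exp (- b * real (len J)) \<le> exp (ln (word_len T (pre (len J) (cat \<Omega>))))" by (subst exp_le_cancel_iff)
        then show ?case using word_len_pos[OF set_pre[OF fs]] by simp
      qed
      with elim(1) have "eventually (\<lambda>J. A J \<Omega>) sequentially"
        unfolding A_def by (rule eventually_conj)
      with E show ?case by blast
    qed
  qed
  then obtain Z where Z: "{\<Omega> \<in> space ?P. \<not> (cat \<Omega> \<in> ?E \<and> eventually (\<lambda>J. A J \<Omega>) sequentially)} \<subseteq> Z"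
    "emeasure ?P Z = 0" "Z \<in> sets ?P" by (rule AE_E)
  \<comment> \<open>On G N the mass and length estimates hold at every generation from N on, a
    uniformity that the mass distribution principle requires. Removing the null set Z makes all
    codes lie in the level set.\<close>
  define G where "G N = {\<Omega> \<in> space ?P. \<forall>J\<in>{N..}. A J \<Omega>} - Z" for N
  have Gs: "G N \<in> sets ?P" for N
    unfolding G_def using Am Z(3) by (intro sets.Diff sets.sets_Collect_countable_All') auto
  have "\<exists>N. P.prob (G N) > 0"
  proof (rule ccontr)
    assume "\<not> ?thesis"
    then have "emeasure ?P (G N) = 0" for N
      using measure_nonneg[of ?P "G N"] by (simp add: P.emeasure_eq_measure not_less measure_le_0_iff)
    then have "emeasure ?P (\<Union>N. G N) = 0" using Gs by (intro emeasure_UN_eq_0) auto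
    then have "emeasure ?P ((\<Union>N. G N) \<union> Z) = 0"
      using Z(2,3) Gs emeasure_Un_null_set[of "\<Union>N. G N" ?P Z] by (auto simp: null_sets_def)
    moreover have "space ?P \<subseteq> (\<Union>N. G N) \<union> Z"
    proof
      fix \<Omega> assume \<Omega>: "\<Omega> \<in> space ?P"
      show "\<Omega> \<in> (\<Union>N. G N) \<union> Z"
      proof (cases "\<Omega> \<in> Z")
        case False
        then have "eventually (\<lambda>J. A J \<Omega>) sequentially" using Z(1) \<Omega> by blast
        then obtain N where "\<forall>J\<ge>N. A J \<Omega>" unfolding eventually_sequentially by blast
        then have "\<Omega> \<in> G N" using \<Omega> False by (simp add: G_def)
        then show ?thesis by blast
      qed simp
    qed
    ultimately have "emeasure ?P (space ?P) \<le> 0"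
      using emeasure_mono[of "space ?P" "(\<Union>N. G N) \<union> Z" ?P] Gs Z(3) by auto
    then show False using P.emeasure_space_1 by simp
  qed
  then obtain N where N: "P.prob (G N) > 0" by blast
  \<comment> \<open>The bracket is the ratio of \<open>len (Suc J)\<close> to \<open>len J\<close>
    and tends to 1, so passing to the next generation does not exhaust the gap between s b and
    a.\<close>
  have "(\<lambda>J. s * b * (1 + real (Suc J) / real (len J))) \<longlonglongrightarrow> s * b * (1 + 0)"
    by (intro tendsto_intros Suc_over_len)
  then have "eventually (\<lambda>J. s * b * (1 + real (Suc J) / real (len J)) < a) sequentially"
    using sb by (intro order_tendstoD(2)) auto
  then obtain N' where N': "\<And>J. J \<ge> N' \<Longrightarrow> s * b * (1 + real (Suc J) / real (len J)) < a"
    unfolding eventually_sequentially by blast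
  define K where "K = Suc (N + N')"
  have scale: "s * b * real (len (Suc J)) \<le> a * real (len J)" if "J \<ge> K" for J
  proof -
    have lJ: "real (len J) > 0" using len_ge[of J] that by (auto simp: K_def)
    have "s * b * (1 + real (Suc J) / real (len J)) * real (len J) \<le> a * real (len J)"
      using N'[of J] that lJ by (intro mult_right_mono) (auto simp: K_def)
    moreover have "(1 + real (Suc J) / real (len J)) * real (len J) = real (len (Suc J))"
      using lJ by (simp add: len_Suc field_simps)
    ultimately show ?thesis by (simp add: mult.assoc)
  qed
  have "hausdorff_measure s (coding T ` ?E) \<noteq> 0"
  proof (rule mass_distribution[where Q = ?P and G = "G N" and x = "\<lambda>\<Omega>. coding T (cat \<Omega>)" and C = 5
        and d = "exp (- b * real (len K))"])
    fix U :: "real set" and r :: real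
    assume U: "bounded U" "diameter U \<le> r" "0 < r" and r: "r \<le> exp (- b * real (len K))"
    obtain J where J: "J \<ge> K" "exp (- b * real (len (Suc J))) < r" "r \<le> exp (- b * real (len J))"
      using interval_scale[OF b U(3) r] by blast
    have "A J \<Omega>" if "\<Omega> \<in> G N" for \<Omega> using that J(1) by (simp add: G_def K_def)
    then show "\<exists>B\<in>sets ?P. {\<Omega> \<in> G N. coding T (cat \<Omega>) \<in> U} \<subseteq> B \<and> P.prob B \<le> 5 * r powr s"
      by (intro mass_of_small_set[OF shift_invariantI[OF inv m_pos] a b s scale[OF J(1)] _ _ _ U J(2,3)])
        (auto simp: A_def G_def)
  next
    show "(\<lambda>\<Omega>. coding T (cat \<Omega>)) ` G N \<subseteq> coding T ` ?E"
      using Z(1) by (auto simp: G_def)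
  qed (use P.prob_space_axioms Gs N s in auto)
  then show False using null by simp
qed

end

subsection \<open>The dimension formula\<close>

theorem theorem1:
  fixes m :: nat and T DT :: "nat \<Rightarrow> real \<Rightarrow> real"
    and f :: "(nat \<Rightarrow> nat) \<Rightarrow> real" and \<alpha> :: real
  assumes m_pos: "m \<ge> 1"
    and maps: "\<And>i. i \<in> {1..m} \<Longrightarrow> T i ` {0..1} \<subseteq> {0..1}"
    and deriv: "\<And>i x. i \<in> {1..m} \<Longrightarrow> x \<in> {0..1} \<Longrightarrow>
                  (T i has_real_derivative DT i x) (at x within {0..1})"
    and deriv_cont: "\<And>i. i \<in> {1..m} \<Longrightarrow> continuous_on {0..1} (DT i)"
    and deriv_pos: "\<And>i x. i \<in> {1..m} \<Longrightarrow> x \<in> {0..1} \<Longrightarrow> DT i x > 0"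
    and disj: "\<And>i j. i \<in> {1..m} \<Longrightarrow> j \<in> {1..m} \<Longrightarrow> i \<noteq> j \<Longrightarrow>
                  T i ` {0<..<1} \<inter> T j ` {0<..<1} = {}"
    and contr: "\<forall>\<epsilon>>0. \<exists>N. \<forall>n\<ge>N. \<forall>\<omega>\<in>full_shift m.
                  diameter (compose_word T \<omega> n ` {0..1}) < \<epsilon>"
    and f_cont: "continuous_on (full_shift m) f"
    and \<alpha>_lo: "Inf ((\<lambda>\<mu>. integral\<^sup>L \<mu> f) ` ergodic_measures m) \<le> \<alpha>"
    and \<alpha>_hi: "\<alpha> \<le> Sup ((\<lambda>\<mu>. integral\<^sup>L \<mu> f) ` ergodic_measures m)"
  shows "ereal (hausdorff_dim (coding T `
            ({\<omega> \<in> full_shift m. (\<lambda>n. birkhoff_avg f n \<omega>) \<longlonglongrightarrow> \<alpha>} \<inter>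
             {\<omega> \<in> full_shift m. Liminf sequentially (\<lambda>n. ereal (birkhoff_avg (geom_pot T DT) n \<omega>)) > 0})))
       = Sup (insert 0 {ereal (ks_entropy \<mu> shift / integral\<^sup>L \<mu> (geom_pot T DT)) | \<mu>.
                \<mu> \<in> invariant_measures m \<and> integral\<^sup>L \<mu> f = \<alpha> \<and> integral\<^sup>L \<mu> (geom_pot T DT) > 0})"
proof -
  interpret interval_ifs m T DT
    by unfold_locales (fact m_pos maps deriv deriv_cont deriv_pos disj contr)+
  let ?E = "{\<omega> \<in> full_shift m. (\<lambda>n. birkhoff_avg f n \<omega>) \<longlonglongrightarrow> \<alpha>} \<inter>
      {\<omega> \<in> full_shift m. Liminf sequentially (\<lambda>n. ereal (birkhoff_avg (geom_pot T DT) n \<omega>)) > 0}"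
  let ?A = "{ereal (ks_entropy \<mu> shift / integral\<^sup>L \<mu> (geom_pot T DT)) | \<mu>.
      \<mu> \<in> invariant_measures m \<and> integral\<^sup>L \<mu> f = \<alpha> \<and> integral\<^sup>L \<mu> (geom_pot T DT) > 0}"
  have f: "cyl_cont m f" using f_cont by (rule continuous_imp_cyl_cont)
  \<comment> \<open>The value 0 stands for the supremum of an empty family, which occurs for
    instance when a single map has a neutral fixed point; exponents are positive, so 0 always lies
    below them.\<close>
  have low: "Sup (insert 0 ?A) \<le> ereal s" if "s > 0" "hausdorff_measure s (coding T ` ?E) = 0" for s
  proof (rule Sup_least)
    fix x assume "x \<in> insert 0 ?A"
    then consider "x = 0" | \<mu> where "x = ereal (ks_entropy \<mu> shift / integral\<^sup>L \<mu> (geom_pot T DT))"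
      "\<mu> \<in> invariant_measures m" "integral\<^sup>L \<mu> f = \<alpha>" "integral\<^sup>L \<mu> (geom_pot T DT) > 0" by blast
    then show "x \<le> ereal s"
    proof cases
      case 1
      then show ?thesis using that by simp
    next
      case 2
      then show ?thesis using lower_bound[OF f 2(2-4) that] by simp
    qed
  qed
  \<comment> \<open>The exponent 2 shows that the extended supremum is finite; being at least 0, it
    is a real number S.\<close>
  have "hausdorff_measure 2 (coding T ` ?E) = 0"
    by (rule hausdorff_null_2_unit_interval) (use coding_range in blast)
  then have "Sup (insert 0 ?A) \<le> ereal 2" by (intro low) auto
  moreover have "0 \<le> Sup (insert 0 ?A)" by (rule Sup_upper) simp
  moreover have "\<exists>S\<ge>0. x = ereal S" if "x \<le> ereal 2" "0 \<le> x" for x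
    using that by (cases x) auto
  ultimately obtain S where S: "Sup (insert 0 ?A) = ereal S" "S \<ge> 0" by blast
  have "hausdorff_dim (coding T ` ?E) = S"
  proof (rule hausdorff_dim_eqI)
    fix s assume s: "s > S"
    show "hausdorff_measure s (coding T ` ?E) = 0"
    proof (rule upper_bound[OF f])
      show "s > 0" using s S(2) by linarith
      fix \<mu> assume "\<mu> \<in> invariant_measures m" "integral\<^sup>L \<mu> f = \<alpha>" "integral\<^sup>L \<mu> (geom_pot T DT) > 0"
      then have "ereal (ks_entropy \<mu> shift / integral\<^sup>L \<mu> (geom_pot T DT)) \<le> Sup (insert 0 ?A)"
        by (intro Sup_upper) blast
      then show "ks_entropy \<mu> shift / integral\<^sup>L \<mu> (geom_pot T DT) < s" using S(1) s by simp
    qed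
  next
    show "S \<le> s" if "s > 0" "hausdorff_measure s (coding T ` ?E) = 0" for s
      using low[OF that] unfolding S(1) by simp
  qed (rule S(2))
  then show ?thesis using S(1) by simp
qed

end
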